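(* Let $n\ge 3$ and let $B^{n+1}$ be the unit ball in the Euclidean space $\mathbb{R}^{n+1}$. Let $\Sigma^n \hookrightarrow B^{n+1}$ be a compact free boundary minimal hypersurface immersed in $B^{n+1}$. If either the inequality $$|A|^2 \le \frac{n^2}{4}\quad\text{or the inequality}\quad |x|^2|A|^2\le \frac{(n-2)^2}{4}$$ is satisfied on $\Sigma$, then $\Sigma$ is a totally geodesic disk $D^n$.
   Context: $|A|^2$ denotes the squared norm of the second fundamental form of $\Sigma$, and $|x|$ is the Euclidean norm of the position vector of a point of $\Sigma$. "Free boundary" means that $\partial\Sigma\subset\partial B^{n+1}$ and $\Sigma$ meets $\partial B^{n+1}$ orthogonally along $\partial\Sigma$; minimal means zero mean curvature. *)

theory Defs
  imports "HOL-Analysis.Analysis"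
begin

primrec Ck_on :: "nat \<Rightarrow> ('a::real_normed_vector \<Rightarrow> 'b::real_normed_vector) \<Rightarrow> 'a set \<Rightarrow> bool" where
  "Ck_on 0 f W \<longleftrightarrow> continuous_on W f"
| "Ck_on (Suc k) f W \<longleftrightarrow> (\<forall>x\<in>W. f differentiable (at x)) \<and>
     (\<forall>v. Ck_on k (\<lambda>x. frechet_derivative f (at x) v) W)"

(* \<open>Ck_on\<close> uses two-sided derivatives and is meant for open sets; on an arbitrary set (here:
   relatively open subsets of a half-space) smoothness means having local smooth extensions. *)
definition smooth_on :: "'a::real_normed_vector set \<Rightarrow> ('a \<Rightarrow> 'b::real_normed_vector) \<Rightarrow> bool" where
  "smooth_on S f \<longleftrightarrow> (\<forall>x\<in>S. \<exists>W g. open W \<and> x \<in> W \<and> (\<forall>k. Ck_on k g W) \<and> (\<forall>y\<in>W \<inter> S. g y = f y))"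

(* An arbitrary but fixed index: the half-space models the boundary by the vanishing of this coordinate. *)
definition bdry_coord :: "'n::finite" where
  "bdry_coord = (SOME i. True)"

definition half_space :: "(real^'n) set" where
  "half_space = {x. 0 \<le> x $ bdry_coord}"

(* A chart is a pair of its domain and its coordinate map. *)
type_synonym ('a, 'n) chart = "'a set \<times> ('a \<Rightarrow> real^'n)"

definition is_chart :: "'a topology \<Rightarrow> ('a, 'n::finite) chart \<Rightarrow> bool" where
  "is_chart M c \<longleftrightarrow> openin M (fst c) \<and>
     openin (top_of_set half_space) (snd c ` fst c) \<and>
     homeomorphic_map (subtopology M (fst c)) (top_of_set (snd c ` fst c)) (snd c)"

definition chart_inv :: "('a, 'n::finite) chart \<Rightarrow> real^'n \<Rightarrow> 'a" where
  "chart_inv c = inv_into (fst c) (snd c)"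

definition smooth_manifold_with_boundary ::
  "'a topology \<Rightarrow> ('a, 'n::finite) chart set \<Rightarrow> bool" where
  "smooth_manifold_with_boundary M \<A> \<longleftrightarrow>
     Hausdorff_space M \<and> second_countable M \<and>
     (\<forall>c\<in>\<A>. is_chart M c) \<and> (\<Union>c\<in>\<A>. fst c) = topspace M \<and>
     (\<forall>c\<in>\<A>. \<forall>d\<in>\<A>. smooth_on (snd c ` (fst c \<inter> fst d)) (snd d \<circ> chart_inv c))"

definition manifold_boundary :: "('a, 'n::finite) chart set \<Rightarrow> 'a set" where
  "manifold_boundary \<A> = {p. \<exists>c\<in>\<A>. p \<in> fst c \<and> snd c p $ bdry_coord = 0}"

(* Derivatives in coordinates are taken within the image of the chart, so that they are
   one-sided at boundary points; they are unique there because the image is relatively open in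
   the half-space. *)
definition partial_in ::
  "('a, 'n::finite) chart \<Rightarrow> 'n \<Rightarrow> (real^'n \<Rightarrow> 'e::real_normed_vector) \<Rightarrow> real^'n \<Rightarrow> 'e" where
  "partial_in c i X u = frechet_derivative X (at u within snd c ` fst c) (axis i 1)"

definition tangent_vec ::
  "('a, 'n::finite) chart \<Rightarrow> ('a \<Rightarrow> 'e::euclidean_space) \<Rightarrow> 'a \<Rightarrow> 'n \<Rightarrow> 'e" where
  "tangent_vec c F p i = partial_in c i (F \<circ> chart_inv c) (snd c p)"

definition second_partial ::
  "('a, 'n::finite) chart \<Rightarrow> ('a \<Rightarrow> 'e::euclidean_space) \<Rightarrow> 'a \<Rightarrow> 'n \<Rightarrow> 'n \<Rightarrow> 'e" where
  "second_partial c F p i j = partial_in c i (partial_in c j (F \<circ> chart_inv c)) (snd c p)"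

definition smooth_immersion ::
  "('a, 'n::finite) chart set \<Rightarrow> ('a \<Rightarrow> 'e::euclidean_space) \<Rightarrow> bool" where
  "smooth_immersion \<A> F \<longleftrightarrow>
     (\<forall>c\<in>\<A>. smooth_on (snd c ` fst c) (F \<circ> chart_inv c) \<and>
        (\<forall>p\<in>fst c. inj (frechet_derivative (F \<circ> chart_inv c) (at (snd c p) within snd c ` fst c))))"

definition metric ::
  "('a, 'n::finite) chart \<Rightarrow> ('a \<Rightarrow> 'e::euclidean_space) \<Rightarrow> 'a \<Rightarrow> real^'n^'n" where
  "metric c F p = (\<chi> i j. tangent_vec c F p i \<bullet> tangent_vec c F p j)"

definition inverse_metric ::
  "('a, 'n::finite) chart \<Rightarrow> ('a \<Rightarrow> 'e::euclidean_space) \<Rightarrow> 'a \<Rightarrow> real^'n^'n" where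
  "inverse_metric c F p = matrix_inv (metric c F p)"

(* The vector-valued second fundamental form A_ij: the component of the second partial derivative
   normal to the tangent space (Gauss formula). No choice of a unit normal is involved, so that
   non-orientable hypersurfaces are covered. *)
definition second_fundamental_form ::
  "('a, 'n::finite) chart \<Rightarrow> ('a \<Rightarrow> 'e::euclidean_space) \<Rightarrow> 'a \<Rightarrow> 'n \<Rightarrow> 'n \<Rightarrow> 'e" where
  "second_fundamental_form c F p i j =
     second_partial c F p i j -
     (\<Sum>k\<in>UNIV. \<Sum>l\<in>UNIV. (inverse_metric c F p $ k $ l *
        (second_partial c F p i j \<bullet> tangent_vec c F p l)) *\<^sub>R tangent_vec c F p k)"

(* |A|^2 = g^ik g^jl <A_ij, A_kl> *)
definition sff_norm_sq ::
  "('a, 'n::finite) chart \<Rightarrow> ('a \<Rightarrow> 'e::euclidean_space) \<Rightarrow> 'a \<Rightarrow> real" where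
  "sff_norm_sq c F p =
     (\<Sum>i\<in>UNIV. \<Sum>j\<in>UNIV. \<Sum>k\<in>UNIV. \<Sum>l\<in>UNIV.
        inverse_metric c F p $ i $ k * inverse_metric c F p $ j $ l *
        (second_fundamental_form c F p i j \<bullet> second_fundamental_form c F p k l))"

definition mean_curvature_vec ::
  "('a, 'n::finite) chart \<Rightarrow> ('a \<Rightarrow> 'e::euclidean_space) \<Rightarrow> 'a \<Rightarrow> 'e" where
  "mean_curvature_vec c F p =
     (\<Sum>i\<in>UNIV. \<Sum>j\<in>UNIV. inverse_metric c F p $ i $ j *\<^sub>R second_fundamental_form c F p i j)"

definition minimal_immersion ::
  "('a, 'n::finite) chart set \<Rightarrow> ('a \<Rightarrow> 'e::euclidean_space) \<Rightarrow> bool" where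
  "minimal_immersion \<A> F \<longleftrightarrow>
     smooth_immersion \<A> F \<and> (\<forall>c\<in>\<A>. \<forall>p\<in>fst c. mean_curvature_vec c F p = 0)"

(* At a point F p of the unit sphere, F p itself is the normal of the sphere; orthogonality says
   that every normal of the immersion at p is perpendicular to it. *)
definition free_boundary_in_ball ::
  "('a, 'n::finite) chart set \<Rightarrow> ('a \<Rightarrow> 'e::euclidean_space) \<Rightarrow> bool" where
  "free_boundary_in_ball \<A> F \<longleftrightarrow>
     F ` manifold_boundary \<A> \<subseteq> sphere 0 1 \<and>
     (\<forall>c\<in>\<A>. \<forall>p\<in>fst c \<inter> manifold_boundary \<A>. \<forall>N.
        (\<forall>i. N \<bullet> tangent_vec c F p i = 0) \<longrightarrow> N \<bullet> F p = 0)"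

definition totally_geodesic ::
  "('a, 'n::finite) chart set \<Rightarrow> ('a \<Rightarrow> 'e::euclidean_space) \<Rightarrow> bool" where
  "totally_geodesic \<A> F \<longleftrightarrow>
     (\<forall>c\<in>\<A>. \<forall>p\<in>fst c. \<forall>i j. second_fundamental_form c F p i j = 0)"

end

theory Submission
  imports Defs
begin

text \<open>
  The support function \<open>u = F \<bullet> N\<close> of a minimal hypersurface solves the Jacobi equation
  \<open>\<Delta>u + |A|\<^sup>2 u = 0\<close>, and the free boundary condition says \<open>u = 0\<close> on the boundary. Under either
  pinching condition there is a positive function \<open>w\<close> of \<open>|F|\<close>, namely \<open>exp (- n |F|\<^sup>2 / 4)\<close> or
  \<open>|F|\<close> to the power \<open>- (n - 2) / 2\<close>, with \<open>\<Delta>w + |A|\<^sup>2 w < 0\<close> wherever \<open>u\<close> does not vanish. A positive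
  maximum of \<open>u\<^sup>2 / w\<^sup>2\<close> would then contradict the second derivative test, hence \<open>u = 0\<close>.

  Now the position vector is tangent to the hypersurface, and \<open>N\<close> is constant in its direction.
  There are only finitely many zeros \<open>z\<close> of \<open>F\<close>. The product of \<open>1 - |F|\<^sup>2\<close> with
  \<open>\<Prod>\<^sub>z (1 - (N(z) \<bullet> N)\<^sup>2)\<close> vanishes on the boundary, and its radial derivative at an interior
  point is \<open>- 2 |F|\<^sup>2\<close> times the second factor; hence its maximum is \<open>0\<close>. Thus \<open>N\<close> takes finitely
  many values up to sign, and by connectedness it is constant up to sign: the image lies in a hyperplane through the origin. Finally \<open>F\<close> is an open, locally
  injective map of a compact connected space to a disk, and therefore a homeomorphism.
\<close>

subsection \<open>Smooth functions and directional derivatives\<close>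

text \<open>The constants come from completing a square. On a minimal hypersurface s = |F|^2 has
  Laplacian 2 n and squared gradient 4 (s - u^2). For the trial function exp (- k s) the Jacobi
  expression divided by the function is, where s <= 1 and u^2 > 0, less than 4 k^2 - 2 n k + n^2 / 4
  = (2 k - n / 2)^2; for s powr a with a < 0, after a further multiplication by s, it is less than
  (2 a + (n - 2) / 2)^2. Only k = n / 4 and a = - (n - 2) / 4 make these squares vanish, so the
  pinching bound is used up and strictness rests on u^2 > 0. The hypersurface may be non-orientable,
  so there need not be a global unit normal: global functions are even in N, and derivatives are
  taken of a smooth local normal whose sign is fixed at one point. As N is constant along rays, one
  could follow the radial field inwards to a zero of F. The maximum argument with the product over
  the zeros takes the place of this flow, and it also yields that a zero exists.\<close>

definition dird :: "'a::real_normed_vector \<Rightarrow> ('a \<Rightarrow> 'b::real_normed_vector) \<Rightarrow> 'a \<Rightarrow> 'b" where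
  "dird v f x = frechet_derivative f (at x) v"

definition Cinf_on :: "('a::real_normed_vector \<Rightarrow> 'b::real_normed_vector) \<Rightarrow> 'a set \<Rightarrow> bool" where
  "Cinf_on f W \<longleftrightarrow> (\<forall>k. Ck_on k f W)"

lemma Ck_on_Suc_dird:
  "Ck_on (Suc k) f W \<longleftrightarrow> (\<forall>x\<in>W. f differentiable (at x)) \<and> (\<forall>v. Ck_on k (dird v f) W)"
  by (simp add: dird_def[abs_def])

lemma dird_has_derivative:
  assumes "(f has_derivative f') (at x)" shows "dird v f x = f' v"
  unfolding dird_def using frechet_derivative_at[OF assms] by simp

lemma has_derivative_dird:
  assumes "f differentiable (at x)" shows "(f has_derivative (\<lambda>v. dird v f x)) (at x)"
  using assms unfolding dird_def by (simp add: frechet_derivative_works)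

lemma dird_cong_open:
  assumes "open W" "x \<in> W" "\<And>y. y \<in> W \<Longrightarrow> f y = g y" "f differentiable (at x)"
  shows "dird v f x = dird v g x"
  unfolding dird_def using frechet_derivative_transform_within_open[OF assms(4,1,2,3)] by simp

lemma differentiable_cong_open:
  assumes "open W" "x \<in> W" "\<And>y. y \<in> W \<Longrightarrow> f y = g y" "f differentiable (at x)"
  shows "g differentiable (at x)"
  using assms by (meson differentiable_def has_derivative_transform_within_open)

lemma Ck_on_cong:
  assumes "open W" "\<And>x. x \<in> W \<Longrightarrow> f x = g x" "Ck_on k f W"
  shows "Ck_on k g W"
  using assms(2,3)
proof (induction k arbitrary: f g)
  case 0
  then show ?case using continuous_on_cong by (metis Ck_on.simps(1))
next
  case (Suc k)
  have d: "f differentiable (at x)" if "x \<in> W" for x using Suc.prems(2) that by simp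
  have "g differentiable (at x)" if "x \<in> W" for x
    using differentiable_cong_open[OF \<open>open W\<close> that Suc.prems(1) d[OF that]] .
  moreover have "Ck_on k (dird v g) W" for v
  proof (rule Suc.IH)
    show "Ck_on k (dird v f) W" using Suc.prems(2) by (simp only: Ck_on_Suc_dird)
    show "dird v f x = dird v g x" if "x \<in> W" for x
      using dird_cong_open[OF \<open>open W\<close> that Suc.prems(1) d[OF that]] .
  qed
  ultimately show ?case by (simp only: Ck_on_Suc_dird) blast
qed

lemma Ck_on_subset: "Ck_on k f W \<Longrightarrow> V \<subseteq> W \<Longrightarrow> Ck_on k f V"
  by (induction k arbitrary: f) (auto simp del: Ck_on.simps(2) simp: Ck_on_Suc_dird intro: continuous_on_subset)

lemma Ck_on_local:
  assumes "\<And>x. x \<in> W \<Longrightarrow> \<exists>V. open V \<and> x \<in> V \<and> Ck_on k f V"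
  shows "Ck_on k f W"
  using assms
proof (induction k arbitrary: f)
  case 0
  have "isCont f x" if "x \<in> W" for x
    using 0[OF that] by (auto simp: continuous_on_eq_continuous_at)
  then show ?case by (simp add: continuous_at_imp_continuous_on)
next
  case (Suc k)
  then show ?case unfolding Ck_on_Suc_dird by meson
qed

lemma Ck_on_SucD:
  assumes "Ck_on (Suc k) f W" shows "Ck_on k f W"
  using assms
proof (induction k arbitrary: f)
  case 0
  then show ?case by (auto intro!: continuous_at_imp_continuous_on differentiable_imp_continuous_within)
next
  case (Suc k)
  then show ?case unfolding Ck_on_Suc_dird[of "Suc k"] Ck_on_Suc_dird[of k f] by blast
qed

lemma Ck_on_const: "open W \<Longrightarrow> Ck_on k (\<lambda>x. c) W"
proof (induction k arbitrary: c)
  case (Suc k)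
  have "dird v (\<lambda>x. c) = (\<lambda>x. 0)" for v
    by (rule ext) (rule dird_has_derivative, auto intro!: derivative_eq_intros)
  then show ?case unfolding Ck_on_Suc_dird using Suc by (simp add: dird_def[abs_def])
qed auto

lemma Ck_on_bounded_linear:
  assumes "open W" "bounded_linear h" "Ck_on k f W"
  shows "Ck_on k (\<lambda>x. h (f x)) W"
  using assms(3)
proof (induction k arbitrary: f)
  case 0
  then show ?case by (auto intro: bounded_linear.continuous_on[OF assms(2)])
next
  case (Suc k)
  have der: "((\<lambda>x. h (f x)) has_derivative (\<lambda>v. h (dird v f x))) (at x)" if "x \<in> W" for x
    using Suc.prems that
    by (intro bounded_linear.has_derivative[OF assms(2)] has_derivative_dird) auto
  have "Ck_on k (dird v (\<lambda>x. h (f x))) W" for v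
    by (rule Ck_on_cong[OF \<open>open W\<close> _ Suc.IH[of "dird v f"]])
      (use Suc.prems dird_has_derivative[OF der] in \<open>simp_all only: Ck_on_Suc_dird\<close>)
  then show ?case unfolding Ck_on_Suc_dird using der by (auto intro: differentiableI)
qed

lemma Ck_on_add:
  assumes "open W" "Ck_on k f W" "Ck_on k g W"
  shows "Ck_on k (\<lambda>x. f x + g x) W"
  using assms(2,3)
proof (induction k arbitrary: f g)
  case 0
  then show ?case by (auto intro: continuous_on_add)
next
  case (Suc k)
  have der: "((\<lambda>x. f x + g x) has_derivative (\<lambda>v. dird v f x + dird v g x)) (at x)" if "x \<in> W" for x
    using Suc.prems that
    by (intro has_derivative_add has_derivative_dird) auto
  have "Ck_on k (dird v (\<lambda>x. f x + g x)) W" for v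
    by (rule Ck_on_cong[OF \<open>open W\<close> _ Suc.IH[of "dird v f" "dird v g"]])
      (use Suc.prems dird_has_derivative[OF der] in \<open>simp_all only: Ck_on_Suc_dird\<close>)
  then show ?case unfolding Ck_on_Suc_dird using der by (auto intro: differentiableI)
qed

lemma Ck_on_bilinear:
  assumes "open W" "bounded_bilinear b" "Ck_on k f W" "Ck_on k g W"
  shows "Ck_on k (\<lambda>x. b (f x) (g x)) W"
  using assms(3,4)
proof (induction k arbitrary: f g)
  case 0
  then show ?case by (auto intro: bounded_bilinear.continuous_on[OF assms(2)])
next
  case (Suc k)
  have der: "((\<lambda>x. b (f x) (g x)) has_derivative (\<lambda>v. b (f x) (dird v g x) + b (dird v f x) (g x))) (at x)"
    if "x \<in> W" for x
    using Suc.prems that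
    by (intro bounded_bilinear.FDERIV[OF assms(2)] has_derivative_dird) auto
  have "Ck_on k (dird v (\<lambda>x. b (f x) (g x))) W" for v
  proof (rule Ck_on_cong[OF \<open>open W\<close>])
    show "Ck_on k (\<lambda>x. b (f x) (dird v g x) + b (dird v f x) (g x)) W"
      using Suc.prems Suc.prems[THEN Ck_on_SucD]
      by (intro Ck_on_add[OF \<open>open W\<close>] Suc.IH) (simp_all only: Ck_on_Suc_dird)
  qed (use dird_has_derivative[OF der] in simp)
  then show ?case unfolding Ck_on_Suc_dird using der by (auto intro: differentiableI)
qed

lemma Ck_on_inverse:
  fixes f :: "'a::real_normed_vector \<Rightarrow> real"
  assumes "open W" "Ck_on k f W" "\<And>x. x \<in> W \<Longrightarrow> f x \<noteq> 0"
  shows "Ck_on k (\<lambda>x. inverse (f x)) W"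
  using assms(2,3)
proof (induction k)
  case 0
  then show ?case by (auto intro: continuous_on_inverse)
next
  case (Suc k)
  have der: "((\<lambda>x. inverse (f x)) has_derivative (\<lambda>v. - (inverse (f x) * dird v f x * inverse (f x)))) (at x)"
    if "x \<in> W" for x
    using Suc.prems that
    by (intro Deriv.has_derivative_inverse has_derivative_dird) auto
  have "Ck_on k (dird v (\<lambda>x. inverse (f x))) W" for v
  proof (rule Ck_on_cong[OF \<open>open W\<close>])
    show "Ck_on k (\<lambda>x. - (inverse (f x) * dird v f x * inverse (f x))) W"
      using Suc.prems Suc.IH[OF Ck_on_SucD[OF Suc.prems(1)] Suc.prems(2)]
      by (intro Ck_on_bounded_linear[OF \<open>open W\<close>, where h = uminus]
          Ck_on_bilinear[OF \<open>open W\<close> bounded_bilinear_mult] bounded_linear_minus bounded_linear_ident) (simp_all only: Ck_on_Suc_dird)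
  qed (use dird_has_derivative[OF der] in simp)
  then show ?case unfolding Ck_on_Suc_dird using der by (auto intro: differentiableI)
qed

text \<open>The derivative of f to the power -1/2 is -1/2 times the cube of that function times the
  derivative of f. It is again a product of the function itself and \<open>dird v f\<close>, so the
  induction closes without derivatives of the square root. The lemma serves to normalise normal
  fields.\<close>

lemma Ck_on_inverse_sqrt:
  fixes f :: "'a::real_normed_vector \<Rightarrow> real"
  assumes "open W" "Ck_on k f W" "\<And>x. x \<in> W \<Longrightarrow> 0 < f x"
  shows "Ck_on k (\<lambda>x. inverse (sqrt (f x))) W"
  using assms(2,3)
proof (induction k)
  case 0
  then show ?case by (auto intro!: continuous_on_inverse continuous_on_real_sqrt simp: less_imp_neq[THEN not_sym])
next
  case (Suc k)
  define r where "r = (\<lambda>x. inverse (sqrt (f x)))"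
  have der: "(r has_derivative (\<lambda>v. - (1/2) * (r x * (r x * (r x * dird v f x))))) (at x)"
    if "x \<in> W" for x
  proof -
    have f: "(f has_derivative (\<lambda>v. dird v f x)) (at x)" and pos: "f x > 0"
      using Suc.prems that by (auto intro: has_derivative_dird)
    have "((\<lambda>x. inverse (sqrt (f x))) has_derivative
        (\<lambda>v. - (inverse (sqrt (f x)) * (dird v f x * (inverse (sqrt (f x)) / 2)) * inverse (sqrt (f x))))) (at x)"
      using pos by (intro Deriv.has_derivative_inverse has_derivative_real_sqrt f) auto
    then show ?thesis unfolding r_def by (simp add: mult_ac)
  qed
  have "Ck_on k (dird v r) W" for v
  proof (rule Ck_on_cong[OF \<open>open W\<close>])
    show "Ck_on k (\<lambda>x. - (1/2) * (r x * (r x * (r x * dird v f x)))) W"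
      using Suc.prems Suc.IH[OF Ck_on_SucD[OF Suc.prems(1)] Suc.prems(2)]
      by (intro Ck_on_bilinear[OF \<open>open W\<close> bounded_bilinear_mult] Ck_on_const \<open>open W\<close>)
        (simp_all only: Ck_on_Suc_dird r_def)
  qed (use dird_has_derivative[OF der] in simp)
  then have "Ck_on (Suc k) r W" unfolding Ck_on_Suc_dird using der by (auto intro: differentiableI)
  then show ?case by (simp only: r_def)
qed

lemma Cinf_on_dird: "Cinf_on f W \<Longrightarrow> Cinf_on (dird v f) W"
  unfolding Cinf_on_def by (metis Ck_on_Suc_dird)

lemma Cinf_on_differentiable: "Cinf_on f W \<Longrightarrow> x \<in> W \<Longrightarrow> f differentiable (at x)"
  unfolding Cinf_on_def by (metis Ck_on_Suc_dird)

lemma Cinf_on_continuous: "Cinf_on f W \<Longrightarrow> continuous_on W f"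
  unfolding Cinf_on_def by (metis Ck_on.simps(1))

lemma Cinf_on_subset: "Cinf_on f W \<Longrightarrow> V \<subseteq> W \<Longrightarrow> Cinf_on f V"
  unfolding Cinf_on_def by (metis Ck_on_subset)

lemma Cinf_on_has_derivative: "Cinf_on f W \<Longrightarrow> x \<in> W \<Longrightarrow> (f has_derivative (\<lambda>v. dird v f x)) (at x)"
  by (simp add: Cinf_on_differentiable has_derivative_dird)

lemma Cinf_on_cong:
  "open W \<Longrightarrow> (\<And>x. x \<in> W \<Longrightarrow> f x = g x) \<Longrightarrow> Cinf_on f W \<Longrightarrow> Cinf_on g W"
  unfolding Cinf_on_def by (metis Ck_on_cong)

lemma Cinf_on_const: "open W \<Longrightarrow> Cinf_on (\<lambda>x. c) W"
  unfolding Cinf_on_def by (simp add: Ck_on_const)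

lemma Cinf_on_ident: "open W \<Longrightarrow> Cinf_on (\<lambda>x. x) W"
  unfolding Cinf_on_def
proof
  fix k assume W: "open W"
  have "dird v (\<lambda>x. x) = (\<lambda>_. v)" for v :: 'a
    by (rule ext) (rule dird_has_derivative[OF has_derivative_ident])
  then show "Ck_on k (\<lambda>x :: 'a. x) W"
    by (cases k) (simp_all add: dird_def[abs_def] continuous_on_id Ck_on_const[OF W])
qed

lemma Cinf_on_add: "open W \<Longrightarrow> Cinf_on f W \<Longrightarrow> Cinf_on g W \<Longrightarrow> Cinf_on (\<lambda>x. f x + g x) W"
  unfolding Cinf_on_def by (simp add: Ck_on_add)

lemma Cinf_on_bounded_linear: "open W \<Longrightarrow> bounded_linear h \<Longrightarrow> Cinf_on f W \<Longrightarrow> Cinf_on (\<lambda>x. h (f x)) W"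
  unfolding Cinf_on_def by (simp add: Ck_on_bounded_linear)

lemma Cinf_on_minus:
  assumes "open W" "Cinf_on f W" shows "Cinf_on (\<lambda>x. - f x) W"
  by (rule Cinf_on_bounded_linear[OF assms(1) bounded_linear_minus[OF bounded_linear_ident] assms(2)])

lemma Cinf_on_diff: "open W \<Longrightarrow> Cinf_on f W \<Longrightarrow> Cinf_on g W \<Longrightarrow> Cinf_on (\<lambda>x. f x - g x) W"
  using Cinf_on_add[of W f "\<lambda>x. - g x"] Cinf_on_minus[of W g] by simp

lemma Cinf_on_bilinear:
  "open W \<Longrightarrow> bounded_bilinear b \<Longrightarrow> Cinf_on f W \<Longrightarrow> Cinf_on g W \<Longrightarrow> Cinf_on (\<lambda>x. b (f x) (g x)) W"
  unfolding Cinf_on_def by (simp add: Ck_on_bilinear)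

lemmas Cinf_on_mult = Cinf_on_bilinear[OF _ bounded_bilinear_mult]
lemmas Cinf_on_inner = Cinf_on_bilinear[OF _ bounded_bilinear_inner]
lemmas Cinf_on_scaleR = Cinf_on_bilinear[OF _ bounded_bilinear_scaleR]

lemma Cinf_on_inverse:
  fixes f :: "'a::real_normed_vector \<Rightarrow> real"
  shows "open W \<Longrightarrow> Cinf_on f W \<Longrightarrow> (\<And>x. x \<in> W \<Longrightarrow> f x \<noteq> 0) \<Longrightarrow> Cinf_on (\<lambda>x. inverse (f x)) W"
  unfolding Cinf_on_def by (simp add: Ck_on_inverse)

lemma Cinf_on_inverse_sqrt:
  fixes f :: "'a::real_normed_vector \<Rightarrow> real"
  shows "open W \<Longrightarrow> Cinf_on f W \<Longrightarrow> (\<And>x. x \<in> W \<Longrightarrow> 0 < f x) \<Longrightarrow> Cinf_on (\<lambda>x. inverse (sqrt (f x))) W"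
  unfolding Cinf_on_def by (simp add: Ck_on_inverse_sqrt)

lemma Cinf_on_sum:
  assumes "open W" "\<And>i. i \<in> I \<Longrightarrow> Cinf_on (f i) W"
  shows "Cinf_on (\<lambda>x. \<Sum>i\<in>I. f i x) W"
  using assms(2) by (induction I rule: infinite_finite_induct) (auto intro!: Cinf_on_const Cinf_on_add assms(1))

lemma Cinf_on_prod:
  fixes f :: "'i \<Rightarrow> 'a::real_normed_vector \<Rightarrow> real"
  assumes "open W" "\<And>i. i \<in> I \<Longrightarrow> Cinf_on (f i) W"
  shows "Cinf_on (\<lambda>x. \<Prod>i\<in>I. f i x) W"
  using assms(2) by (induction I rule: infinite_finite_induct) (auto intro!: Cinf_on_const Cinf_on_mult assms(1))

lemma dird_scaleR: "Cinf_on f W \<Longrightarrow> x \<in> W \<Longrightarrow> dird (c *\<^sub>R v) f x = c *\<^sub>R dird v f x"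
  using linear_cmul[OF bounded_linear.linear[OF has_derivative_bounded_linear[OF Cinf_on_has_derivative]]]
  by blast

lemma dird_sum: "Cinf_on f W \<Longrightarrow> x \<in> W \<Longrightarrow> dird (\<Sum>i\<in>I. v i) f x = (\<Sum>i\<in>I. dird (v i) f x)"
  using linear_sum[OF bounded_linear.linear[OF has_derivative_bounded_linear[OF Cinf_on_has_derivative, of f W x]]]
  by simp

lemma dird_bilinear:
  assumes "bounded_bilinear b" "Cinf_on f W" "Cinf_on g W" "x \<in> W"
  shows "dird v (\<lambda>x. b (f x) (g x)) x = b (f x) (dird v g x) + b (dird v f x) (g x)"
  by (rule dird_has_derivative, intro bounded_bilinear.FDERIV[OF assms(1)] Cinf_on_has_derivative)
    (use assms in auto)

lemmas dird_inner = dird_bilinear[OF bounded_bilinear_inner]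

lemma dird_const: "dird v (\<lambda>x. c) x = 0"
  by (rule dird_has_derivative) (auto intro!: derivative_eq_intros)

lemma dird_eq_const:
  assumes "open W" "x \<in> W" "\<And>y. y \<in> W \<Longrightarrow> f y = c"
  shows "dird v f x = 0"
  using dird_cong_open[of W x "\<lambda>_. c" f v] assms dird_const[of v c x] by auto

section \<open>Symmetry of second directional derivatives\<close>

lemma dird_line:
  assumes "Cinf_on f W" "x + t *\<^sub>R v \<in> W"
  shows "((\<lambda>t. f (x + t *\<^sub>R v)) has_vector_derivative dird v f (x + t *\<^sub>R v)) (at t)"
proof -
  have 1: "((\<lambda>t. x + t *\<^sub>R v) has_derivative (\<lambda>s. s *\<^sub>R v)) (at t)"
    by (auto intro!: derivative_eq_intros)
  from has_derivative_compose[OF 1 Cinf_on_has_derivative[OF assms]]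
  show ?thesis unfolding has_vector_derivative_def using dird_scaleR[OF assms] by simp
qed

text \<open>The mean value theorem is used twice: along \<open>v\<close> for the increment of
  \<open>f\<close> under the shift by \<open>h *\<^sub>R w\<close>, then along \<open>w\<close> for
  \<open>dird v f\<close>. The left-hand side is symmetric in \<open>v\<close> and \<open>w\<close>,
  the right-hand side a priori is not.\<close>

lemma second_difference:
  fixes f :: "'a::real_normed_vector \<Rightarrow> real"
  assumes f: "Cinf_on f W" and h: "h > 0"
    and W: "\<And>s t. s \<in> {0..h} \<Longrightarrow> t \<in> {0..h} \<Longrightarrow> x + s *\<^sub>R v + t *\<^sub>R w \<in> W"
  shows "\<exists>s\<in>{0..h}. \<exists>t\<in>{0..h}. f (x + h *\<^sub>R v + h *\<^sub>R w) - f (x + h *\<^sub>R v) - f (x + h *\<^sub>R w) + f x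
    = h * h * dird w (dird v f) (x + s *\<^sub>R v + t *\<^sub>R w)"
proof -
  define \<phi> where "\<phi> s = f ((x + h *\<^sub>R w) + s *\<^sub>R v) - f (x + s *\<^sub>R v)" for s
  have W1: "(x + h *\<^sub>R w) + s *\<^sub>R v \<in> W" "x + s *\<^sub>R v \<in> W" if "s \<in> {0..h}" for s
    using W[of s h] W[of s 0] that h by (auto simp: add_ac)
  have "(\<phi> has_vector_derivative dird v f ((x + h *\<^sub>R w) + s *\<^sub>R v) - dird v f (x + s *\<^sub>R v)) (at s)"
    if "s \<in> {0..h}" for s
    unfolding \<phi>_def using W1[OF that] by (intro has_vector_derivative_diff dird_line[OF f])
  then have "\<exists>s. 0 < s \<and> s < h \<and> \<phi> h - \<phi> 0 = (h - 0) * (dird v f ((x + h *\<^sub>R w) + s *\<^sub>R v) - dird v f (x + s *\<^sub>R v))"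
    by (intro MVT2 h) (auto simp: has_real_derivative_iff_has_vector_derivative)
  then obtain s where s: "0 < s" "s < h" "\<phi> h - \<phi> 0 = h * (dird v f ((x + h *\<^sub>R w) + s *\<^sub>R v) - dird v f (x + s *\<^sub>R v))"
    by auto
  have "((\<lambda>t. dird v f ((x + s *\<^sub>R v) + t *\<^sub>R w)) has_vector_derivative dird w (dird v f) ((x + s *\<^sub>R v) + t *\<^sub>R w)) (at t)"
    if "t \<in> {0..h}" for t
    using W[of s t] that s by (intro dird_line[OF Cinf_on_dird[OF f]]) auto
  then have "\<exists>t. 0 < t \<and> t < h \<and> dird v f ((x + s *\<^sub>R v) + h *\<^sub>R w) - dird v f ((x + s *\<^sub>R v) + 0 *\<^sub>R w)
     = (h - 0) * dird w (dird v f) ((x + s *\<^sub>R v) + t *\<^sub>R w)"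
    by (intro MVT2 h) (auto simp: has_real_derivative_iff_has_vector_derivative)
  then obtain t where t: "0 < t" "t < h" "dird v f ((x + s *\<^sub>R v) + h *\<^sub>R w) - dird v f (x + s *\<^sub>R v)
     = h * dird w (dird v f) ((x + s *\<^sub>R v) + t *\<^sub>R w)" by auto
  have "f (x + h *\<^sub>R v + h *\<^sub>R w) - f (x + h *\<^sub>R v) - f (x + h *\<^sub>R w) + f x = \<phi> h - \<phi> 0"
    by (simp add: \<phi>_def add_ac)
  also have "\<dots> = h * h * dird w (dird v f) (x + s *\<^sub>R v + t *\<^sub>R w)"
    using s(3) t(3) by (simp add: add_ac)
  finally show ?thesis using s t by (intro bexI[of _ s] bexI[of _ t]) auto
qed

lemma second_difference_tendsto:
  fixes f :: "'a::real_normed_vector \<Rightarrow> real"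
  assumes W: "open W" "x \<in> W" and f: "Cinf_on f W"
  shows "((\<lambda>h. (f (x + h *\<^sub>R v + h *\<^sub>R w) - f (x + h *\<^sub>R v) - f (x + h *\<^sub>R w) + f x) / (h * h))
    \<longlongrightarrow> dird w (dird v f) x) (at_right 0)"
proof (rule tendstoI)
  fix e :: real assume "e > 0"
  have "isCont (dird w (dird v f)) x"
    using Cinf_on_continuous[OF Cinf_on_dird[OF Cinf_on_dird[OF f]]] W
    by (auto simp: continuous_on_eq_continuous_at)
  then obtain d0 where d0: "d0 > 0" "\<And>y. dist y x < d0 \<Longrightarrow> dist (dird w (dird v f) y) (dird w (dird v f) x) < e"
    using \<open>e > 0\<close> unfolding continuous_at_eps_delta by blast
  obtain d1 where d1: "d1 > 0" "ball x d1 \<subseteq> W" using W openE by blast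
  define d where "d = min d0 d1"
  have d: "d > 0" "d \<le> d0" "d \<le> d1" using d0 d1 by (auto simp: d_def)
  \<comment> \<open>The summand 1 keeps the quotient meaningful for \<open>v = w = 0\<close> and
    makes the estimate below strict.\<close>
  define \<delta> where "\<delta> = d / (norm v + norm w + 1)"
  have "\<delta> > 0" using d by (simp add: \<delta>_def add_nonneg_pos)
  have "dist ((f (x + h *\<^sub>R v + h *\<^sub>R w) - f (x + h *\<^sub>R v) - f (x + h *\<^sub>R w) + f x) / (h * h)) (dird w (dird v f) x) < e"
    if h: "0 < h" "h < \<delta>" for h
  proof -
    have near: "dist (x + s *\<^sub>R v + t *\<^sub>R w) x < d" if "s \<in> {0..h}" "t \<in> {0..h}" for s t
    proof -
      have "dist (x + s *\<^sub>R v + t *\<^sub>R w) x = norm (s *\<^sub>R v + t *\<^sub>R w)" by (simp add: dist_norm)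
      also have "\<dots> \<le> \<bar>s\<bar> * norm v + \<bar>t\<bar> * norm w" by (metis norm_scaleR norm_triangle_ineq)
      also have "\<dots> \<le> h * norm v + h * norm w" using that by (intro add_mono mult_right_mono) auto
      also have "\<dots> = h * (norm v + norm w)" by (simp add: algebra_simps)
      also have "\<dots> < h * (norm v + norm w + 1)" using h by simp
      also have "\<dots> < d" using h by (simp add: \<delta>_def pos_less_divide_eq add_nonneg_pos)
      finally show ?thesis .
    qed
    have inW: "x + s *\<^sub>R v + t *\<^sub>R w \<in> W" if "s \<in> {0..h}" "t \<in> {0..h}" for s t
      using near[OF that] d d1 by (auto simp: dist_commute subset_eq)
    obtain s t where st: "s \<in> {0..h}" "t \<in> {0..h}"
      "f (x + h *\<^sub>R v + h *\<^sub>R w) - f (x + h *\<^sub>R v) - f (x + h *\<^sub>R w) + f x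
        = h * h * dird w (dird v f) (x + s *\<^sub>R v + t *\<^sub>R w)"
      using second_difference[OF f h(1) inW] by auto
    then show ?thesis using h d0(2)[of "x + s *\<^sub>R v + t *\<^sub>R w"] near[OF st(1,2)] d by simp
  qed
  then show "\<forall>\<^sub>F h in at_right 0. dist ((f (x + h *\<^sub>R v + h *\<^sub>R w) - f (x + h *\<^sub>R v) - f (x + h *\<^sub>R w) + f x) / (h * h)) (dird w (dird v f) x) < e"
    using \<open>\<delta> > 0\<close> unfolding eventually_at_right_field by auto
qed

text \<open>Both iterated derivatives are limits of the same second difference quotient, which does
  not change when \<open>v\<close> and \<open>w\<close> are exchanged.\<close>

lemma dird_commute_real:
  fixes f :: "'a::real_normed_vector \<Rightarrow> real"
  assumes W: "open W" "x \<in> W" and f: "Cinf_on f W"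
  shows "dird w (dird v f) x = dird v (dird w f) x"
proof (rule tendsto_unique[OF _ second_difference_tendsto[OF assms]])
  have eq: "f (x + h *\<^sub>R v + h *\<^sub>R w) - f (x + h *\<^sub>R v) - f (x + h *\<^sub>R w) + f x =
    f (x + h *\<^sub>R w + h *\<^sub>R v) - f (x + h *\<^sub>R w) - f (x + h *\<^sub>R v) + f x" for h
    by (simp add: add_ac)
  show "((\<lambda>h. (f (x + h *\<^sub>R v + h *\<^sub>R w) - f (x + h *\<^sub>R v) - f (x + h *\<^sub>R w) + f x) / (h * h))
    \<longlongrightarrow> dird v (dird w f) x) (at_right 0)"
    unfolding eq by (rule second_difference_tendsto[OF assms])
qed auto

lemma dird_commute:
  fixes f :: "'a::real_normed_vector \<Rightarrow> 'b::euclidean_space"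
  assumes W: "open W" "x \<in> W" and f: "Cinf_on f W"
  shows "dird w (dird v f) x = dird v (dird w f) x"
proof (rule euclidean_eqI)
  fix b :: 'b assume "b \<in> Basis"
  have in1: "dird u (\<lambda>y. f y \<bullet> b) y = dird u f y \<bullet> b" if "y \<in> W" for u y
    using dird_inner[OF f Cinf_on_const[OF W(1)] that] by (simp add: dird_const)
  have in2: "dird u' (dird u (\<lambda>y. f y \<bullet> b)) x = dird u' (dird u f) x \<bullet> b" for u u'
  proof -
    have "dird u' (dird u (\<lambda>y. f y \<bullet> b)) x = dird u' (\<lambda>y. dird u f y \<bullet> b) x"
      by (rule dird_cong_open[OF W in1 Cinf_on_differentiable])
        (auto intro!: Cinf_on_dird Cinf_on_inner f Cinf_on_const W)
    also have "\<dots> = dird u' (dird u f) x \<bullet> b"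
      using dird_inner[OF Cinf_on_dird[OF f] Cinf_on_const[OF W(1)] W(2)] by (simp add: dird_const)
    finally show ?thesis .
  qed
  show "dird w (dird v f) x \<bullet> b = dird v (dird w f) x \<bullet> b"
    using dird_commute_real[OF W, of "\<lambda>y. f y \<bullet> b" w v] in2
      Cinf_on_inner[OF W(1) f Cinf_on_const[OF W(1)]] by simp
qed

subsection \<open>The Jacobi equation of the support function\<close>

text \<open>The \<open>e i\<close> are constant directions in the parameter domain whose images are
  orthonormal at \<open>x\<close> only; elsewhere the metric varies, so its inverse \<open>h\<close>
  is carried along on all of \<open>W\<close>. Minimality is demanded on a neighbourhood because it
  gets differentiated at \<open>x\<close>. The field \<open>N\<close> is a local smooth unit
  normal.\<close>

locale minimal_frame =
  fixes W :: "'a::real_normed_vector set" and x :: 'a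
    and G N :: "'a \<Rightarrow> 'b::euclidean_space"
    and e :: "'i::finite \<Rightarrow> 'a"
    and h :: "'i \<Rightarrow> 'i \<Rightarrow> 'a \<Rightarrow> real"
  assumes W: "open W" "x \<in> W"
    and G: "Cinf_on G W" and N: "Cinf_on N W" and h: "\<And>i j. Cinf_on (h i j) W"
    and unit: "\<And>y. y \<in> W \<Longrightarrow> N y \<bullet> N y = 1"
    and normal: "\<And>y i. y \<in> W \<Longrightarrow> N y \<bullet> dird (e i) G y = 0"
    and h_inverse: "\<And>y i j. y \<in> W \<Longrightarrow>
      (\<Sum>k\<in>UNIV. h i k y * (dird (e k) G y \<bullet> dird (e j) G y)) = (if i = j then 1 else 0)"
    and minimal: "\<And>y. y \<in> W \<Longrightarrow>
      (\<Sum>i\<in>UNIV. \<Sum>j\<in>UNIV. h i j y * (N y \<bullet> dird (e i) (dird (e j) G) y)) = 0"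
    and orthonormal: "\<And>i j. dird (e i) G x \<bullet> dird (e j) G x = (if i = j then 1 else 0)"
    and expansion: "\<And>v. v = (\<Sum>i\<in>UNIV. (v \<bullet> dird (e i) G x) *\<^sub>R dird (e i) G x) + (v \<bullet> N x) *\<^sub>R N x"
begin

definition G1 :: "'i \<Rightarrow> 'a \<Rightarrow> 'b" where "G1 i = dird (e i) G"
definition G2 :: "'i \<Rightarrow> 'i \<Rightarrow> 'a \<Rightarrow> 'b" where "G2 i j = dird (e i) (G1 j)"
definition N1 :: "'i \<Rightarrow> 'a \<Rightarrow> 'b" where "N1 i = dird (e i) N"

definition b :: "'i \<Rightarrow> 'i \<Rightarrow> real" where "b i j = N x \<bullet> G2 i j x"

text \<open>Trace of the Christoffel symbols at \<open>x\<close>: the Laplacian of a function there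
  is the sum of its second derivatives along the \<open>e i\<close> minus the sum of
  \<open>tension k\<close> times its derivative along \<open>e k\<close>.\<close>

definition tension :: "'i \<Rightarrow> real" where "tension k = (\<Sum>i\<in>UNIV. G2 i i x \<bullet> G1 k x)"

lemma smooth: "Cinf_on (G1 i) W" "Cinf_on (G2 i j) W" "Cinf_on (N1 i) W"
  unfolding G1_def G2_def N1_def by (intro Cinf_on_dird G N)+

lemma expansion': "v = (\<Sum>i\<in>UNIV. (v \<bullet> G1 i x) *\<^sub>R G1 i x) + (v \<bullet> N x) *\<^sub>R N x"
  using expansion unfolding G1_def .

lemma eqI:
  assumes "\<And>c. v \<bullet> G1 c x = w \<bullet> G1 c x" "v \<bullet> N x = w \<bullet> N x" shows "v = w"
  using expansion'[of v] expansion'[of w] assms by simp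

lemma G2_commute: "y \<in> W \<Longrightarrow> G2 i j y = G2 j i y"
  unfolding G2_def G1_def by (rule dird_commute[OF W(1) _ G])

lemma b_commute: "b i j = b j i"
  unfolding b_def using G2_commute[OF W(2)] by simp

lemma G3_commute: "dird (e a) (G2 a c) x = dird (e c) (G2 a a) x"
proof -
  have "dird (e a) (G2 a c) x = dird (e a) (G2 c a) x"
    using W G2_commute smooth(2) by (intro dird_cong_open[of W] Cinf_on_differentiable) auto
  also have "\<dots> = dird (e c) (G2 a a) x"
    unfolding G2_def[of c a] G2_def[of a a] by (rule dird_commute[OF W smooth(1)])
  finally show ?thesis .
qed

text \<open>The Weingarten equation, from differentiating
  \<open>N y \<bullet> G1 c y = 0\<close>.\<close>

lemma normal1: "y \<in> W \<Longrightarrow> N1 a y \<bullet> G1 c y = - (N y \<bullet> G2 a c y)"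
  using dird_eq_const[OF W(1) _ normal[of _ c], where x=y and v="e a"] dird_inner[OF N smooth(1)[of c], where x=y and v="e a"]
  by (simp add: G1_def G2_def N1_def)

lemma N1_normal: "y \<in> W \<Longrightarrow> N1 a y \<bullet> N y = 0"
  using dird_eq_const[OF W(1) _ unit, where x=y and v="e a"] dird_inner[OF N N, where x=y and v="e a"]
  by (simp add: N1_def inner_commute)

lemma N2_normal: "dird (e a) (N1 a) x \<bullet> N x = - (N1 a x \<bullet> N1 a x)"
  using dird_eq_const[OF W N1_normal[of _ a], where v="e a"] dird_inner[OF smooth(3)[of a] N W(2), where v="e a"]
  by (simp add: N1_def inner_commute)

text \<open>The Weingarten equation is differentiated once more. \<open>G3_commute\<close> moves the
  index \<open>c\<close> to the outside, so that the trace over \<open>a\<close> can be compared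
  with the derivative of the minimality equation.\<close>

lemma N2_tangent:
  "dird (e a) (N1 a) x \<bullet> G1 c x = - 2 * (N1 a x \<bullet> G2 a c x) - N x \<bullet> dird (e c) (G2 a a) x"
proof -
  have "dird (e a) (\<lambda>y. N1 a y \<bullet> G1 c y + N y \<bullet> G2 a c y) x = 0"
    using normal1 by (intro dird_eq_const[OF W]) auto
  moreover have "dird (e a) (\<lambda>y. N1 a y \<bullet> G1 c y + N y \<bullet> G2 a c y) x =
      (N1 a x \<bullet> G2 a c x + dird (e a) (N1 a) x \<bullet> G1 c x) + (N x \<bullet> dird (e a) (G2 a c) x + N1 a x \<bullet> G2 a c x)"
    unfolding N1_def[of a] G2_def[of a c]
    by (intro dird_has_derivative has_derivative_add bounded_bilinear.FDERIV[OF bounded_bilinear_inner]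
        Cinf_on_has_derivative[of _ W] Cinf_on_dird smooth N W)
  ultimately show ?thesis using G3_commute[of a c] by simp
qed

lemma h_at: "h i j x = (if i = j then 1 else 0)"
  using h_inverse[OF W(2), of i j] by (simp add: orthonormal if_distrib cong: if_cong)

text \<open>Differentiation of the identity "inverse metric times metric is 1". Both factors are the
  identity at \<open>x\<close>, so the derivative of \<open>h\<close> is minus that of the metric,
  whose two terms come from the product rule.\<close>

lemma dird_h: "dird (e c) (h i j) x = - (G2 c i x \<bullet> G1 j x + G1 i x \<bullet> G2 c j x)"
proof -
  have "0 = dird (e c) (\<lambda>y. \<Sum>k\<in>UNIV. h i k y * (G1 k y \<bullet> G1 j y)) x"
    using dird_eq_const[OF W h_inverse[of _ i j], where v="e c"] by (simp add: G1_def)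
  also have "\<dots> = (\<Sum>k\<in>UNIV. h i k x * (G1 k x \<bullet> G2 c j x + G2 c k x \<bullet> G1 j x)
      + dird (e c) (h i k) x * (G1 k x \<bullet> G1 j x))"
    unfolding G2_def
    by (intro dird_has_derivative has_derivative_sum bounded_bilinear.FDERIV[OF bounded_bilinear_inner]
         bounded_bilinear.FDERIV[OF bounded_bilinear_mult] Cinf_on_has_derivative[of _ W] smooth h W)
  also have "\<dots> = (G1 i x \<bullet> G2 c j x + G2 c i x \<bullet> G1 j x) + dird (e c) (h i j) x"
    by (simp add: h_at G1_def orthonormal sum.distrib if_distrib[of "\<lambda>u. _ * u"] if_distrib[of "\<lambda>u. u * _"] cong: if_cong)
  finally show ?thesis by simp
qed

lemma minimal_at: "(\<Sum>i\<in>UNIV. b i i) = 0"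
  using minimal[OF W(2)] by (simp add: b_def h_at G2_def G1_def if_distrib[of "\<lambda>u. u * _"] cong: if_cong)

text \<open>The derivative of the vanishing mean curvature. The factor 2 arises because the two
  terms of \<open>dird_h\<close> contribute equally, by the symmetry of \<open>b\<close>.\<close>

lemma dird_minimal:
  "(\<Sum>i\<in>UNIV. N x \<bullet> dird (e c) (G2 i i) x) =
    2 * (\<Sum>i\<in>UNIV. \<Sum>j\<in>UNIV. (G2 c i x \<bullet> G1 j x) * b i j) - (\<Sum>i\<in>UNIV. N1 c x \<bullet> G2 i i x)"
proof -
  have "0 = dird (e c) (\<lambda>y. \<Sum>i\<in>UNIV. \<Sum>j\<in>UNIV. h i j y * (N y \<bullet> G2 i j y)) x"
    using dird_eq_const[OF W minimal, where v="e c"] by (simp add: G2_def G1_def)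
  also have "\<dots> = (\<Sum>i\<in>UNIV. \<Sum>j\<in>UNIV. h i j x * (N x \<bullet> dird (e c) (G2 i j) x + N1 c x \<bullet> G2 i j x)
      + dird (e c) (h i j) x * (N x \<bullet> G2 i j x))"
    unfolding N1_def
    by (intro dird_has_derivative has_derivative_sum bounded_bilinear.FDERIV[OF bounded_bilinear_inner]
         bounded_bilinear.FDERIV[OF bounded_bilinear_mult] Cinf_on_has_derivative[of _ W] smooth h N W)
  also have "\<dots> = (\<Sum>i\<in>UNIV. N x \<bullet> dird (e c) (G2 i i) x) + (\<Sum>i\<in>UNIV. N1 c x \<bullet> G2 i i x)
      - ((\<Sum>i\<in>UNIV. \<Sum>j\<in>UNIV. (G2 c i x \<bullet> G1 j x) * b i j)
      + (\<Sum>i\<in>UNIV. \<Sum>j\<in>UNIV. (G2 c j x \<bullet> G1 i x) * b i j))"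
    by (simp add: dird_h h_at b_def[symmetric] sum.distrib if_distrib[of "\<lambda>u. u * _"] sum_negf[symmetric]
        algebra_simps sum_subtractf inner_commute cong: if_cong)
  also have "(\<Sum>i\<in>UNIV. \<Sum>j\<in>UNIV. (G2 c j x \<bullet> G1 i x) * b i j) = (\<Sum>i\<in>UNIV. \<Sum>j\<in>UNIV. (G2 c i x \<bullet> G1 j x) * b i j)"
    by (subst sum.swap) (simp add: b_commute)
  finally show ?thesis by simp
qed

lemma N1_expansion: "N1 a x = - (\<Sum>c\<in>UNIV. b a c *\<^sub>R G1 c x)"
  using expansion'[of "N1 a x"] by (simp add: N1_normal normal1 W b_def sum_negf)

text \<open>The traced second derivative has no normal part because the trace of \<open>b\<close>
  vanishes.\<close>

lemma tension_G: "(\<Sum>i\<in>UNIV. G2 i i x) = (\<Sum>k\<in>UNIV. tension k *\<^sub>R G1 k x)"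
proof -
  have "(\<Sum>i\<in>UNIV. G2 i i x) \<bullet> N x = 0"
    using minimal_at by (simp add: b_def inner_sum_right inner_commute[of _ "N x"])
  then show ?thesis
    using expansion'[of "\<Sum>i\<in>UNIV. G2 i i x"] by (simp add: inner_sum_left tension_def)
qed

text \<open>Codazzi, in the form of the symmetry of third derivatives, cancels all terms except the
  tangential drift \<open>tension\<close>, which is due to the coordinates not being harmonic.\<close>
lemma laplacian_N:
  "(\<Sum>a\<in>UNIV. dird (e a) (N1 a) x) =
    (\<Sum>k\<in>UNIV. tension k *\<^sub>R N1 k x) - (\<Sum>i\<in>UNIV. \<Sum>j\<in>UNIV. (b i j)\<^sup>2) *\<^sub>R N x"
proof (rule eqI)
  fix c
  have 1: "N1 a x \<bullet> G2 a c x = - (\<Sum>d\<in>UNIV. (G2 c a x \<bullet> G1 d x) * b a d)" for a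
    unfolding N1_expansion
    by (simp add: inner_sum_left G2_commute[OF W(2), of a c] inner_commute[of "G2 c a x"] mult.commute)
  \<comment> \<open>Tracing \<open>N2_tangent\<close> produces twice a double sum, which is removed
    by inserting \<open>dird_minimal\<close>; only the last sum of \<open>dird_minimal\<close> is
    left.\<close>
  have "(\<Sum>a\<in>UNIV. dird (e a) (N1 a) x) \<bullet> G1 c x = N1 c x \<bullet> (\<Sum>i\<in>UNIV. G2 i i x)"
    by (simp add: inner_sum_left inner_sum_right N2_tangent sum_subtractf sum_distrib_left[symmetric]
         sum_negf 1 dird_minimal)
  also have "\<dots> = (\<Sum>k\<in>UNIV. tension k * (N1 k x \<bullet> G1 c x))"
    by (simp add: tension_G inner_sum_right normal1 W G2_commute[OF W(2), of c])
  also have "\<dots> = ((\<Sum>k\<in>UNIV. tension k *\<^sub>R N1 k x) - (\<Sum>i\<in>UNIV. \<Sum>j\<in>UNIV. (b i j)\<^sup>2) *\<^sub>R N x) \<bullet> G1 c x"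
    using normal[OF W(2), of c] by (simp add: inner_diff_left inner_sum_left G1_def)
  finally show "(\<Sum>a\<in>UNIV. dird (e a) (N1 a) x) \<bullet> G1 c x = \<dots>" .
next
  have "N1 a x \<bullet> N1 a x = (\<Sum>c\<in>UNIV. (b a c)\<^sup>2)" for a
  proof -
    have "N1 a x \<bullet> N1 a x = - (\<Sum>c\<in>UNIV. b a c * (N1 a x \<bullet> G1 c x))"
      by (subst (2) N1_expansion) (simp add: inner_sum_right)
    then show ?thesis by (simp add: normal1 W b_def power2_eq_square sum_negf)
  qed
  then show "(\<Sum>a\<in>UNIV. dird (e a) (N1 a) x) \<bullet> N x
    = ((\<Sum>k\<in>UNIV. tension k *\<^sub>R N1 k x) - (\<Sum>i\<in>UNIV. \<Sum>j\<in>UNIV. (b i j)\<^sup>2) *\<^sub>R N x) \<bullet> N x"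
    by (simp add: inner_diff_left inner_sum_left N2_normal N1_normal W unit sum_negf)
qed

end

section \<open>Second derivative test at a touching point\<close>

lemma local_max_second_derivative:
  fixes f f' :: "real \<Rightarrow> real"
  assumes d: "d > 0" and f: "\<And>t. \<bar>t\<bar> < d \<Longrightarrow> (f has_real_derivative f' t) (at t)"
    and f': "(f' has_real_derivative c) (at 0)"
    and max: "\<And>t. \<bar>t\<bar> < d \<Longrightarrow> f t \<le> f 0"
  shows "f' 0 = 0" "c \<le> 0"
proof -
  show z: "f' 0 = 0"
    by (rule DERIV_local_max[OF f[of 0] d]) (use d max in auto)
  show "c \<le> 0"
  \<comment> \<open>If \<open>c > 0\<close>, then \<open>f'\<close> is positive just to the right of
    0 because \<open>f' 0 = 0\<close>, and by the mean value theorem \<open>f\<close> exceeds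
    \<open>f 0\<close> there.\<close>
  proof (rule ccontr)
    assume "\<not> c \<le> 0"
    then obtain r where r: "r > 0" "\<And>t. 0 < t \<Longrightarrow> t < r \<Longrightarrow> f' 0 < f' (0 + t)"
      using DERIV_pos_inc_right[OF f'] by force
    define t where "t = min d r / 2"
    have t: "0 < t" "t < d" "t < r" using d r by (auto simp: t_def)
    have "\<exists>z. 0 < z \<and> z < t \<and> f t - f 0 = (t - 0) * f' z"
      using t by (intro MVT2 f) auto
    then obtain z where "0 < z" "z < t" "f t - f 0 = t * f' z" by auto
    then have "f t - f 0 > 0" using r(2)[of z] t z by simp
    then show False using max[of t] t by simp
  qed
qed

context minimal_frame
begin

text \<open>At \<open>x\<close> the support function touches the barrier
  \<open>\<Lambda> * \<phi> (G y \<bullet> G y)\<close> from below. Along each \<open>e a\<close>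
  the first derivatives agree and the second ones are ordered. Summing over \<open>a\<close>
  compares the Laplacians, since the drift terms with \<open>tension\<close> contain only first
  derivatives and cancel. The positive factor \<open>\<Lambda>\<close> is divided out at the
  end.\<close>

lemma support_function_max:
  fixes \<phi> \<phi>' \<phi>'' :: "real \<Rightarrow> real"
  assumes \<phi>: "\<And>t. t > 0 \<Longrightarrow> (\<phi> has_real_derivative \<phi>' t) (at t)"
    and \<phi>': "\<And>t. t > 0 \<Longrightarrow> (\<phi>' has_real_derivative \<phi>'' t) (at t)"
    and pos: "G x \<bullet> N x > 0" "\<Lambda> > 0"
    and le: "\<And>y. y \<in> W \<Longrightarrow> G y \<bullet> N y \<le> \<Lambda> * \<phi> (G y \<bullet> G y)"
    and eq: "G x \<bullet> N x = \<Lambda> * \<phi> (G x \<bullet> G x)"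
  shows "4 * \<phi>'' (G x \<bullet> G x) * (G x \<bullet> G x - (G x \<bullet> N x)\<^sup>2) + 2 * CARD('i) * \<phi>' (G x \<bullet> G x)
    + (\<Sum>i\<in>UNIV. \<Sum>j\<in>UNIV. (b i j)\<^sup>2) * \<phi> (G x \<bullet> G x) \<ge> 0"
proof -
  define s where "s y = G y \<bullet> G y" for y
  define u where "u y = G y \<bullet> N y" for y
  have sm: "Cinf_on s W" "Cinf_on u W"
    unfolding s_def[abs_def] u_def[abs_def] by (intro Cinf_on_inner W G N)+
  have s1: "dird (e a) s y = 2 * (G y \<bullet> G1 a y)" if "y \<in> W" for a y
    using dird_inner[OF G G that, where v="e a"] by (simp add: s_def[abs_def] G1_def inner_commute)
  have u1: "dird (e a) u y = G y \<bullet> N1 a y" if "y \<in> W" for a y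
    using dird_inner[OF G N that, where v="e a"] normal[OF that, of a]
    by (simp add: u_def[abs_def] N1_def inner_commute)
  have s2: "dird (e a) (dird (e a) s) x = 2 + 2 * (G x \<bullet> G2 a a x)" for a
  proof -
    have "dird (e a) (dird (e a) s) x = dird (e a) (\<lambda>y. 2 * (G y \<bullet> G1 a y)) x"
      by (intro dird_cong_open[OF W s1] Cinf_on_differentiable[OF _ W(2)] Cinf_on_dird sm)
    also have "\<dots> = 2 * (G x \<bullet> G2 a a x + G1 a x \<bullet> G1 a x)"
      unfolding G2_def[of a] G1_def[of a]
      by (intro dird_has_derivative has_derivative_mult_right bounded_bilinear.FDERIV[OF bounded_bilinear_inner]
         Cinf_on_has_derivative[of _ W] Cinf_on_dird G W)
    finally show ?thesis using orthonormal[of a a] by (simp add: G1_def)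
  qed
  have u2: "dird (e a) (dird (e a) u) x = - b a a + G x \<bullet> dird (e a) (N1 a) x" for a
  proof -
    have "dird (e a) (dird (e a) u) x = dird (e a) (\<lambda>y. G y \<bullet> N1 a y) x"
      by (intro dird_cong_open[OF W u1] Cinf_on_differentiable[OF _ W(2)] Cinf_on_dird sm)
    also have "\<dots> = G x \<bullet> dird (e a) (N1 a) x + G1 a x \<bullet> N1 a x"
      using dird_inner[OF G smooth(3)[of a] W(2), where v="e a"] by (simp add: G1_def)
    finally show ?thesis using normal1[OF W(2), of a a] by (simp add: b_def inner_commute)
  qed
  have "s x > 0"
  proof -
    have "G x \<noteq> 0" using pos(1) by auto
    then show ?thesis by (simp add: s_def)
  qed
  obtain r where r: "r > 0" "ball x r \<subseteq> W" using W openE by blast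
  have "isCont s x" using Cinf_on_continuous[OF sm(1)] W by (simp add: continuous_on_eq_continuous_at)
  then obtain r' where r': "r' > 0" "\<And>y. dist y x < r' \<Longrightarrow> dist (s y) (s x) < s x"
    using \<open>s x > 0\<close> unfolding continuous_at_eps_delta by blast
  have test: "dird (e a) u x = \<Lambda> * (\<phi>' (s x) * dird (e a) s x) \<and>
      dird (e a) (dird (e a) u) x - \<Lambda> * (\<phi>'' (s x) * (dird (e a) s x)\<^sup>2 + \<phi>' (s x) * dird (e a) (dird (e a) s) x) \<le> 0" for a
  proof -
    define c where "c t = x + t *\<^sub>R e a" for t :: real
    \<comment> \<open>Small enough for the segment to stay in \<open>W\<close> and for
      \<open>s\<close> to stay positive on it, where \<open>\<phi>\<close> is
      differentiable.\<close>
    define d where "d = min r r' / (norm (e a) + 1)"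
    have d: "d > 0" using r(1) r'(1) by (simp add: d_def add_nonneg_pos)
    have near: "dist (c t) x < min r r'" if "\<bar>t\<bar> < d" for t
    proof -
      have "dist (c t) x = \<bar>t\<bar> * norm (e a)" by (simp add: c_def dist_norm)
      also have "\<dots> \<le> \<bar>t\<bar> * (norm (e a) + 1)" by (intro mult_left_mono) auto
      also have "\<dots> < min r r'" using that by (simp add: d_def pos_less_divide_eq add_nonneg_pos)
      finally show ?thesis .
    qed
    have cW: "c t \<in> W" and spos: "s (c t) > 0" if "\<bar>t\<bar> < d" for t
      using near[OF that] r(2) r'(2)[of "c t"] by (auto simp: dist_commute dist_real_def subset_eq)
    have line: "((\<lambda>t. f (c t)) has_real_derivative dird (e a) f (c t)) (at t)"
      if "\<bar>t\<bar> < d" "Cinf_on f W" for t and f :: "'a \<Rightarrow> real"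
      using dird_line[OF that(2), of x t "e a"] cW[OF that(1)]
      by (simp add: c_def has_real_derivative_iff_has_vector_derivative)
    have c0: "c 0 = x" by (simp add: c_def)
    define f where "f t = u (c t) - \<Lambda> * \<phi> (s (c t))" for t
    define f' where "f' t = dird (e a) u (c t) - \<Lambda> * (\<phi>' (s (c t)) * dird (e a) s (c t))" for t
    have 1: "(f has_real_derivative f' t) (at t)" if "\<bar>t\<bar> < d" for t
      unfolding f_def[abs_def] f'_def
      by (intro derivative_intros DERIV_cmult line[OF that sm(2)]
          DERIV_chain2[OF \<phi>[OF spos[OF that]] line[OF that sm(1)]])
    have 2: "(f' has_real_derivative (dird (e a) (dird (e a) u) x -
       \<Lambda> * (\<phi>' (s x) * dird (e a) (dird (e a) s) x + (\<phi>'' (s x) * dird (e a) s x) * dird (e a) s x))) (at 0)"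
    proof -
      have d0: "\<bar>0\<bar> < d" using d by simp
      show ?thesis
        unfolding f'_def[abs_def]
        by (rule DERIV_diff[OF line[OF d0 Cinf_on_dird[OF sm(2)], unfolded c0] DERIV_cmult[OF
           DERIV_mult'[OF DERIV_chain2[OF \<phi>'[OF spos[OF d0]] line[OF d0 sm(1)]] line[OF d0 Cinf_on_dird[OF sm(1)]], unfolded c0]]])
    qed
    have 3: "f t \<le> f 0" if "\<bar>t\<bar> < d" for t
      using le[OF cW[OF that]] eq by (simp add: f_def s_def u_def c0)
    show ?thesis using local_max_second_derivative[OF d 1 2 3]
      by (simp add: f'_def c0 power2_eq_square algebra_simps)
  qed
  \<comment> \<open>The Jacobi equation with the drift still present: \<open>laplacian_N\<close> is
    paired with \<open>G x\<close>, and the trace of \<open>b\<close> drops out.\<close>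
  have Su: "(\<Sum>a\<in>UNIV. dird (e a) (dird (e a) u) x) = (\<Sum>k\<in>UNIV. tension k * dird (e k) u x)
     - (\<Sum>i\<in>UNIV. \<Sum>j\<in>UNIV. (b i j)\<^sup>2) * u x"
    unfolding u2 sum.distrib sum_negf minimal_at inner_sum_right[symmetric] laplacian_N
    by (simp add: inner_diff_right inner_sum_right u1 W u_def)
  \<comment> \<open>Up to the drift, the squared distance to the origin has constant Laplacian on a
    minimal hypersurface: twice the dimension.\<close>
  have Ss: "(\<Sum>a\<in>UNIV. dird (e a) (dird (e a) s) x) = 2 * CARD('i) + (\<Sum>k\<in>UNIV. tension k * dird (e k) s x)"
    unfolding s2 sum.distrib sum_distrib_left[symmetric] inner_sum_right[symmetric] tension_G
    by (simp add: inner_sum_right s1 W sum_distrib_left mult_ac)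
  \<comment> \<open>Half the gradient of \<open>s\<close> is the tangential part of
    \<open>G x\<close>, whose squared length is \<open>s x\<close> minus the square of the normal
    component.\<close>
  have Sg: "(\<Sum>a\<in>UNIV. (dird (e a) s x)\<^sup>2) = 4 * (s x - (u x)\<^sup>2)"
  proof -
    have "s x = (\<Sum>i\<in>UNIV. (G x \<bullet> G1 i x)\<^sup>2) + (u x)\<^sup>2"
      unfolding s_def by (subst (2) expansion'[of "G x"])
        (simp add: inner_add_right inner_sum_right power2_eq_square u_def)
    then show ?thesis by (simp add: s1 W sum_distrib_left[symmetric] power_mult_distrib)
  qed
  have "0 \<ge> (\<Sum>a\<in>UNIV. dird (e a) (dird (e a) u) x - \<Lambda> * (\<phi>'' (s x) * (dird (e a) s x)\<^sup>2 + \<phi>' (s x) * dird (e a) (dird (e a) s) x))"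
    by (rule sum_nonpos) (use test in blast)
  also have "(\<Sum>a\<in>UNIV. dird (e a) (dird (e a) u) x - \<Lambda> * (\<phi>'' (s x) * (dird (e a) s x)\<^sup>2 + \<phi>' (s x) * dird (e a) (dird (e a) s) x))
    = (\<Sum>k\<in>UNIV. tension k * dird (e k) u x) - (\<Sum>i\<in>UNIV. \<Sum>j\<in>UNIV. (b i j)\<^sup>2) * u x
      - \<Lambda> * (\<phi>'' (s x) * (4 * (s x - (u x)\<^sup>2)) + \<phi>' (s x) * (2 * CARD('i) + (\<Sum>k\<in>UNIV. tension k * dird (e k) s x)))"
    unfolding sum_subtractf sum_distrib_left[symmetric] sum.distrib Su Ss Sg ..
  also have "(\<Sum>k\<in>UNIV. tension k * dird (e k) u x) = \<Lambda> * (\<phi>' (s x) * (\<Sum>k\<in>UNIV. tension k * dird (e k) s x))"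
    by (simp add: test sum_distrib_left mult_ac)
  also have "u x = \<Lambda> * \<phi> (s x)" using eq by (simp add: u_def s_def)
  finally have "0 \<le> \<Lambda> * (4 * \<phi>'' (s x) * (s x - (u x)\<^sup>2) + 2 * CARD('i) * \<phi>' (s x) + (\<Sum>i\<in>UNIV. \<Sum>j\<in>UNIV. (b i j)\<^sup>2) * \<phi> (s x))"
    using eq by (simp add: u_def s_def algebra_simps)
  then show ?thesis using pos(2) by (simp add: zero_le_mult_iff s_def u_def)
qed

end

subsection \<open>Gram matrices and hyperplanes\<close>

definition lin_indep_family :: "('n::finite \<Rightarrow> 'b::real_vector) \<Rightarrow> bool" where
  "lin_indep_family t \<longleftrightarrow> (\<forall>c. (\<Sum>i\<in>UNIV. c i *\<^sub>R t i) = 0 \<longrightarrow> (\<forall>i. c i = 0))"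

definition gram :: "('n::finite \<Rightarrow> 'b::real_inner) \<Rightarrow> real^'n^'n" where
  "gram t = (\<chi> i j. t i \<bullet> t j)"

text \<open>Orthogonal projection to the span of an independent family, in the shape of the term
  subtracted in \<open>second_fundamental_form\<close>, where the metric is the Gram matrix of the
  tangent vectors.\<close>

definition tangential :: "('n::finite \<Rightarrow> 'b::real_inner) \<Rightarrow> 'b \<Rightarrow> 'b" where
  "tangential t v = (\<Sum>k\<in>UNIV. \<Sum>l\<in>UNIV. (matrix_inv (gram t) $ k $ l * (v \<bullet> t l)) *\<^sub>R t k)"

lemma matrix_inv_inverse:
  fixes A :: "real^'n^'n"
  assumes "invertible A"
  shows "A ** matrix_inv A = mat 1" "matrix_inv A ** A = mat 1"
  using someI_ex[of "\<lambda>A'. A ** A' = mat 1 \<and> A' ** A = mat 1"] assms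
  unfolding invertible_def matrix_inv_def by auto

text \<open>For a kernel vector \<open>x\<close> the combination of the \<open>t i\<close> with
  coefficients \<open>x $ i\<close> has norm 0, and independence forces
  \<open>x = 0\<close>.\<close>

lemma gram_invertible:
  assumes "lin_indep_family t" shows "invertible (gram t)"
proof -
  have "x = 0" if "gram t *v x = 0" for x
  proof -
    let ?v = "\<Sum>i\<in>UNIV. x $ i *\<^sub>R t i"
    have "?v \<bullet> ?v = (\<Sum>i\<in>UNIV. x $ i * (gram t *v x) $ i)"
      by (simp add: inner_sum_left inner_sum_right matrix_vector_mult_def gram_def sum_distrib_left mult_ac inner_commute)
    also have "\<dots> = 0" using that by simp
    finally have "?v = 0" by simp
    then show ?thesis using assms unfolding lin_indep_family_def by (auto simp: vec_eq_iff)
  qed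
  then show ?thesis by (simp add: invertible_left_inverse matrix_left_invertible_ker)
qed

lemma gram_inverse:
  assumes "lin_indep_family t"
  shows "(\<Sum>k\<in>UNIV. (t i \<bullet> t k) * matrix_inv (gram t) $ k $ j) = (if i = j then 1 else 0)"
    and "(\<Sum>k\<in>UNIV. matrix_inv (gram t) $ i $ k * (t k \<bullet> t j)) = (if i = j then 1 else 0)"
proof -
  have "(gram t ** matrix_inv (gram t)) $ i $ j = (mat 1 :: real^_^_) $ i $ j"
    "(matrix_inv (gram t) ** gram t) $ i $ j = (mat 1 :: real^_^_) $ i $ j"
    using matrix_inv_inverse[OF gram_invertible[OF assms]] by simp_all
  then show "(\<Sum>k\<in>UNIV. (t i \<bullet> t k) * matrix_inv (gram t) $ k $ j) = (if i = j then 1 else 0)"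
    "(\<Sum>k\<in>UNIV. matrix_inv (gram t) $ i $ k * (t k \<bullet> t j)) = (if i = j then 1 else 0)"
    by (simp_all add: matrix_matrix_mult_def gram_def mat_def)
qed

lemma tangential_inner:
  assumes "lin_indep_family t"
  shows "tangential t v \<bullet> t j = v \<bullet> t j"
proof -
  have "tangential t v \<bullet> t j =
      (\<Sum>k\<in>UNIV. \<Sum>l\<in>UNIV. (v \<bullet> t l) * ((t j \<bullet> t k) * matrix_inv (gram t) $ k $ l))"
    by (simp add: tangential_def inner_sum_left inner_sum_right inner_commute mult_ac)
  also have "\<dots> = (\<Sum>l\<in>UNIV. (v \<bullet> t l) * (\<Sum>k\<in>UNIV. (t j \<bullet> t k) * matrix_inv (gram t) $ k $ l))"
    by (subst sum.swap) (simp add: sum_distrib_left)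
  also have "\<dots> = v \<bullet> t j"
    by (simp add: gram_inverse[OF assms] if_distrib[of "\<lambda>u. _ * u"] cong: if_cong)
  finally show ?thesis .
qed

lemma tangential_normal: "(\<And>i. N \<bullet> t i = 0) \<Longrightarrow> tangential t v \<bullet> N = 0"
  by (simp add: tangential_def inner_sum_left inner_sum_right inner_commute)

lemma lin_indep_family_dim:
  fixes t :: "'n::finite \<Rightarrow> 'b::euclidean_space"
  assumes "lin_indep_family t"
  shows "dim (range t) = CARD('n)"
proof -
  have inj: "inj t"
  proof (rule injI, rule ccontr)
    fix i j assume "t i = t j" "i \<noteq> j"
    define c where "c k = (if k = i then 1 else 0) - (if k = j then 1 else 0 :: real)" for k
    have "(\<Sum>k\<in>UNIV. c k *\<^sub>R t k) = 0"
      using \<open>t i = t j\<close> by (simp add: c_def scaleR_left_diff_distrib sum_subtractf if_distrib[of "\<lambda>u. u *\<^sub>R _"] cong: if_cong)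
    then have "c i = 0" using assms unfolding lin_indep_family_def by blast
    then show False using \<open>i \<noteq> j\<close> by (simp add: c_def)
  qed
  have "independent (range t)"
  proof
    assume "dependent (range t)"
    then obtain u where u: "\<exists>v\<in>range t. u v \<noteq> 0" "(\<Sum>v\<in>range t. u v *\<^sub>R v) = 0"
      by (auto simp: dependent_finite)
    have "(\<Sum>i\<in>UNIV. u (t i) *\<^sub>R t i) = 0" using u(2) by (simp add: sum.reindex[OF inj])
    then show False using u(1) assms unfolding lin_indep_family_def by (metis rangeE)
  qed
  then show ?thesis using inj by (simp add: dim_eq_card_independent card_image)
qed

text \<open>A nonzero residual would be orthogonal to \<open>N\<close> and to all
  \<open>t i\<close>, which gives \<open>CARD('n) + 2\<close> independent directions in a space of
  dimension \<open>CARD('n) + 1\<close>.\<close>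

lemma hypersurface_expansion:
  fixes t :: "'n::finite \<Rightarrow> real^'m::finite"
  assumes t: "lin_indep_family t" and card: "CARD('m) = CARD('n) + 1"
    and N: "norm N = 1" "\<And>i. N \<bullet> t i = 0"
  shows "v = tangential t v + (v \<bullet> N) *\<^sub>R N"
proof (rule ccontr)
  assume neq: "v \<noteq> tangential t v + (v \<bullet> N) *\<^sub>R N"
  define w where "w = v - tangential t v - (v \<bullet> N) *\<^sub>R N"
  have w: "w \<noteq> 0" "w \<bullet> N = 0" "w \<bullet> t i = 0" for i
    using neq N
    by (auto simp: w_def algebra_simps inner_simps tangential_inner[OF t] tangential_normal dot_square_norm)
  have "dim ({N} \<union> {w}) = dim {N} + dim {w}"
    using w by (intro dim_orthogonal_sum) (auto simp: inner_commute)
  moreover have "dim {N} = 1" "dim {w} = 1" using w N by (auto simp: dim_singleton)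
  moreover have "dim (range t \<union> ({N} \<union> {w})) = dim (range t) + dim ({N} \<union> {w})"
    using w N by (intro dim_orthogonal_sum) (auto simp: inner_commute)
  moreover have "dim (range t \<union> ({N} \<union> {w})) \<le> CARD('m)"
    using dim_subset_UNIV[of "range t \<union> ({N} \<union> {w})"] by simp
  ultimately show False using lin_indep_family_dim[OF t] card by simp
qed

lemma ex_unit_normal:
  fixes t :: "'n::finite \<Rightarrow> real^'m::finite"
  assumes card: "CARD('m) = CARD('n) + 1"
  obtains N where "norm N = 1" "\<And>i. N \<bullet> t i = 0"
proof -
  have "dim (range t) \<le> CARD('n)" by (rule order_trans[OF dim_le_card' card_image_le]) auto
  then have "dim (span (range t)) < DIM(real^'m)" using card by simp
  then have "span (range t) \<noteq> UNIV" by (metis dim_UNIV less_irrefl)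
  then obtain a where a: "a \<noteq> 0" "\<And>x. x \<in> span (range t) \<Longrightarrow> a \<bullet> x = 0"
    by (metis span_not_UNIV_orthogonal)
  show ?thesis
    by (rule that[of "a /\<^sub>R norm a"]) (use a in \<open>auto simp: span_base\<close>)
qed

lemma unit_normal_unique:
  fixes t :: "'n::finite \<Rightarrow> real^'m::finite"
  assumes t: "lin_indep_family t" and card: "CARD('m) = CARD('n) + 1"
    and N: "norm N = 1" "\<And>i. N \<bullet> t i = 0" and N': "norm N' = 1" "\<And>i. N' \<bullet> t i = 0"
  shows "N' = N \<or> N' = - N"
proof -
  have "tangential t N' = 0" by (simp add: tangential_def N')
  then have eq: "N' = (N' \<bullet> N) *\<^sub>R N" using hypersurface_expansion[OF t card N, of N'] by simp
  then have "\<bar>N' \<bullet> N\<bar> = 1" using N N' by (metis norm_scaleR mult.right_neutral)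
  then have "N' \<bullet> N = 1 \<or> N' \<bullet> N = - 1" by linarith
  then show ?thesis using eq by (metis scaleR_minus1_left scaleR_one)
qed

text \<open>Cramer's rule for the columns of the inverse. Each entry becomes a quotient of
  polynomials in the entries of \<open>A\<close>, from which both smooth and continuous dependence
  on a parameter follow.\<close>

lemma matrix_inv_cramer:
  fixes A :: "real^'n^'n"
  assumes "invertible A"
  shows "matrix_inv A $ k $ j = det (\<chi> i l. if l = k then (if i = j then 1 else 0) else A $ i $ l) / det A"
proof -
  have "A *v column j (matrix_inv A) = column j (A ** matrix_inv A)"
    by (simp add: vec_eq_iff column_def matrix_vector_mult_def matrix_matrix_mult_def)
  also have "\<dots> = (\<chi> i. if i = j then 1 else 0)"
    by (simp add: matrix_inv_inverse[OF assms] column_def mat_def vec_eq_iff)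
  finally have "column j (matrix_inv A) = (\<chi> k. det (\<chi> i l. if l = k then (\<chi> i. if i = j then 1 else 0) $ i else A $ i $ l) / det A)"
    using cramer[of A] assms by (simp add: invertible_det_nz)
  then have "column j (matrix_inv A) $ k = det (\<chi> i l. if l = k then (if i = j then 1 else 0) else A $ i $ l) / det A"
    by (simp cong: if_cong)
  then show ?thesis by (simp add: column_def)
qed

lemma Cinf_on_det:
  fixes A :: "'a::real_normed_vector \<Rightarrow> real^'n::finite^'n"
  assumes "open W" "\<And>i j. Cinf_on (\<lambda>y. A y $ i $ j) W"
  shows "Cinf_on (\<lambda>y. det (A y)) W"
  unfolding det_def using assms(2)
  by (intro Cinf_on_sum Cinf_on_mult Cinf_on_prod Cinf_on_const assms(1))

lemma Cinf_on_matrix_inv: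
  fixes A :: "'a::real_normed_vector \<Rightarrow> real^'n::finite^'n"
  assumes W: "open W" and A: "\<And>i j. Cinf_on (\<lambda>y. A y $ i $ j) W" "\<And>y. y \<in> W \<Longrightarrow> invertible (A y)"
  shows "Cinf_on (\<lambda>y. matrix_inv (A y) $ k $ j) W"
proof (rule Cinf_on_cong[OF W])
  have "Cinf_on (\<lambda>y. (\<chi> i l. if l = k then (if i = j then 1 else 0) else A y $ i $ l) $ i $ l) W" for i l
    using A(1) W by (cases "l = k") (auto intro!: Cinf_on_const)
  then show "Cinf_on (\<lambda>y. det (\<chi> i l. if l = k then (if i = j then 1 else 0) else A y $ i $ l) * inverse (det (A y))) W"
    using A by (intro Cinf_on_mult Cinf_on_det Cinf_on_inverse W) (auto simp: invertible_det_nz)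
qed (use A(2) in \<open>simp add: matrix_inv_cramer divide_inverse\<close>)

lemma continuous_on_matrix_inv:
  fixes A :: "'a::topological_space \<Rightarrow> real^'n::finite^'n"
  assumes A: "\<And>i j. continuous_on W (\<lambda>y. A y $ i $ j)" "\<And>y. y \<in> W \<Longrightarrow> invertible (A y)"
  shows "continuous_on W (\<lambda>y. matrix_inv (A y) $ k $ j)"
proof -
  have "continuous_on W (\<lambda>y. if l = k then if i = j then 1 else 0 else A y $ i $ l)" for i l
    using A(1) by (cases "l = k") auto
  then have "continuous_on W (\<lambda>y. det (\<chi> i l. if l = k then (if i = j then 1 else 0) else A y $ i $ l) / det (A y))"
    using A unfolding invertible_det_nz det_def[abs_def]
    by (intro continuous_on_divide continuous_on_sum continuous_on_mult continuous_on_prod continuous_on_const) auto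
  then show ?thesis
    using A(2) by (subst continuous_on_cong[OF refl matrix_inv_cramer]) auto
qed

subsection \<open>Open immersions onto convex bodies\<close>

definition locally_inj :: "'a topology \<Rightarrow> ('a \<Rightarrow> 'b) \<Rightarrow> bool" where
  "locally_inj M F \<longleftrightarrow> (\<forall>p\<in>topspace M. \<exists>V. openin M V \<and> p \<in> V \<and> inj_on F V)"

text \<open>Uniqueness of lifts: the coincidence set is closed because \<open>M\<close> is Hausdorff
  and open because \<open>F\<close> is injective near a common value, so connectedness of
  \<open>X\<close> makes it everything.\<close>

lemma unique_section:
  assumes H: "Hausdorff_space M" and s: "continuous_map X M \<sigma>" "continuous_map X M \<tau>"
    and conn: "connected_space X" and inj: "locally_inj M F"
    and eq: "\<And>y. y \<in> topspace X \<Longrightarrow> F (\<sigma> y) = F (\<tau> y)"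
    and y0: "y0 \<in> topspace X" "\<sigma> y0 = \<tau> y0" and y: "y \<in> topspace X"
  shows "\<sigma> y = \<tau> y"
proof -
  define A where "A = {y \<in> topspace X. \<sigma> y = \<tau> y}"
  have "closedin X A" unfolding A_def by (rule closedin_continuous_maps_eq[OF H s])
  moreover have "openin X A"
  proof (subst openin_subopen, intro ballI)
    fix y assume y: "y \<in> A"
    then have "y \<in> topspace X" by (simp add: A_def)
    then have "\<sigma> y \<in> topspace M" using s(1) by (simp add: continuous_map_def Pi_iff)
    then obtain V where V: "openin M V" "\<sigma> y \<in> V" "inj_on F V" using inj unfolding locally_inj_def by blast
    let ?T = "{z \<in> topspace X. \<sigma> z \<in> V} \<inter> {z \<in> topspace X. \<tau> z \<in> V}"
    have "openin X ?T" using s V by (intro openin_Int openin_continuous_map_preimage)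
    moreover have "y \<in> ?T" using y V by (auto simp: A_def)
    moreover have "?T \<subseteq> A" using V(3) eq by (auto simp: A_def inj_on_def)
    ultimately show "\<exists>T. openin X T \<and> y \<in> T \<and> T \<subseteq> A" by blast
  qed
  ultimately have "A = {} \<or> A = topspace X" using conn unfolding connected_space_clopen_in by blast
  then show ?thesis using y0 y by (auto simp: A_def)
qed

text \<open>A Lebesgue number argument. Finitely many sets \<open>V' p\<close> cover
  \<open>M\<close>. Their points are mapped into the ball of radius \<open>\<epsilon> p\<close>,
  whereas the image of \<open>V p\<close> reaches out to radius \<open>2 * \<epsilon> p\<close>; so
  the least of these \<open>\<epsilon> p\<close> leaves room around every image point.\<close>

lemma uniform_local_sections:
  fixes F :: "'a \<Rightarrow> 'b::metric_space"
  assumes comp: "compact_space M" and ne: "topspace M \<noteq> {}"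
    and cont: "continuous_map M (top_of_set D) F"
    and op: "open_map M (top_of_set D) F" and inj: "locally_inj M F"
  obtains \<delta> where "\<delta> > 0" "\<And>p. p \<in> topspace M \<Longrightarrow>
    \<exists>\<tau>. continuous_map (top_of_set (D \<inter> ball (F p) \<delta>)) M \<tau> \<and> \<tau> (F p) = p \<and> (\<forall>y\<in>D \<inter> ball (F p) \<delta>. F (\<tau> y) = y)"
proof -
  have "\<exists>V \<epsilon>. openin M V \<and> p \<in> V \<and> inj_on F V \<and> \<epsilon> > 0 \<and> D \<inter> ball (F p) (2 * \<epsilon>) \<subseteq> F ` V" if p: "p \<in> topspace M" for p
  proof -
    obtain V where V: "openin M V" "p \<in> V" "inj_on F V" using inj p unfolding locally_inj_def by blast
    have "openin (top_of_set D) (F ` V)" using op V unfolding open_map_def by blast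
    then obtain e where "e > 0" "ball (F p) e \<inter> D \<subseteq> F ` V"
      using V(2) unfolding openin_contains_ball by (metis imageI)
    then show ?thesis using V by (intro exI[of _ V] exI[of _ "e / 2"]) auto
  qed
  then obtain V \<epsilon> where V: "\<And>p. p \<in> topspace M \<Longrightarrow> openin M (V p) \<and> p \<in> V p \<and> inj_on F (V p) \<and> \<epsilon> p > 0
      \<and> D \<inter> ball (F p) (2 * \<epsilon> p) \<subseteq> F ` V p" by metis
  have FD: "F p \<in> D" if "p \<in> topspace M" for p using cont that by (auto simp: continuous_map_def)
  define V' where "V' p = {q \<in> V p. F q \<in> D \<inter> ball (F p) (\<epsilon> p)}" for p
  have "openin M (V' p)" if "p \<in> topspace M" for p
    unfolding V'_def using V[OF that]
    by (intro openin_continuous_map_preimage_gen[OF cont]) (auto simp: openin_open_Int)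
  moreover have "p \<in> V' p" if "p \<in> topspace M" for p using V[OF that] FD[OF that] by (auto simp: V'_def)
  ultimately have "(\<forall>U\<in>V' ` topspace M. openin M U) \<and> topspace M \<subseteq> \<Union>(V' ` topspace M)" by blast
  then obtain \<F> where "finite \<F>" "\<F> \<subseteq> V' ` topspace M" "topspace M \<subseteq> \<Union>\<F>"
    using comp unfolding compact_space_alt by meson
  then obtain P where P: "P \<subseteq> topspace M" "finite P" "topspace M \<subseteq> \<Union>(V' ` P)"
    by (metis finite_subset_image)
  then have "P \<noteq> {}" using ne by auto
  define \<delta> where "\<delta> = Min (\<epsilon> ` P)"
  have \<delta>: "\<delta> > 0" "\<And>p. p \<in> P \<Longrightarrow> \<delta> \<le> \<epsilon> p"
    using P V \<open>P \<noteq> {}\<close> by (auto simp: \<delta>_def subset_eq)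
  show ?thesis
  proof (rule that[OF \<delta>(1)])
    fix q assume q: "q \<in> topspace M"
    then obtain p where p: "p \<in> P" "q \<in> V' p" using P by blast
    have Vp: "openin M (V p)" "inj_on F (V p)" "D \<inter> ball (F p) (2 * \<epsilon> p) \<subseteq> F ` V p" "p \<in> topspace M"
      using V p P by auto
    define \<tau> where "\<tau> = inv_into (V p) F"
    have sub: "D \<inter> ball (F q) \<delta> \<subseteq> F ` V p"
    proof -
      have "ball (F q) \<delta> \<subseteq> ball (F p) (2 * \<epsilon> p)"
      proof
        fix y assume "y \<in> ball (F q) \<delta>"
        then have "dist (F p) y < \<epsilon> p + \<delta>"
          using p(2) dist_triangle[of "F p" y "F q"] by (auto simp: V'_def)
        then show "y \<in> ball (F p) (2 * \<epsilon> p)" using \<delta>(2)[OF p(1)] by simp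
      qed
      then show ?thesis using Vp(3) by blast
    qed
    have \<tau>: "\<tau> y \<in> V p" "F (\<tau> y) = y" if "y \<in> D \<inter> ball (F q) \<delta>" for y
      using sub that by (auto simp: \<tau>_def inv_into_into f_inv_into_f subset_eq)
    have "continuous_map (top_of_set (D \<inter> ball (F q) \<delta>)) M \<tau>"
      unfolding continuous_map_def
    proof (intro conjI allI impI)
      show "\<tau> \<in> topspace (top_of_set (D \<inter> ball (F q) \<delta>)) \<rightarrow> topspace M"
        using \<tau>(1) openin_subset[OF Vp(1)] by auto
      fix U assume U: "openin M U"
      have "{y \<in> topspace (top_of_set (D \<inter> ball (F q) \<delta>)). \<tau> y \<in> U} = (D \<inter> ball (F q) \<delta>) \<inter> F ` (U \<inter> V p)"
      proof safe
        fix y assume y: "y \<in> topspace (top_of_set (D \<inter> ball (F q) \<delta>))" "\<tau> y \<in> U"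
        then show "y \<in> F ` (U \<inter> V p)" using \<tau>[of y] by (metis IntI imageI topspace_euclidean_subtopology)
      next
        fix z assume "F z \<in> D" "F z \<in> ball (F q) \<delta>" "z \<in> U" "z \<in> V p"
        then show "\<tau> (F z) \<in> U" using Vp(2) by (simp add: \<tau>_def)
      qed auto
      moreover have "openin (top_of_set D) (F ` (U \<inter> V p))"
        using op U Vp(1) unfolding open_map_def by blast
      ultimately show "openin (top_of_set (D \<inter> ball (F q) \<delta>)) {y \<in> topspace (top_of_set (D \<inter> ball (F q) \<delta>)). \<tau> y \<in> U}"
        by (auto simp: openin_open)
    qed
    moreover have "\<tau> (F q) = q" using p(2) Vp(2) by (simp add: \<tau>_def V'_def)
    ultimately show "\<exists>\<tau>. continuous_map (top_of_set (D \<inter> ball (F q) \<delta>)) M \<tau> \<and> \<tau> (F q) = q \<and> (\<forall>y\<in>D \<inter> ball (F q) \<delta>. F (\<tau> y) = y)"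
      using \<tau>(2) by blast
  qed
qed

text \<open>The domain is contracted along lifts of the radial segments into the preimage of a small ball,
  whose components are mapped injectively.\<close>
lemma open_immersion_onto_convex_body:
  fixes F :: "'a \<Rightarrow> 'b::real_normed_vector"
  assumes comp: "compact_space M" and H: "Hausdorff_space M"
    and conn: "connected_space M" and ne: "topspace M \<noteq> {}"
    and D: "convex D" "compact D" "0 \<in> D"
    and cont: "continuous_map M (top_of_set D) F"
    and op: "open_map M (top_of_set D) F" and inj: "locally_inj M F"
  shows "homeomorphic_map M (top_of_set D) F"
proof -
  have FD: "F p \<in> D" if "p \<in> topspace M" for p using cont that by (auto simp: continuous_map_def)
  obtain \<delta> where \<delta>: "\<delta> > 0" and "\<And>p. p \<in> topspace M \<Longrightarrow>
    \<exists>\<tau>. continuous_map (top_of_set (D \<inter> ball (F p) \<delta>)) M \<tau> \<and> \<tau> (F p) = p \<and> (\<forall>y\<in>D \<inter> ball (F p) \<delta>. F (\<tau> y) = y)"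
    using uniform_local_sections[OF comp ne cont op inj] by blast
  then obtain \<tau> where \<tau>c: "\<And>p. p \<in> topspace M \<Longrightarrow> continuous_map (top_of_set (D \<inter> ball (F p) \<delta>)) M (\<tau> p)"
    and \<tau>0: "\<And>p. p \<in> topspace M \<Longrightarrow> \<tau> p (F p) = p"
    and \<tau>F: "\<And>p y. p \<in> topspace M \<Longrightarrow> y \<in> D \<Longrightarrow> y \<in> ball (F p) \<delta> \<Longrightarrow> F (\<tau> p y) = y"
    by (metis IntI)
  \<comment> \<open>The common domain of two sections is an intersection of convex sets, hence
    connected, and \<open>unique_section\<close> applies.\<close>
  have transport: "\<tau> p y = \<tau> q y"
    if "p \<in> topspace M" "q \<in> topspace M" "y0 \<in> D" "y0 \<in> ball (F p) \<delta>" "y0 \<in> ball (F q) \<delta>" "\<tau> p y0 = \<tau> q y0"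
      "y \<in> D" "y \<in> ball (F p) \<delta>" "y \<in> ball (F q) \<delta>" for p q y0 y
  proof (rule unique_section[where X = "top_of_set (D \<inter> ball (F p) \<delta> \<inter> ball (F q) \<delta>)"
        and \<sigma> = "\<tau> p" and \<tau> = "\<tau> q" and ?y0.0 = y0, OF H _ _ _ inj])
    let ?X = "top_of_set (D \<inter> ball (F p) \<delta> \<inter> ball (F q) \<delta>)"
    show "continuous_map ?X M (\<tau> p)"
      by (rule continuous_map_from_subtopology_mono[OF \<tau>c[OF that(1)]]) auto
    show "continuous_map ?X M (\<tau> q)"
      by (rule continuous_map_from_subtopology_mono[OF \<tau>c[OF that(2)]]) auto
    have "connected (D \<inter> ball (F p) \<delta> \<inter> ball (F q) \<delta>)"
      by (intro convex_connected convex_Int D convex_ball)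
    then show "connected_space ?X" by (metis connectedin_def connectedin_iff_connected)
    show "F (\<tau> p z) = F (\<tau> q z)" if "z \<in> topspace ?X" for z
      using that \<tau>F \<open>p \<in> topspace M\<close> \<open>q \<in> topspace M\<close> by auto
  qed (use that in auto)
  have lift_open: "\<exists>T. open T \<and> (\<forall>y\<in>D. y \<in> T \<longleftrightarrow> y \<in> ball (F p) \<delta> \<and> \<tau> p y \<in> U)"
    if "p \<in> topspace M" "openin M U" for p U
  proof -
    have "openin (top_of_set (D \<inter> ball (F p) \<delta>)) {y \<in> D \<inter> ball (F p) \<delta>. \<tau> p y \<in> U}"
      using openin_continuous_map_preimage[OF \<tau>c[OF that(1)] that(2)] by simp
    then obtain T where "open T" "{y \<in> D \<inter> ball (F p) \<delta>. \<tau> p y \<in> U} = D \<inter> ball (F p) \<delta> \<inter> T"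
      by (auto simp: openin_open)
    then show ?thesis by (intro exI[of _ "ball (F p) \<delta> \<inter> T"]) (blast intro: open_Int)
  qed
  have preimage: "openin M {q \<in> topspace M. g (F q) \<in> T}" if "open T" "continuous_on UNIV g" for T and g :: "'b \<Rightarrow> 'b"
  proof -
    have "continuous_map M euclidean F" using cont by (simp add: continuous_map_in_subtopology)
    then have "continuous_map M euclidean (g \<circ> F)"
      using that(2) by (metis continuous_map_compose continuous_map_iff_continuous2)
    then show ?thesis using openin_continuous_map_preimage[of M euclidean "g \<circ> F" T] that(1) by simp
  qed
  \<comment> \<open>For \<open>q\<close> near \<open>p\<close> the section \<open>\<tau> q\<close>
    agrees with \<open>\<tau> p\<close> wherever both are defined, because \<open>q\<close> itself
    lies on the sheet parametrised by \<open>\<tau> p\<close>.\<close>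
  have local: "\<exists>O'. openin M O' \<and> p \<in> O' \<and> (\<forall>q\<in>O'. F q \<in> ball (F p) \<delta> \<and> (\<forall>y\<in>D \<inter> ball (F p) \<delta> \<inter> ball (F q) \<delta>. \<tau> q y = \<tau> p y))"
    if p: "p \<in> topspace M" for p
  proof -
    obtain V where V: "openin M V" "p \<in> V" "inj_on F V" using inj p unfolding locally_inj_def by blast
    obtain T where T: "open T" "\<forall>y\<in>D. y \<in> T \<longleftrightarrow> y \<in> ball (F p) \<delta> \<and> \<tau> p y \<in> V" using lift_open[OF p V(1)] by blast
    let ?O = "V \<inter> {q \<in> topspace M. F q \<in> T}"
    have "openin M ?O" using preimage[OF T(1), of id] V by (auto simp: continuous_on_id)
    moreover have "p \<in> ?O" using T(2) FD[OF p] \<tau>0[OF p] V(2) p \<delta> by simp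
    moreover have "F q \<in> ball (F p) \<delta> \<and> (\<forall>y\<in>D \<inter> ball (F p) \<delta> \<inter> ball (F q) \<delta>. \<tau> q y = \<tau> p y)" if "q \<in> ?O" for q
    proof -
      have q: "q \<in> V" "q \<in> topspace M" "F q \<in> D \<inter> ball (F p) \<delta>" "\<tau> p (F q) \<in> V"
        using that T(2) FD[of q] by blast+
      then have "\<tau> p (F q) = q" using \<tau>F[OF p, of "F q"] V(3) by (auto simp: inj_on_def)
      then show ?thesis using transport[OF q(2) p, of "F q"] q \<tau>0[OF q(2)] \<delta> by auto
    qed
    ultimately show ?thesis by blast
  qed
  obtain B where B: "B > 0" "\<And>y. y \<in> D \<Longrightarrow> norm y \<le> B"
    using compact_imp_bounded[OF D(2)] unfolding bounded_pos by blast
  \<comment> \<open>The bound \<open>\<delta> / (2 * B)\<close> keeps the displacement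
    \<open>\<mu> * norm y\<close> below \<open>\<delta>\<close>, so that one scaling step stays in
    the domain of the local section; the bound 1/2 keeps \<open>\<rho>\<close> positive.\<close>
  define \<mu> where "\<mu> = min (1/2) (\<delta> / (2 * B))"
  have \<mu>: "0 < \<mu>" "\<mu> < 1" "\<mu> * B < \<delta>"
  proof -
    have "\<mu> * B \<le> \<delta> / (2 * B) * B" using B by (intro mult_right_mono) (auto simp: \<mu>_def)
    also have "\<dots> < \<delta>" using B \<delta> by simp
    finally show "\<mu> * B < \<delta>" .
  qed (use B \<delta> in \<open>auto simp: \<mu>_def\<close>)
  define \<rho> where "\<rho> = 1 - \<mu>"
  have \<rho>: "0 < \<rho>" "\<rho> < 1" using \<mu> by (auto simp: \<rho>_def)
  have scaled: "\<rho> *\<^sub>R y \<in> D" "\<rho> *\<^sub>R y \<in> ball y \<delta>" if "y \<in> D" for y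
  proof -
    show "\<rho> *\<^sub>R y \<in> D" using convexD_alt[OF D(1) D(3) that, of \<rho>] \<rho> by simp
    have "dist y (\<rho> *\<^sub>R y) = \<mu> * norm y" using \<mu> by (simp add: dist_norm \<rho>_def algebra_simps)
    also have "\<dots> \<le> \<mu> * B" using B(2)[OF that] \<mu> by simp
    finally show "\<rho> *\<^sub>R y \<in> ball y \<delta>" using \<mu> by simp
  qed
  \<comment> \<open>One contraction step: scaling by \<open>\<rho>\<close> in \<open>D\<close>,
    lifted to \<open>M\<close> by the section through \<open>p\<close>.\<close>
  define C where "C p = \<tau> p (\<rho> *\<^sub>R F p)" for p
  have CM: "C p \<in> topspace M" if "p \<in> topspace M" for p
    using \<tau>c[OF that] scaled[OF FD[OF that]] by (auto simp: C_def continuous_map_def)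
  have FC: "F (C p) = \<rho> *\<^sub>R F p" if "p \<in> topspace M" for p
    unfolding C_def using \<tau>F[OF that] scaled[OF FD[OF that]] by blast
  have Cc: "continuous_map M M C"
    unfolding continuous_map_def
  proof (intro conjI allI impI)
    fix U assume U: "openin M U"
    show "openin M {p \<in> topspace M. C p \<in> U}"
    proof (subst openin_subopen, intro ballI)
      fix p assume "p \<in> {p \<in> topspace M. C p \<in> U}"
      then have p: "p \<in> topspace M" "C p \<in> U" by auto
      obtain O' where O': "openin M O'" "p \<in> O'" "\<And>q. q \<in> O' \<Longrightarrow> F q \<in> ball (F p) \<delta> \<and> (\<forall>y\<in>D \<inter> ball (F p) \<delta> \<inter> ball (F q) \<delta>. \<tau> q y = \<tau> p y)"
        using local[OF p(1)] by blast
      obtain T where T: "open T" "\<forall>y\<in>D. y \<in> T \<longleftrightarrow> y \<in> ball (F p) \<delta> \<and> \<tau> p y \<in> U" using lift_open[OF p(1) U] by blast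
      let ?O = "O' \<inter> {q \<in> topspace M. \<rho> *\<^sub>R F q \<in> T}"
      have "continuous_on UNIV (\<lambda>y::'b. \<rho> *\<^sub>R y)" by (intro continuous_intros)
      from preimage[OF T(1) this] have "openin M ?O" using O'(1) by blast
      moreover have "p \<in> ?O" using O'(2) p T(2) scaled[OF FD[OF p(1)]] unfolding C_def by blast
      moreover have "C q \<in> U" "q \<in> topspace M" if q: "q \<in> ?O" for q
      proof -
        show qM: "q \<in> topspace M" using q by auto
        then have "\<rho> *\<^sub>R F q \<in> ball (F p) \<delta> \<and> \<tau> p (\<rho> *\<^sub>R F q) \<in> U" using q T(2) scaled[OF FD[OF qM]] by blast
        then show "C q \<in> U" using O'(3)[of q] q scaled[OF FD[OF qM]] unfolding C_def by simp
      qed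
      ultimately show "\<exists>T. openin M T \<and> p \<in> T \<and> T \<subseteq> {p \<in> topspace M. C p \<in> U}" by blast
    qed
  qed (use CM in auto)
  have Ck: "continuous_map M M (C ^^ k)" for k
  proof (induction k)
    case (Suc k)
    show ?case using continuous_map_compose[OF Suc Cc] by (simp only: funpow.simps)
  qed (simp add: id_def)
  have CkM: "(C ^^ k) p \<in> topspace M" if "p \<in> topspace M" for p k
    using Ck[of k] that by (auto simp: continuous_map_def)
  have FCk: "F ((C ^^ k) p) = (\<rho> ^ k) *\<^sub>R F p" if "p \<in> topspace M" for p k
    by (induction k) (use that in \<open>simp_all add: FC CkM\<close>)
  \<comment> \<open>The two sections agree at the scaled point, hence also at the common starting
    point \<open>F p\<close>, where they return \<open>p\<close> and \<open>q\<close>.\<close>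
  have C_inj: "p = q" if "p \<in> topspace M" "q \<in> topspace M" "F p = F q" "C p = C q" for p q
  proof -
    have "\<tau> p (F p) = \<tau> q (F p)"
      by (rule transport[of p q "\<rho> *\<^sub>R F p"]) (use that scaled[OF FD[of p]] FD \<delta> in \<open>auto simp: C_def\<close>)
    then show ?thesis using \<tau>0 that by metis
  qed
  have Ck_inj: "p = q" if "p \<in> topspace M" "q \<in> topspace M" "F p = F q" "(C ^^ k) p = (C ^^ k) q" for p q k
    using that(4)
  proof (induction k)
    case (Suc k)
    have "(C ^^ k) p = (C ^^ k) q"
      by (rule C_inj) (use Suc.prems that CkM FCk in auto)
    then show ?case by (rule Suc.IH)
  qed simp
  \<comment> \<open>After \<open>k\<close> steps every image lies within \<open>\<delta>\<close> of
    0, so the section through \<open>(C ^^ k) p\<close> can be evaluated at the origin.\<close>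
  obtain k where "\<rho> ^ k < \<delta> / B" using real_arch_pow_inv[of "\<delta> / B" \<rho>] \<delta> B \<rho> by auto
  then have k: "\<rho> ^ k * B < \<delta>" using B by (simp add: pos_less_divide_eq)
  have near: "0 \<in> ball (F ((C ^^ k) p)) \<delta>" if "p \<in> topspace M" for p
  proof -
    have "norm (F ((C ^^ k) p)) \<le> \<rho> ^ k * B" using FCk[OF that] B(2)[OF FD[OF that]] \<rho> by simp
    then show ?thesis using k by simp
  qed
  have conn': "connectedin M ((C ^^ k) ` topspace M)"
    using connectedin_continuous_map_image[OF Ck, of "topspace M"] conn by (simp add: connectedin_topspace)
  have end_const: "\<tau> ((C ^^ k) p) 0 = \<tau> ((C ^^ k) q) 0" if p: "p \<in> topspace M" and q: "q \<in> topspace M" for p q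
  proof (rule ccontr)
    assume ne: "\<tau> ((C ^^ k) p) 0 \<noteq> \<tau> ((C ^^ k) q) 0"
    \<comment> \<open>As \<open>Z\<close> is arbitrary, this says that \<open>\<tau> r 0\<close> is
      locally constant in \<open>r\<close>; by \<open>conn'\<close> it is constant on the image of
      \<open>C ^^ k\<close>.\<close>
    have op': "openin M {r \<in> topspace M. 0 \<in> ball (F r) \<delta> \<and> \<tau> r 0 \<in> Z}" for Z
    proof (subst openin_subopen, intro ballI)
      fix r assume "r \<in> {r \<in> topspace M. 0 \<in> ball (F r) \<delta> \<and> \<tau> r 0 \<in> Z}"
      then have r: "r \<in> topspace M" "0 \<in> ball (F r) \<delta>" "\<tau> r 0 \<in> Z" by auto
      obtain O' where O': "openin M O'" "r \<in> O'" "\<And>q. q \<in> O' \<Longrightarrow> F q \<in> ball (F r) \<delta> \<and> (\<forall>y\<in>D \<inter> ball (F r) \<delta> \<inter> ball (F q) \<delta>. \<tau> q y = \<tau> r y)"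
        using local[OF r(1)] by blast
      let ?O = "O' \<inter> {q \<in> topspace M. F q \<in> ball 0 \<delta>}"
      have "openin M ?O" using preimage[of "ball 0 \<delta>" id] O'(1) by (auto simp: continuous_on_id)
      moreover have "r \<in> ?O" using r O' by (auto simp: dist_commute)
      moreover have "?O \<subseteq> {r \<in> topspace M. 0 \<in> ball (F r) \<delta> \<and> \<tau> r 0 \<in> Z}"
        using O'(3) r D(3) by (auto simp: dist_commute)
      ultimately show "\<exists>T. openin M T \<and> r \<in> T \<and> T \<subseteq> {r \<in> topspace M. 0 \<in> ball (F r) \<delta> \<and> \<tau> r 0 \<in> Z}" by blast
    qed
    let ?A = "\<lambda>Z. {r \<in> topspace M. 0 \<in> ball (F r) \<delta> \<and> \<tau> r 0 \<in> Z}"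
    let ?z = "\<tau> ((C ^^ k) p) 0"
    have "(C ^^ k) p \<in> ?A {?z} \<inter> (C ^^ k) ` topspace M" using near[OF p] CkM[OF p] p by blast
    moreover have "(C ^^ k) q \<in> ?A (- {?z}) \<inter> (C ^^ k) ` topspace M"
      using near[OF q] CkM[OF q] q ne by (intro IntI CollectI conjI imageI) auto
    moreover have "(C ^^ k) ` topspace M \<subseteq> ?A {?z} \<union> ?A (- {?z})" using near CkM by blast
    ultimately show False
      using connectedinD[OF conn' op'[of "{?z}"] op'[of "- {?z}"]] by blast
  qed
  \<comment> \<open>The end points of two points in one fibre share the lift of the origin.
    Uniqueness of lifts then identifies the end points, and \<open>Ck_inj\<close> undoes the
    contraction steps.\<close>
  have "inj_on F (topspace M)"
  proof (rule inj_onI)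
    fix p q assume p: "p \<in> topspace M" and q: "q \<in> topspace M" and eq: "F p = F q"
    have eq': "F ((C ^^ k) p) = F ((C ^^ k) q)" using FCk p q eq by simp
    have "\<tau> ((C ^^ k) p) (F ((C ^^ k) p)) = \<tau> ((C ^^ k) q) (F ((C ^^ k) p))"
      by (rule transport[OF CkM[OF p] CkM[OF q] D(3) near[OF p] near[OF q] end_const[OF p q] FD[OF CkM[OF p]]])
        (use eq' \<delta> in simp_all)
    then have "(C ^^ k) p = (C ^^ k) q" using \<tau>0 CkM p q eq' by metis
    then show "p = q" using Ck_inj p q eq by blast
  qed
  moreover have "F ` topspace M = D"
  proof -
    have "openin (top_of_set D) (F ` topspace M)" using op unfolding open_map_def by blast
    moreover have "compactin (top_of_set D) (F ` topspace M)"
      using image_compactin[OF _ cont] comp by (simp add: compact_space_def)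
    then have "compact (F ` topspace M)" by (simp add: compactin_subtopology)
    then have "closedin (top_of_set D) (F ` topspace M)"
      using FD by (intro closed_subset compact_imp_closed) auto
    moreover have "connected D" using D(1) by (rule convex_connected)
    ultimately show ?thesis using ne unfolding connected_clopen by blast
  qed
  ultimately show ?thesis
    using bijective_open_imp_homeomorphic_map[OF cont op] by simp
qed

section \<open>Orthonormal frames and contraction with the inverse metric\<close>

lemma orthonormal_frame:
  fixes t :: "'n::finite \<Rightarrow> 'b::euclidean_space"
  assumes t: "lin_indep_family t"
  obtains E :: "'n \<Rightarrow> real^'n" and f :: "'n \<Rightarrow> 'n \<Rightarrow> real" where
    "\<And>a b. (\<Sum>i\<in>UNIV. E a $ i *\<^sub>R t i) \<bullet> (\<Sum>i\<in>UNIV. E b $ i *\<^sub>R t i) = (if a = b then 1 else 0)"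
    "\<And>i j. matrix_inv (gram t) $ i $ j = (\<Sum>a\<in>UNIV. E a $ i * E a $ j)"
    "\<And>i. (\<Sum>a\<in>UNIV. f a i *\<^sub>R E a) = axis i 1"
    "\<And>a i. f a i = t i \<bullet> (\<Sum>k\<in>UNIV. E a $ k *\<^sub>R t k)"
proof -
  obtain B where B: "B \<subseteq> span (range t)" "pairwise orthogonal B" "\<And>x. x \<in> B \<Longrightarrow> norm x = 1"
    "independent B" "card B = dim (span (range t))" "span B = span (range t)"
    using orthonormal_basis_subspace[OF subspace_span, of "range t"] by metis
  have finB: "finite B" using B(4) finiteI_independent by blast
  have "card B = card (UNIV :: 'n set)" using B(5) lin_indep_family_dim[OF t] by simp
  then obtain w where w: "bij_betw w (UNIV :: 'n set) B"
    using finB by (metis finite_same_card_bij finite_class.finite_UNIV)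
  have wB: "w a \<in> B" for a using w by (auto simp: bij_betw_def)
  have orth: "w a \<bullet> w b = (if a = b then 1 else 0)" for a b
  proof (cases "a = b")
    case False
    then have "w a \<noteq> w b" using w by (auto simp: bij_betw_def inj_on_def)
    then show ?thesis using B(2) wB False by (auto simp: pairwise_def orthogonal_def)
  qed (use B(3)[OF wB] in \<open>simp add: dot_square_norm\<close>)
  have "\<exists>e :: real^'n. w a = (\<Sum>i\<in>UNIV. e $ i *\<^sub>R t i)" for a
  proof -
    have "w a \<in> span (range t)" using wB B(1) by blast
    then show ?thesis
    proof (induction rule: span_induct_alt)
      case base
      show ?case by (intro exI[of _ 0]) simp
    next
      case (step c x y)
      then obtain i e where "x = t i" "y = (\<Sum>i\<in>UNIV. e $ i *\<^sub>R t i)" by blast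
      then show ?case
        by (intro exI[of _ "e + axis i c"])
          (simp add: scaleR_left_distrib sum.distrib axis_def if_distrib[of "\<lambda>u. u *\<^sub>R _"] cong: if_cong)
    qed
  qed
  then obtain E :: "'n \<Rightarrow> real^'n" where E: "\<And>a. w a = (\<Sum>i\<in>UNIV. E a $ i *\<^sub>R t i)" by metis
  \<comment> \<open>\<open>E\<close> expresses the orthonormal \<open>w a\<close> through the
    \<open>t i\<close>, and \<open>f\<close> expresses the \<open>t i\<close> through the
    \<open>w a\<close>. The Gram matrix is f^T f; as f^T E = 1, its inverse is E^T E, the matrix
    \<open>H\<close> below.\<close>
  define f where "f a i = t i \<bullet> w a" for a i
  have texp: "t i = (\<Sum>a\<in>UNIV. f a i *\<^sub>R w a)" for i
  proof -
    have "t i \<in> span B" using B(6) by (simp add: span_base)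
    then have "(\<Sum>v\<in>B. (t i \<bullet> v) *\<^sub>R v) = t i"
      by (intro orthonormal_basis_expand B finB) auto
    then show ?thesis using sum.reindex_bij_betw[OF w, of "\<lambda>v. (t i \<bullet> v) *\<^sub>R v"]
      by (simp add: f_def)
  qed
  have fE: "(\<Sum>a\<in>UNIV. f a i * E a $ k) = (if k = i then 1 else 0)" for i k
  proof -
    define c where "c k = (\<Sum>a\<in>UNIV. f a i * E a $ k) - (if k = i then 1 else 0)" for k
    have "(\<Sum>k\<in>UNIV. (\<Sum>a\<in>UNIV. f a i * E a $ k) *\<^sub>R t k) = (\<Sum>a\<in>UNIV. f a i *\<^sub>R w a)"
      unfolding E scaleR_sum_right scaleR_sum_left by (subst sum.swap) simp
    then have "(\<Sum>k\<in>UNIV. c k *\<^sub>R t k) = 0"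
      using texp[of i] by (simp add: c_def scaleR_left_diff_distrib sum_subtractf if_distrib[of "\<lambda>u. u *\<^sub>R _"] cong: if_cong)
    then have "c k = 0" using t unfolding lin_indep_family_def by blast
    then show ?thesis by (simp add: c_def)
  qed
  define H :: "real^'n^'n" where "H = (\<chi> i j. \<Sum>a\<in>UNIV. E a $ i * E a $ j)"
  have "gram t ** H = mat 1"
  proof -
    have "(\<Sum>j\<in>UNIV. (t i \<bullet> t j) * (\<Sum>a\<in>UNIV. E a $ j * E a $ k)) = (\<Sum>a\<in>UNIV. f a i * E a $ k)" for i k
      unfolding f_def E inner_sum_right sum_distrib_left sum_distrib_right
      by (subst sum.swap) (simp add: mult_ac)
    then show ?thesis by (simp add: vec_eq_iff matrix_matrix_mult_def gram_def H_def mat_def fE eq_commute)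
  qed
  then have "matrix_inv (gram t) = H"
    using matrix_inv_inverse(2)[OF gram_invertible[OF t]]
    by (metis matrix_mul_assoc matrix_mul_lid matrix_mul_rid)
  then show ?thesis
    using orth fE unfolding E
    by (intro that[of E f]) (auto simp: H_def vec_eq_iff axis_def f_def E)
qed

text \<open>Inserting the frame sum for both factors \<open>H\<close> separates the index pairs
  \<open>i, j\<close> and \<open>k, l\<close> into two equal factors. This is how the invariant norm
  of the second fundamental form becomes a sum of squares in an orthonormal frame.\<close>

lemma frame_contraction:
  fixes E :: "'k::finite \<Rightarrow> 'n::finite \<Rightarrow> real"
  assumes "\<And>i j. H i j = (\<Sum>a\<in>UNIV. E a i * E a j)"
  shows "(\<Sum>i\<in>UNIV. \<Sum>j\<in>UNIV. \<Sum>k\<in>UNIV. \<Sum>l\<in>UNIV. H i k * H j l * (b i j * b k l))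
    = (\<Sum>a\<in>UNIV. \<Sum>c\<in>UNIV. (\<Sum>i\<in>UNIV. \<Sum>j\<in>UNIV. E a i * E c j * b i j)\<^sup>2)"
proof -
  have "(\<Sum>i\<in>UNIV. \<Sum>j\<in>UNIV. \<Sum>k\<in>UNIV. \<Sum>l\<in>UNIV. H i k * H j l * (b i j * b k l))
    = (\<Sum>i\<in>UNIV. \<Sum>j\<in>UNIV. \<Sum>k\<in>UNIV. \<Sum>l\<in>UNIV. \<Sum>a\<in>UNIV. \<Sum>c\<in>UNIV. (E a i * E c j * b i j) * (E a k * E c l * b k l))"
    unfolding assms unfolding sum_product unfolding sum_distrib_right by (simp only: mult_ac)
  also have "\<dots> = (\<Sum>a\<in>UNIV. \<Sum>c\<in>UNIV. \<Sum>i\<in>UNIV. \<Sum>j\<in>UNIV. \<Sum>k\<in>UNIV. \<Sum>l\<in>UNIV. (E a i * E c j * b i j) * (E a k * E c l * b k l))"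
    by (simp only: sum.swap[of _ "UNIV :: 'k set" "UNIV :: 'n set"])
  also have "\<dots> = (\<Sum>a\<in>UNIV. \<Sum>c\<in>UNIV. (\<Sum>i\<in>UNIV. \<Sum>j\<in>UNIV. E a i * E c j * b i j)\<^sup>2)"
    unfolding power2_eq_square unfolding sum_distrib_right unfolding sum_distrib_left ..
  finally show ?thesis .
qed

subsection \<open>Charts\<close>

abbreviation coords :: "('a, 'n::finite) chart \<Rightarrow> (real^'n) set" where
  "coords c \<equiv> snd c ` fst c"

definition inner_coords :: "('a, 'n::finite) chart \<Rightarrow> (real^'n) set" where
  "inner_coords c = {u \<in> coords c. 0 < u $ bdry_coord}"

text \<open>From any point of a relatively open part of the half-space, small positive multiples of
  every basis vector stay inside, which is enough to determine a derivative even at the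
  boundary.\<close>

lemma half_space_derivative_unique:
  fixes f :: "real^'n::finite \<Rightarrow> 'b::real_normed_vector"
  assumes S: "openin (top_of_set half_space) S" "u \<in> S"
    and f: "(f has_derivative f1) (at u within S)" "(f has_derivative f2) (at u within S)"
  shows "f1 = f2"
proof (rule frechet_derivative_unique_within[OF f])
  fix i :: "real^'n" and e :: real assume i: "i \<in> Basis" and e: "e > 0"
  obtain r where r: "r > 0" "ball u r \<inter> half_space \<subseteq> S" using S unfolding openin_contains_ball by blast
  define d where "d = min r e / 2"
  have d: "0 < d" "d < r" "d < e" using r e by (auto simp: d_def)
  have "0 \<le> i $ bdry_coord" using i by (auto simp: Basis_vec_def axis_def)
  moreover have "0 \<le> u $ bdry_coord" using S openin_imp_subset by (force simp: half_space_def)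
  ultimately have "u + d *\<^sub>R i \<in> half_space" using d by (simp add: half_space_def)
  moreover have "u + d *\<^sub>R i \<in> ball u r" using d i by (simp add: dist_norm)
  ultimately show "\<exists>d. 0 < \<bar>d\<bar> \<and> \<bar>d\<bar> < e \<and> u + d *\<^sub>R i \<in> S" using r d by (intro exI[of _ d]) auto
qed

text \<open>By uniqueness, the one-sided derivatives of \<open>f\<close> are those of a local smooth
  extension. This transfers two-sided calculus to boundary points.\<close>

lemma smooth_on_extension:
  fixes f :: "real^'n::finite \<Rightarrow> 'b::real_normed_vector"
  assumes "smooth_on S f" "openin (top_of_set half_space) S" "u \<in> S"
  obtains W g where "open W" "u \<in> W" "Cinf_on g W" "\<And>y. y \<in> W \<inter> S \<Longrightarrow> g y = f y"
    "\<And>y. y \<in> W \<inter> S \<Longrightarrow> (f has_derivative (\<lambda>v. dird v g y)) (at y within S)"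
    "\<And>y v. y \<in> W \<inter> S \<Longrightarrow> frechet_derivative f (at y within S) v = dird v g y"
proof -
  obtain W g where W: "open W" "u \<in> W" "Cinf_on g W" "\<forall>y\<in>W \<inter> S. g y = f y"
    using assms(1,3) unfolding smooth_on_def Cinf_on_def by blast
  have der: "(f has_derivative (\<lambda>v. dird v g y)) (at y within S)" if y: "y \<in> W \<inter> S" for y
  proof -
    obtain r where r: "r > 0" "ball y r \<subseteq> W" using W(1) y openE by blast
    have "(g has_derivative (\<lambda>v. dird v g y)) (at y within S)"
      using Cinf_on_has_derivative[OF W(3)] y has_derivative_at_withinI by blast
    then show ?thesis
      by (rule has_derivative_transform_within[OF _ r(1)]) (use r y W(4) in \<open>auto simp: dist_commute subset_eq\<close>)
  qed
  moreover have "frechet_derivative f (at y within S) v = dird v g y" if y: "y \<in> W \<inter> S" for y v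
    using half_space_derivative_unique[OF assms(2) _ der[OF y]] der[OF y] y
    by (metis IntD2 differentiableI frechet_derivative_works)
  ultimately show ?thesis using W by (intro that[of W g]) auto
qed

lemma open_half_space_interior:
  assumes "openin (top_of_set half_space) S"
  shows "open {u \<in> S. 0 < u $ bdry_coord}"
proof -
  obtain T where T: "open T" "S = half_space \<inter> T" using assms by (auto simp: openin_open)
  have "{u \<in> S. 0 < u $ bdry_coord} = T \<inter> {u. 0 < u $ bdry_coord}" using T by (auto simp: half_space_def)
  moreover have "open {u :: real^'n. 0 < u $ bdry_coord}"
    by (intro open_Collect_less continuous_intros)
  ultimately show ?thesis using T by auto
qed

lemma Cinf_on_local:
  assumes "\<And>x. x \<in> W \<Longrightarrow> \<exists>V. open V \<and> x \<in> V \<and> Cinf_on f V"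
  shows "Cinf_on f W"
  unfolding Cinf_on_def
proof (intro allI Ck_on_local)
  fix k x assume "x \<in> W"
  then show "\<exists>V. open V \<and> x \<in> V \<and> Ck_on k f V" using assms unfolding Cinf_on_def by blast
qed

lemma smooth_on_interior:
  fixes f :: "real^'n::finite \<Rightarrow> 'b::real_normed_vector"
  assumes "smooth_on S f" "openin (top_of_set half_space) S"
  shows "Cinf_on f {u \<in> S. 0 < u $ bdry_coord}"
proof (rule Cinf_on_local)
  fix u assume u: "u \<in> {u \<in> S. 0 < u $ bdry_coord}"
  then have "u \<in> S" by blast
  then obtain W g where W: "open W" "u \<in> W" "Cinf_on g W" "\<And>y. y \<in> W \<inter> S \<Longrightarrow> g y = f y"
    using smooth_on_extension[OF assms, of u] by metis
  let ?V = "W \<inter> {u \<in> S. 0 < u $ bdry_coord}"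
  have o: "open ?V" using W(1) open_half_space_interior[OF assms(2)] by (rule open_Int)
  have "Cinf_on g ?V" using Cinf_on_subset[OF W(3)] by blast
  then have "Cinf_on f ?V" using Cinf_on_cong[OF o, of g f] W(4) by blast
  then show "\<exists>V. open V \<and> u \<in> V \<and> Cinf_on f V" using o W u by blast
qed

section \<open>Tangent spaces, normals and the second fundamental form in charts\<close>

locale immersed_hypersurface =
  fixes M :: "'a topology"
    and \<A> :: "('a, 'n::finite) chart set"
    and F :: "'a \<Rightarrow> real^'m::finite"
  assumes card: "CARD('m) = CARD('n) + 1"
    and manifold: "smooth_manifold_with_boundary M \<A>"
    and immersion: "smooth_immersion \<A> F"
begin

abbreviation local_map :: "('a, 'n) chart \<Rightarrow> real^'n \<Rightarrow> real^'m" where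
  "local_map c \<equiv> F \<circ> chart_inv c"

lemma Hausdorff: "Hausdorff_space M"
  using manifold by (simp add: smooth_manifold_with_boundary_def)

lemma chart_cover: "p \<in> topspace M \<Longrightarrow> \<exists>c\<in>\<A>. p \<in> fst c"
  using manifold by (auto simp: smooth_manifold_with_boundary_def)

lemma chart:
  assumes "c \<in> \<A>"
  shows "openin M (fst c)" "openin (top_of_set half_space) (coords c)"
    "homeomorphic_map (subtopology M (fst c)) (top_of_set (coords c)) (snd c)"
  using manifold assms by (auto simp: smooth_manifold_with_boundary_def is_chart_def)

lemma chart_subset: "c \<in> \<A> \<Longrightarrow> fst c \<subseteq> topspace M"
  using chart(1) openin_subset by blast

lemma chart_inj: "c \<in> \<A> \<Longrightarrow> inj_on (snd c) (fst c)"
  using homeomorphic_imp_injective_map[OF chart(3)] chart_subset by (metis topspace_subtopology_subset)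

lemma chart_inv_left: "c \<in> \<A> \<Longrightarrow> p \<in> fst c \<Longrightarrow> chart_inv c (snd c p) = p"
  by (simp add: chart_inv_def chart_inj)

lemma chart_inv_right: "u \<in> coords c \<Longrightarrow> snd c (chart_inv c u) = u"
  by (simp add: chart_inv_def f_inv_into_f)

lemma chart_inv_in: "u \<in> coords c \<Longrightarrow> chart_inv c u \<in> fst c"
  by (simp add: chart_inv_def inv_into_into)

lemma chart_continuous: "c \<in> \<A> \<Longrightarrow> continuous_map (subtopology M (fst c)) euclidean (snd c)"
  using homeomorphic_imp_continuous_map[OF chart(3)] by (simp add: continuous_map_in_subtopology)

lemma chart_image_open:
  assumes c: "c \<in> \<A>" and U: "openin M U" "U \<subseteq> fst c"
  shows "openin (top_of_set half_space) (snd c ` U)"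
proof -
  have "openin (subtopology M (fst c)) U" using U by (metis inf.absorb1 openin_subtopology)
  then have "openin (top_of_set (coords c)) (snd c ` U)"
    using homeomorphic_imp_open_map[OF chart(3)[OF c]] by (simp add: open_map_def)
  then show ?thesis using chart(2)[OF c] openin_trans by blast
qed

lemma chart_preimage_open:
  assumes c: "c \<in> \<A>" and U: "open U"
  shows "openin M {p \<in> fst c. snd c p \<in> U}"
proof -
  have "openin (subtopology M (fst c)) {p \<in> topspace (subtopology M (fst c)). snd c p \<in> U}"
    using openin_continuous_map_preimage[OF chart_continuous[OF c]] U by simp
  moreover have "topspace (subtopology M (fst c)) = fst c" using chart_subset[OF c] by auto
  ultimately show ?thesis using openin_trans_full[OF _ chart(1)[OF c]] by metis
qed

lemma continuous_map_charts:
  fixes f :: "'a \<Rightarrow> 'b::topological_space"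
  assumes "\<And>c. c \<in> \<A> \<Longrightarrow> continuous_on (coords c) (f \<circ> chart_inv c)"
  shows "continuous_map M euclidean f"
  unfolding continuous_map_def
proof (intro conjI allI impI)
  fix U :: "'b set" assume U: "openin euclidean U"
  show "openin M {p \<in> topspace M. f p \<in> U}"
  proof (subst openin_subopen, intro ballI)
    fix p assume "p \<in> {p \<in> topspace M. f p \<in> U}"
    then have p: "p \<in> topspace M" "f p \<in> U" by auto
    obtain c where c: "c \<in> \<A>" "p \<in> fst c" using chart_cover p by blast
    obtain T where T: "open T" "T \<inter> coords c = (f \<circ> chart_inv c) -` U \<inter> coords c"
      using assms[OF c(1)] U unfolding continuous_on_open_invariant by auto
    have eq: "snd c q \<in> T \<longleftrightarrow> f q \<in> U" if q: "q \<in> fst c" for q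
    proof -
      have "snd c q \<in> T \<inter> coords c \<longleftrightarrow> snd c q \<in> (f \<circ> chart_inv c) -` U \<inter> coords c" by (simp only: T(2))
      then show ?thesis using q chart_inv_left[OF c(1) q] by simp
    qed
    have "openin M {q \<in> fst c. snd c q \<in> T}" by (rule chart_preimage_open[OF c(1) T(1)])
    moreover have "p \<in> {q \<in> fst c. snd c q \<in> T}" using c eq p by auto
    moreover have "{q \<in> fst c. snd c q \<in> T} \<subseteq> {p \<in> topspace M. f p \<in> U}"
      using eq chart_subset[OF c(1)] by auto
    ultimately show "\<exists>T. openin M T \<and> p \<in> T \<and> T \<subseteq> {p \<in> topspace M. f p \<in> U}" by blast
  qed
qed auto

lemma local_map_smooth: "c \<in> \<A> \<Longrightarrow> smooth_on (coords c) (local_map c)"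
  using immersion by (simp add: smooth_immersion_def)

lemma local_map_derivative:
  assumes c: "c \<in> \<A>" and u: "u \<in> coords c"
  shows "(local_map c has_derivative frechet_derivative (local_map c) (at u within coords c)) (at u within coords c)"
  using smooth_on_extension[OF local_map_smooth[OF c] chart(2)[OF c] u] u
  by (metis IntI differentiableI frechet_derivative_works)

lemma tangent_sum:
  assumes c: "c \<in> \<A>" and p: "p \<in> fst c"
  shows "frechet_derivative (local_map c) (at (snd c p) within coords c) v = (\<Sum>i\<in>UNIV. v $ i *\<^sub>R tangent_vec c F p i)"
proof -
  let ?D = "frechet_derivative (local_map c) (at (snd c p) within coords c)"
  have lin: "linear ?D"
    using local_map_derivative[OF c, of "snd c p"] p has_derivative_linear by blast
  have "?D v = ?D (\<Sum>i\<in>UNIV. v $ i *\<^sub>R axis i 1)"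
    using basis_expansion[of v] by (simp add: scalar_mult_eq_scaleR)
  also have "\<dots> = (\<Sum>i\<in>UNIV. v $ i *\<^sub>R ?D (axis i 1))"
    using lin by (simp add: linear_sum linear_cmul)
  finally show ?thesis by (simp add: tangent_vec_def partial_in_def)
qed

lemma tangent_indep:
  assumes c: "c \<in> \<A>" and p: "p \<in> fst c"
  shows "lin_indep_family (tangent_vec c F p)"
  unfolding lin_indep_family_def
proof (intro allI impI)
  fix b :: "'n \<Rightarrow> real" and i
  let ?D = "frechet_derivative (local_map c) (at (snd c p) within coords c)"
  assume "(\<Sum>i\<in>UNIV. b i *\<^sub>R tangent_vec c F p i) = 0"
  then have "?D (\<chi> i. b i) = 0" using tangent_sum[OF c p, of "\<chi> i. b i"] by simp
  moreover have "?D 0 = 0" using tangent_sum[OF c p, of 0] by simp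
  moreover have "inj ?D" using immersion c p by (auto simp: smooth_immersion_def)
  ultimately have "(\<chi> i. b i) = 0" by (metis injD)
  then show "b i = 0" by (simp add: vec_eq_iff)
qed

text \<open>By the chain rule for the transition map, the tangent vectors of \<open>c\<close> lie in
  the span of those of \<open>d\<close>; hence being normal does not depend on the chart.\<close>

lemma tangent_vec_transition:
  assumes c: "c \<in> \<A>" "p \<in> fst c" and d: "d \<in> \<A>" "p \<in> fst d"
    and N: "\<And>i. N \<bullet> tangent_vec d F p i = 0"
  shows "N \<bullet> tangent_vec c F p i = 0"
proof -
  define T where "T = snd c ` (fst c \<inter> fst d)"
  define \<tau> where "\<tau> = snd d \<circ> chart_inv c"
  define u where "u = snd c p"
  have T: "openin (top_of_set half_space) T"
    unfolding T_def using chart(1)[OF c(1)] chart(1)[OF d(1)] by (intro chart_image_open[OF c(1)]) auto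
  have uT: "u \<in> T" using c d by (auto simp: u_def T_def)
  have TS: "T \<subseteq> coords c" by (auto simp: T_def)
  have "smooth_on T \<tau>" using manifold c d by (auto simp: smooth_manifold_with_boundary_def T_def \<tau>_def)
  then obtain L where L: "(\<tau> has_derivative L) (at u within T)"
    using smooth_on_extension[OF _ T uT] uT by (metis IntI)
  have \<tau>u: "\<tau> u = snd d p" using chart_inv_left c by (simp add: \<tau>_def u_def)
  have \<tau>T: "\<tau> ` T \<subseteq> coords d" by (auto simp: \<tau>_def T_def chart_inv_left[OF c(1)])
  let ?Dd = "frechet_derivative (local_map d) (at (snd d p) within coords d)"
  let ?Dc = "frechet_derivative (local_map c) (at u within coords c)"
  have "(local_map d has_derivative ?Dd) (at (\<tau> u) within \<tau> ` T)"
    unfolding \<tau>u using local_map_derivative[OF d(1), of "snd d p"] d(2) \<tau>T has_derivative_subset by blast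
  then have "((local_map d \<circ> \<tau>) has_derivative ?Dd \<circ> L) (at u within T)"
    by (rule diff_chain_within[OF L])
  then have 1: "(local_map c has_derivative ?Dd \<circ> L) (at u within T)"
    by (rule has_derivative_transform_within[OF _ zero_less_one uT])
      (auto simp: T_def \<tau>_def chart_inv_left[OF c(1)] chart_inv_left[OF d(1)])
  have 2: "(local_map c has_derivative ?Dc) (at u within T)"
    using local_map_derivative[OF c(1), of u] uT TS has_derivative_subset by blast
  have "?Dc = ?Dd \<circ> L" by (rule half_space_derivative_unique[OF T uT 2 1])
  then have "tangent_vec c F p i = ?Dd (L (axis i 1))"
    by (simp add: tangent_vec_def partial_in_def u_def)
  then show ?thesis using N by (simp add: tangent_sum[OF d] inner_sum_right)
qed

text \<open>The sign is chosen point by point, the same for all charts around \<open>p\<close> but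
  without any continuity. Global arguments therefore use only quantities and conditions that are
  invariant under a change of this sign.\<close>

definition normal :: "'a \<Rightarrow> real^'m" where
  "normal p = (SOME N. norm N = 1 \<and> (\<forall>c\<in>\<A>. p \<in> fst c \<longrightarrow> (\<forall>i. N \<bullet> tangent_vec c F p i = 0)))"

lemma normal:
  assumes "p \<in> topspace M"
  shows "norm (normal p) = 1" "c \<in> \<A> \<Longrightarrow> p \<in> fst c \<Longrightarrow> normal p \<bullet> tangent_vec c F p i = 0"
proof -
  obtain d where d: "d \<in> \<A>" "p \<in> fst d" using chart_cover assms by blast
  obtain N where "norm N = 1" "\<And>i. N \<bullet> tangent_vec d F p i = 0" using ex_unit_normal[OF card] by metis
  then have "norm N = 1 \<and> (\<forall>c\<in>\<A>. p \<in> fst c \<longrightarrow> (\<forall>i. N \<bullet> tangent_vec c F p i = 0))"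
    using tangent_vec_transition[OF _ _ d] by blast
  from someI[of "\<lambda>N. norm N = 1 \<and> (\<forall>c\<in>\<A>. p \<in> fst c \<longrightarrow> (\<forall>i. N \<bullet> tangent_vec c F p i = 0))", OF this]
  show "norm (normal p) = 1" "c \<in> \<A> \<Longrightarrow> p \<in> fst c \<Longrightarrow> normal p \<bullet> tangent_vec c F p i = 0"
    by (auto simp: normal_def)
qed

lemma normal_unique:
  assumes c: "c \<in> \<A>" "p \<in> fst c" and N: "norm N = 1" "\<And>i. N \<bullet> tangent_vec c F p i = 0"
  shows "N = normal p \<or> N = - normal p"
  by (rule unit_normal_unique[OF tangent_indep[OF c] card])
    (use N normal c chart_subset in blast)+

lemma expansion:
  assumes c: "c \<in> \<A>" "p \<in> fst c"
  shows "v = tangential (tangent_vec c F p) v + (v \<bullet> normal p) *\<^sub>R normal p"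
  by (rule hypersurface_expansion[OF tangent_indep[OF c] card])
    (use normal c chart_subset in blast)+

text \<open>The subtracted term is the tangential projection, so only the component along the normal
  survives; the result is even in \<open>normal p\<close>.\<close>

lemma second_fundamental_form_eq:
  assumes c: "c \<in> \<A>" "p \<in> fst c"
  shows "second_fundamental_form c F p i j = (second_partial c F p i j \<bullet> normal p) *\<^sub>R normal p"
proof -
  have "metric c F p = gram (tangent_vec c F p)" by (simp add: metric_def gram_def)
  then have "second_fundamental_form c F p i j = second_partial c F p i j - tangential (tangent_vec c F p) (second_partial c F p i j)"
    by (simp add: second_fundamental_form_def tangential_def inverse_metric_def)
  then show ?thesis using expansion[OF c, of "second_partial c F p i j"] by (metis add_diff_cancel_left')
qed

lemma continuous_on_tangent_vec:
  assumes c: "c \<in> \<A>"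
  shows "continuous_on (coords c) (\<lambda>u. tangent_vec c F (chart_inv c u) i)"
  unfolding continuous_on_eq_continuous_within
proof
  fix u assume u: "u \<in> coords c"
  obtain W g where W: "open W" "u \<in> W" "Cinf_on g W"
    "\<And>y v. y \<in> W \<inter> coords c \<Longrightarrow> frechet_derivative (local_map c) (at y within coords c) v = dird v g y"
    using smooth_on_extension[OF local_map_smooth[OF c] chart(2)[OF c] u] by metis
  obtain r where r: "r > 0" "ball u r \<subseteq> W" using W openE by blast
  have eq: "tangent_vec c F (chart_inv c y) i = dird (axis i 1) g y" if "y \<in> W \<inter> coords c" for y
    using W(4)[OF that] that by (simp add: tangent_vec_def partial_in_def chart_inv_right)
  have "isCont (dird (axis i 1) g) u"
    using Cinf_on_continuous[OF Cinf_on_dird[OF W(3)]] W by (simp add: continuous_on_eq_continuous_at)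
  then have "continuous (at u within coords c) (dird (axis i 1) g)" by (rule continuous_at_imp_continuous_at_within)
  then show "continuous (at u within coords c) (\<lambda>u. tangent_vec c F (chart_inv c u) i)"
    by (rule continuous_transform_within[OF _ r(1) u]) (use r eq in \<open>auto simp: dist_commute subset_eq\<close>)
qed

lemma continuous_map_F: "continuous_map M euclidean F"
proof (rule continuous_map_charts)
  fix c assume c: "c \<in> \<A>"
  show "continuous_on (coords c) (local_map c)"
    using local_map_derivative[OF c] has_derivative_continuous
    unfolding continuous_on_eq_continuous_within by blast
qed

lemma continuous_on_chart:
  assumes c: "c \<in> \<A>" and f: "continuous_map M euclidean f"
  shows "continuous_on (coords c) (f \<circ> chart_inv c)"
proof -
  obtain h where h: "homeomorphic_maps (subtopology M (fst c)) (top_of_set (coords c)) (snd c) h"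
    using chart(3)[OF c] homeomorphic_map_maps by blast
  have "chart_inv c u = h u" if "u \<in> coords c" for u
    using h that chart_inv_left[OF c] chart_subset[OF c] unfolding homeomorphic_maps_def by auto
  then have "continuous_map (top_of_set (coords c)) (subtopology M (fst c)) (chart_inv c)"
    using h unfolding homeomorphic_maps_def by (auto intro: continuous_map_eq)
  then have "continuous_map (top_of_set (coords c)) M (chart_inv c)" by (simp add: continuous_map_in_subtopology)
  from continuous_map_compose[OF this f] show ?thesis by simp
qed

text \<open>By Pythagoras the square is the squared length of \<open>f p\<close> minus that of its
  tangential part, an expression in the continuous tangent vectors that involves no choice of a
  normal.\<close>

lemma continuous_normal_component:
  assumes f: "continuous_map M euclidean f"
  shows "continuous_map M euclidean (\<lambda>p. (f p \<bullet> normal p)\<^sup>2)"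
proof (rule continuous_map_charts)
  fix c assume c: "c \<in> \<A>"
  let ?t = "\<lambda>u. tangent_vec c F (chart_inv c u)"
  have f': "continuous_on (coords c) (\<lambda>u. f (chart_inv c u))"
    using continuous_on_chart[OF c f] by (simp add: o_def)
  have t: "continuous_on (coords c) (\<lambda>u. ?t u i)" for i by (rule continuous_on_tangent_vec[OF c])
  have inv: "continuous_on (coords c) (\<lambda>u. matrix_inv (gram (?t u)) $ k $ l)" for k l
    by (rule continuous_on_matrix_inv)
      (use t tangent_indep[OF c] chart_inv_left[OF c] in \<open>auto simp: gram_def intro!: continuous_on_inner gram_invertible[unfolded gram_def]\<close>)
  have "(f p \<bullet> normal p)\<^sup>2 = f p \<bullet> f p - f p \<bullet> tangential (tangent_vec c F p) (f p)" if p: "p \<in> fst c" for p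
    using arg_cong[OF expansion[OF c p, of "f p"], of "\<lambda>w. f p \<bullet> w"]
    by (simp add: inner_add_right power2_eq_square)
  then have eq: "((\<lambda>p. (f p \<bullet> normal p)\<^sup>2) \<circ> chart_inv c) u
      = f (chart_inv c u) \<bullet> f (chart_inv c u) - f (chart_inv c u) \<bullet> tangential (?t u) (f (chart_inv c u))"
    if "u \<in> coords c" for u using chart_inv_in[OF that] by simp
  have "continuous_on (coords c) (\<lambda>u. f (chart_inv c u) \<bullet> f (chart_inv c u) - f (chart_inv c u) \<bullet> tangential (?t u) (f (chart_inv c u)))"
    unfolding tangential_def
    by (intro continuous_on_diff continuous_on_inner continuous_on_sum continuous_on_scaleR continuous_on_mult inv t f')
  then show "continuous_on (coords c) ((\<lambda>p. (f p \<bullet> normal p)\<^sup>2) \<circ> chart_inv c)"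
    by (rule continuous_on_eq) (simp only: eq)
qed

subsection \<open>Interior points\<close>

lemma open_inner_coords: "c \<in> \<A> \<Longrightarrow> open (inner_coords c)"
  unfolding inner_coords_def by (rule open_half_space_interior[OF chart(2)])

lemma inner_coords_subset: "inner_coords c \<subseteq> coords c"
  by (auto simp: inner_coords_def)

lemma inner_snd: "u \<in> inner_coords c \<Longrightarrow> snd c (chart_inv c u) = u"
  by (rule chart_inv_right[OF subsetD[OF inner_coords_subset]])

lemma inner_chart_inv: "u \<in> inner_coords c \<Longrightarrow> chart_inv c u \<in> fst c"
  by (rule chart_inv_in[OF subsetD[OF inner_coords_subset]])

lemma local_map_Cinf: "c \<in> \<A> \<Longrightarrow> Cinf_on (local_map c) (inner_coords c)"
  unfolding inner_coords_def by (rule smooth_on_interior[OF local_map_smooth chart(2)])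

lemma partial_in_inner:
  assumes c: "c \<in> \<A>" and u: "u \<in> inner_coords c"
  shows "partial_in c i f u = dird (axis i 1) f u"
proof -
  have "at u within coords c = at u"
    using at_within_open_subset[OF u open_inner_coords[OF c] inner_coords_subset] .
  then show ?thesis by (simp add: partial_in_def dird_def)
qed

lemma tangent_vec_inner:
  assumes "c \<in> \<A>" "u \<in> inner_coords c"
  shows "tangent_vec c F (chart_inv c u) i = dird (axis i 1) (local_map c) u"
  unfolding tangent_vec_def inner_snd[OF assms(2)] by (rule partial_in_inner[OF assms])

lemma second_partial_inner:
  assumes c: "c \<in> \<A>" and u: "u \<in> inner_coords c"
  shows "second_partial c F (chart_inv c u) i j = dird (axis i 1) (dird (axis j 1) (local_map c)) u"
proof -
  have "second_partial c F (chart_inv c u) i j = dird (axis i 1) (partial_in c j (local_map c)) u"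
    unfolding second_partial_def inner_snd[OF u] by (rule partial_in_inner[OF assms])
  also have "\<dots> = dird (axis i 1) (dird (axis j 1) (local_map c)) u"
    using partial_in_inner[OF c]
    by (intro dird_cong_open[OF open_inner_coords[OF c] u]
        differentiable_cong_open[OF open_inner_coords[OF c] u _ Cinf_on_differentiable[OF Cinf_on_dird[OF local_map_Cinf[OF c]] u]]) auto
  finally show ?thesis .
qed

lemma dird_local_map:
  assumes c: "c \<in> \<A>" and u: "u \<in> inner_coords c"
  shows "dird v (local_map c) u = (\<Sum>i\<in>UNIV. v $ i *\<^sub>R dird (axis i 1) (local_map c) u)"
proof -
  have "dird v (local_map c) u = dird (\<Sum>i\<in>UNIV. v $ i *\<^sub>R axis i 1) (local_map c) u"
    using basis_expansion[of v] by (simp add: scalar_mult_eq_scaleR)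
  also have "\<dots> = (\<Sum>i\<in>UNIV. v $ i *\<^sub>R dird (axis i 1) (local_map c) u)"
    by (simp add: dird_sum[OF local_map_Cinf[OF c] u] dird_scaleR[OF local_map_Cinf[OF c] u])
  finally show ?thesis .
qed

text \<open>The field is the normal part of the constant vector \<open>N0\<close>, scaled to unit
  length. At \<open>u\<close> this part is \<open>N0\<close> itself, so it does not vanish
  nearby.\<close>

lemma smooth_normal:
  assumes c: "c \<in> \<A>" and u: "u \<in> inner_coords c"
    and N: "norm N0 = 1" "\<And>i. N0 \<bullet> tangent_vec c F (chart_inv c u) i = 0"
  obtains W N where "open W" "u \<in> W" "W \<subseteq> inner_coords c" "Cinf_on N W" "N u = N0"
    "\<And>y. y \<in> W \<Longrightarrow> norm (N y) = 1" "\<And>y i. y \<in> W \<Longrightarrow> N y \<bullet> tangent_vec c F (chart_inv c y) i = 0"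
proof -
  let ?I = "inner_coords c"
  let ?t = "\<lambda>y. tangent_vec c F (chart_inv c y)"
  have I: "open ?I" by (rule open_inner_coords[OF c])
  have t: "Cinf_on (\<lambda>y. ?t y i) ?I" for i
    by (rule Cinf_on_cong[OF I _ Cinf_on_dird[OF local_map_Cinf[OF c], of "axis i 1"]])
      (simp add: tangent_vec_inner[OF c])
  have indep: "lin_indep_family (?t y)" if "y \<in> ?I" for y
    by (rule tangent_indep[OF c inner_chart_inv[OF that]])
  have inv: "Cinf_on (\<lambda>y. matrix_inv (gram (?t y)) $ k $ l) ?I" for k l
  proof (rule Cinf_on_matrix_inv[OF I])
    show "Cinf_on (\<lambda>y. gram (?t y) $ i $ j) ?I" for i j
      using Cinf_on_inner[OF I t t] by (simp add: gram_def)
  qed (rule gram_invertible[OF indep])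
  define n where "n y = N0 - tangential (?t y) N0" for y
  have n: "Cinf_on n ?I"
    unfolding n_def[abs_def] tangential_def
    by (intro Cinf_on_diff Cinf_on_sum Cinf_on_scaleR Cinf_on_mult Cinf_on_inner Cinf_on_const I inv t)
  have nu: "n u = N0" using N by (simp add: n_def tangential_def)
  define W where "W = ?I \<inter> n -` (- {0})"
  have W: "open W" unfolding W_def by (rule continuous_open_preimage[OF Cinf_on_continuous[OF n] I]) auto
  define N where "N y = inverse (sqrt (n y \<bullet> n y)) *\<^sub>R n y" for y
  have N': "N y = n y /\<^sub>R norm (n y)" for y by (simp add: N_def norm_eq_sqrt_inner)
  show ?thesis
  proof (rule that[of W N])
    show "u \<in> W" using u nu N by (auto simp: W_def)
    show "Cinf_on N W"
      unfolding N_def[abs_def]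
      by (intro Cinf_on_scaleR Cinf_on_inverse_sqrt Cinf_on_inner W Cinf_on_subset[OF n]) (auto simp: W_def)
    show "N u = N0" using N nu by (simp add: N')
    show "norm (N y) = 1" if "y \<in> W" for y using that by (auto simp: N' W_def)
    show "N y \<bullet> ?t y i = 0" if "y \<in> W" for y i
      using tangential_inner[OF indep, of y N0 i] that by (auto simp: N' W_def n_def inner_diff_left)
  qed (use W in \<open>auto simp: W_def\<close>)
qed

end

section \<open>Minimality in an adapted frame\<close>

lemma sum_swap_pairs:
  fixes T :: "'i::finite \<Rightarrow> 'j::finite \<Rightarrow> 'k::finite \<Rightarrow> 'l::finite \<Rightarrow> 'z::comm_monoid_add"
  shows "(\<Sum>a\<in>UNIV. \<Sum>b\<in>UNIV. \<Sum>k\<in>UNIV. \<Sum>l\<in>UNIV. T a b k l) = (\<Sum>k\<in>UNIV. \<Sum>l\<in>UNIV. \<Sum>a\<in>UNIV. \<Sum>b\<in>UNIV. T a b k l)"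
proof -
  have swap: "(\<Sum>b\<in>B. \<Sum>k\<in>K. \<Sum>l\<in>L. g b k l) = (\<Sum>k\<in>K. \<Sum>l\<in>L. \<Sum>b\<in>B. g b k l)"
    for g :: "'x \<Rightarrow> 'k \<Rightarrow> 'l \<Rightarrow> 'z" and B K L
    by (subst sum.swap) (intro sum.cong refl sum.swap)
  show ?thesis unfolding swap ..
qed

locale minimal_hypersurface = immersed_hypersurface M \<A> F
  for M :: "'a topology" and \<A> :: "('a, 'n::finite) chart set" and F :: "'a \<Rightarrow> real^'m::finite" +
  assumes minimal: "\<And>c p. c \<in> \<A> \<Longrightarrow> p \<in> fst c \<Longrightarrow> mean_curvature_vec c F p = 0"
begin

lemma minimal_trace:
  assumes c: "c \<in> \<A>" and u: "u \<in> inner_coords c"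
    and N: "norm N = 1" "\<And>i. N \<bullet> tangent_vec c F (chart_inv c u) i = 0"
  shows "(\<Sum>i\<in>UNIV. \<Sum>j\<in>UNIV. matrix_inv (gram (tangent_vec c F (chart_inv c u))) $ i $ j *
    (N \<bullet> dird (axis i 1) (dird (axis j 1) (local_map c)) u)) = 0"
proof -
  let ?p = "chart_inv c u"
  have p: "?p \<in> fst c" by (rule inner_chart_inv[OF u])
  have m: "inverse_metric c F ?p = matrix_inv (gram (tangent_vec c F ?p))"
    by (simp add: inverse_metric_def metric_def gram_def)
  have "(\<Sum>i\<in>UNIV. \<Sum>j\<in>UNIV. matrix_inv (gram (tangent_vec c F ?p)) $ i $ j *
     (dird (axis i 1) (dird (axis j 1) (local_map c)) u \<bullet> normal ?p)) *\<^sub>R normal ?p = 0"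
    using minimal[OF c p]
    by (simp add: mean_curvature_vec_def m second_fundamental_form_eq[OF c p] second_partial_inner[OF c u] scaleR_sum_left)
  moreover have "normal ?p \<noteq> 0" using normal(1)[of ?p] p chart_subset[OF c] by force
  ultimately have 0: "(\<Sum>i\<in>UNIV. \<Sum>j\<in>UNIV. matrix_inv (gram (tangent_vec c F ?p)) $ i $ j *
     (dird (axis i 1) (dird (axis j 1) (local_map c)) u \<bullet> normal ?p)) = 0" by simp
  from normal_unique[OF c p N] show ?thesis
  proof
    assume "N = normal ?p"
    then show ?thesis using 0 by (simp add: inner_commute)
  next
    assume "N = - normal ?p"
    then show ?thesis using 0 by (simp add: inner_commute sum_negf)
  qed
qed

lemma sff_norm_sq_inner:
  fixes E :: "'k::finite \<Rightarrow> real^'n"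
  assumes c: "c \<in> \<A>" and u: "u \<in> inner_coords c"
    and N: "norm N = 1" "\<And>i. N \<bullet> tangent_vec c F (chart_inv c u) i = 0"
    and E: "\<And>i j. matrix_inv (gram (tangent_vec c F (chart_inv c u))) $ i $ j = (\<Sum>a\<in>UNIV. E a $ i * E a $ j)"
  shows "sff_norm_sq c F (chart_inv c u) = (\<Sum>a\<in>UNIV. \<Sum>b\<in>UNIV. (\<Sum>i\<in>UNIV. \<Sum>j\<in>UNIV.
    E a $ i * E b $ j * (N \<bullet> dird (axis i 1) (dird (axis j 1) (local_map c)) u))\<^sup>2)"
proof -
  let ?p = "chart_inv c u"
  let ?b = "\<lambda>i j. N \<bullet> dird (axis i 1) (dird (axis j 1) (local_map c)) u"
  have p: "?p \<in> fst c" by (rule inner_chart_inv[OF u])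
  have m: "inverse_metric c F ?p = matrix_inv (gram (tangent_vec c F ?p))"
    by (simp add: inverse_metric_def metric_def gram_def)
  have nn: "normal ?p \<bullet> normal ?p = 1" using normal(1)[of ?p] p chart_subset[OF c] by (auto simp: dot_square_norm)
  have "second_fundamental_form c F ?p i j \<bullet> second_fundamental_form c F ?p k l = ?b i j * ?b k l" for i j k l
    using normal_unique[OF c p N]
    by (auto simp: second_fundamental_form_eq[OF c p] second_partial_inner[OF c u] nn inner_commute)
  then have "sff_norm_sq c F ?p = (\<Sum>i\<in>UNIV. \<Sum>j\<in>UNIV. \<Sum>k\<in>UNIV. \<Sum>l\<in>UNIV.
      inverse_metric c F ?p $ i $ k * inverse_metric c F ?p $ j $ l * (?b i j * ?b k l))"
    by (simp add: sff_norm_sq_def)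
  also have "\<dots> = (\<Sum>a\<in>UNIV. \<Sum>b\<in>UNIV. (\<Sum>i\<in>UNIV. \<Sum>j\<in>UNIV. E a $ i * E b $ j * ?b i j)\<^sup>2)"
    by (rule frame_contraction[where E = "\<lambda>a i. E a $ i" and b = ?b]) (simp add: m E)
  finally show ?thesis .
qed

lemma dird2_local_map:
  assumes c: "c \<in> \<A>" and u: "u \<in> inner_coords c"
  shows "dird v (dird w (local_map c)) u =
    (\<Sum>i\<in>UNIV. \<Sum>j\<in>UNIV. (v $ i * w $ j) *\<^sub>R dird (axis i 1) (dird (axis j 1) (local_map c)) u)"
proof -
  let ?G = "local_map c"
  let ?I = "inner_coords c"
  note G = local_map_Cinf[OF c]
  have basis: "x = (\<Sum>i\<in>UNIV. x $ i *\<^sub>R axis i 1)" for x :: "real^'n"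
    using basis_expansion[of x] by (simp add: scalar_mult_eq_scaleR)
  have lin: "dird x f u = (\<Sum>i\<in>UNIV. x $ i *\<^sub>R dird (axis i 1) f u)" if "Cinf_on f ?I" for x and f :: "real^'n \<Rightarrow> real^'m"
    by (subst basis[of x]) (simp add: dird_sum[OF that u] dird_scaleR[OF that u])
  have "dird v (dird w ?G) u = (\<Sum>i\<in>UNIV. v $ i *\<^sub>R dird (axis i 1) (dird w ?G) u)"
    by (rule lin[OF Cinf_on_dird[OF G]])
  \<comment> \<open>Linearity is available in the outer direction only: the two derivatives are
    exchanged, \<open>w\<close> is expanded, and then they are exchanged back.\<close>
  also have "\<dots> = (\<Sum>i\<in>UNIV. v $ i *\<^sub>R (\<Sum>j\<in>UNIV. w $ j *\<^sub>R dird (axis j 1) (dird (axis i 1) ?G) u))"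
    unfolding lin[OF Cinf_on_dird[OF G], of w, symmetric]
    by (intro sum.cong refl arg_cong[where f = "scaleR _"] dird_commute[OF open_inner_coords[OF c] u G])
  also have "\<dots> = (\<Sum>i\<in>UNIV. \<Sum>j\<in>UNIV. (v $ i * w $ j) *\<^sub>R dird (axis i 1) (dird (axis j 1) ?G) u)"
    unfolding scaleR_sum_right scaleR_scaleR
    by (intro sum.cong refl arg_cong[where f = "scaleR _"] dird_commute[OF open_inner_coords[OF c] u G])
  finally show ?thesis .
qed

text \<open>The frame vectors have constant coefficients, taken from
  \<open>orthonormal_frame\<close> at \<open>u\<close>. In this basis the inverse metric at a nearby
  \<open>y\<close> is the coordinate one transformed by the dual matrix \<open>f\<close>, which
  explains the shape of \<open>h\<close>.\<close>

lemma minimal_frame_at: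
  assumes c: "c \<in> \<A>" and u: "u \<in> inner_coords c"
    and N0: "norm N0 = 1" "\<And>i. N0 \<bullet> tangent_vec c F (chart_inv c u) i = 0"
  obtains W N and e :: "'n \<Rightarrow> real^'n" and h where
    "minimal_frame W u (local_map c) N e h" "W \<subseteq> inner_coords c" "N u = N0"
    "\<And>y. y \<in> W \<Longrightarrow> norm (N y) = 1" "\<And>y i. y \<in> W \<Longrightarrow> N y \<bullet> tangent_vec c F (chart_inv c y) i = 0"
    "(\<Sum>i\<in>UNIV. \<Sum>j\<in>UNIV. (minimal_frame.b u (local_map c) N e i j)\<^sup>2) = sff_norm_sq c F (chart_inv c u)"
proof -
  let ?G = "local_map c"
  let ?t = "\<lambda>y. tangent_vec c F (chart_inv c y)"
  obtain W N where W: "open W" "u \<in> W" "W \<subseteq> inner_coords c" and N: "Cinf_on N W" "N u = N0"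
    "\<And>y. y \<in> W \<Longrightarrow> norm (N y) = 1" "\<And>y i. y \<in> W \<Longrightarrow> N y \<bullet> ?t y i = 0"
    using smooth_normal[OF c u N0] by metis
  have WI: "y \<in> inner_coords c" if "y \<in> W" for y using W that by blast
  have indep: "lin_indep_family (?t y)" if "y \<in> W" for y
    by (rule tangent_indep[OF c inner_chart_inv[OF WI[OF that]]])
  obtain E :: "'n \<Rightarrow> real^'n" and f where
    E1: "\<And>a b. (\<Sum>i\<in>UNIV. E a $ i *\<^sub>R ?t u i) \<bullet> (\<Sum>i\<in>UNIV. E b $ i *\<^sub>R ?t u i) = (if a = b then 1 else 0)"
    and E2: "\<And>i j. matrix_inv (gram (?t u)) $ i $ j = (\<Sum>a\<in>UNIV. E a $ i * E a $ j)"
    and E3: "\<And>i. (\<Sum>a\<in>UNIV. f a i *\<^sub>R E a) = axis i 1"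
    and E4: "\<And>a i. f a i = ?t u i \<bullet> (\<Sum>k\<in>UNIV. E a $ k *\<^sub>R ?t u k)"
    by (rule orthonormal_frame[OF indep[OF W(2)]]) (rule that)
  define ginv where "ginv y = matrix_inv (gram (?t y))" for y
  define h where "h a b y = (\<Sum>i\<in>UNIV. \<Sum>j\<in>UNIV. f a i * f b j * ginv y $ i $ j)" for a b y
  have GE: "dird (E a) ?G y = (\<Sum>i\<in>UNIV. E a $ i *\<^sub>R ?t y i)" if "y \<in> W" for a y
    unfolding tangent_vec_inner[OF c WI[OF that]] by (rule dird_local_map[OF c WI[OF that]])
  have fEk: "(\<Sum>a\<in>UNIV. f a i * E a $ k) = (if k = i then 1 else 0)" for i k
    using arg_cong[OF E3[of i], of "\<lambda>x. x $ k"] by (simp add: axis_def)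
  have tf: "(\<Sum>a\<in>UNIV. f a i *\<^sub>R dird (E a) ?G y) = ?t y i" if "y \<in> W" for i y
  proof -
    have "(\<Sum>a\<in>UNIV. f a i *\<^sub>R dird (E a) ?G y) = (\<Sum>k\<in>UNIV. (\<Sum>a\<in>UNIV. f a i * E a $ k) *\<^sub>R ?t y k)"
      unfolding GE[OF that] scaleR_sum_right scaleR_sum_left by (subst sum.swap) simp
    also have "\<dots> = ?t y i" by (simp add: fEk if_distrib[of "\<lambda>u. u *\<^sub>R _"] cong: if_cong)
    finally show ?thesis .
  qed
  have fE: "(\<Sum>i\<in>UNIV. f a i * E b $ i) = (if a = b then 1 else 0)" for a b
    using E1[of b a] unfolding E4 by (simp add: inner_sum_left mult.commute eq_commute)
  have frame: "minimal_frame W u ?G N E h"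
  proof
    show "open W" "u \<in> W" by (fact W)+
    show "Cinf_on ?G W" by (rule Cinf_on_subset[OF local_map_Cinf[OF c] W(3)])
    show "Cinf_on N W" by (fact N)
    show "Cinf_on (h a b) W" for a b
    proof -
      have t: "Cinf_on (\<lambda>y. ?t y i) W" for i
        by (rule Cinf_on_cong[OF W(1) _ Cinf_on_subset[OF Cinf_on_dird[OF local_map_Cinf[OF c], of "axis i 1"] W(3)]])
          (simp add: tangent_vec_inner[OF c WI])
      have "Cinf_on (\<lambda>y. ginv y $ i $ j) W" for i j
        unfolding ginv_def
      proof (rule Cinf_on_matrix_inv[OF W(1)])
        show "Cinf_on (\<lambda>y. gram (?t y) $ i $ j) W" for i j
          using Cinf_on_inner[OF W(1) t t] by (simp add: gram_def)
      qed (rule gram_invertible[OF indep])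
      then show ?thesis
        unfolding h_def[abs_def] by (intro Cinf_on_sum Cinf_on_mult Cinf_on_const W(1))
    qed
    show "N y \<bullet> N y = 1" if "y \<in> W" for y using N(3)[OF that] by (simp add: dot_square_norm)
    show "N y \<bullet> dird (E i) ?G y = 0" if "y \<in> W" for y i
      unfolding GE[OF that] by (simp add: inner_sum_right N(4)[OF that])
    show "(\<Sum>k\<in>UNIV. h a k y * (dird (E k) ?G y \<bullet> dird (E b) ?G y)) = (if a = b then 1 else 0)"
      if y: "y \<in> W" for y a b
    proof -
      let ?w = "dird (E b) ?G y"
      have "(\<Sum>k\<in>UNIV. h a k y * (dird (E k) ?G y \<bullet> ?w))
        = (\<Sum>i\<in>UNIV. \<Sum>j\<in>UNIV. f a i * ginv y $ i $ j * ((\<Sum>k\<in>UNIV. f k j *\<^sub>R dird (E k) ?G y) \<bullet> ?w))"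
        unfolding h_def sum_distrib_right sum_distrib_left inner_sum_left
        by (subst sum.swap, subst (2) sum.swap) (simp add: mult_ac)
      also have "\<dots> = (\<Sum>i\<in>UNIV. f a i * (\<Sum>j\<in>UNIV. ginv y $ i $ j * (?t y j \<bullet> ?w)))"
        by (simp add: tf[OF y] sum_distrib_left mult.assoc)
      also have "(\<lambda>i. \<Sum>j\<in>UNIV. ginv y $ i $ j * (?t y j \<bullet> ?w)) = (\<lambda>i. E b $ i)"
      proof
        fix i
        have "(\<Sum>j\<in>UNIV. ginv y $ i $ j * (?t y j \<bullet> ?w))
          = (\<Sum>k\<in>UNIV. E b $ k * (\<Sum>j\<in>UNIV. ginv y $ i $ j * (?t y j \<bullet> ?t y k)))"
          unfolding GE[OF y] inner_sum_right sum_distrib_left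
          by (subst sum.swap) (simp add: mult_ac)
        then show "(\<Sum>j\<in>UNIV. ginv y $ i $ j * (?t y j \<bullet> ?w)) = E b $ i"
          by (simp add: ginv_def gram_inverse(2)[OF indep[OF y]] if_distrib[of "\<lambda>u. _ * u"] cong: if_cong)
      qed
      finally show ?thesis unfolding fE .
    qed
    show "(\<Sum>a\<in>UNIV. \<Sum>b\<in>UNIV. h a b y * (N y \<bullet> dird (E a) (dird (E b) ?G) y)) = 0" if y: "y \<in> W" for y
    proof -
      let ?X = "\<lambda>k l. N y \<bullet> dird (axis k 1) (dird (axis l 1) ?G) y"
      have B: "N y \<bullet> dird (E a) (dird (E b) ?G) y = (\<Sum>k\<in>UNIV. \<Sum>l\<in>UNIV. E a $ k * E b $ l * ?X k l)" for a b
        using arg_cong[OF dird2_local_map[OF c WI[OF y], of "E a" "E b"], of "\<lambda>z. N y \<bullet> z"]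
        by (simp only: inner_sum_right inner_scaleR_right)
      have fEE: "(\<Sum>a\<in>UNIV. \<Sum>b\<in>UNIV. f a i * f b j * (\<Sum>k\<in>UNIV. \<Sum>l\<in>UNIV. E a $ k * E b $ l * ?X k l)) = ?X i j" for i j
      proof -
        have "(\<Sum>a\<in>UNIV. \<Sum>b\<in>UNIV. f a i * f b j * (\<Sum>k\<in>UNIV. \<Sum>l\<in>UNIV. E a $ k * E b $ l * ?X k l))
          = (\<Sum>k\<in>UNIV. \<Sum>l\<in>UNIV. (\<Sum>a\<in>UNIV. f a i * E a $ k) * (\<Sum>b\<in>UNIV. f b j * E b $ l) * ?X k l)"
          unfolding sum_product unfolding sum_distrib_left sum_distrib_right
          by (subst sum_swap_pairs) (simp only: mult_ac)
        also have "\<dots> = (\<Sum>k\<in>UNIV. (if k = i then 1 else 0) * (\<Sum>l\<in>UNIV. (if l = j then 1 else 0) * ?X k l))"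
          by (simp only: fEk sum_distrib_left mult.assoc)
        also have "\<dots> = ?X i j" by (simp add: if_distrib[of "\<lambda>u. u * _"] cong: if_cong)
        finally show ?thesis .
      qed
      have "(\<Sum>a\<in>UNIV. \<Sum>b\<in>UNIV. h a b y * (N y \<bullet> dird (E a) (dird (E b) ?G) y))
        = (\<Sum>i\<in>UNIV. \<Sum>j\<in>UNIV. ginv y $ i $ j *
            (\<Sum>a\<in>UNIV. \<Sum>b\<in>UNIV. f a i * f b j * (N y \<bullet> dird (E a) (dird (E b) ?G) y)))"
        unfolding h_def sum_distrib_left sum_distrib_right
        by (subst sum_swap_pairs) (simp only: mult_ac)
      also have "\<dots> = (\<Sum>i\<in>UNIV. \<Sum>j\<in>UNIV. ginv y $ i $ j * ?X i j)" unfolding B fEE ..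
      also have "\<dots> = 0" using minimal_trace[OF c WI[OF y] N(3)[OF y] N(4)[OF y]] by (simp add: ginv_def)
      finally show ?thesis .
    qed
    show "dird (E i) ?G u \<bullet> dird (E j) ?G u = (if i = j then 1 else 0)" for i j
      unfolding GE[OF W(2)] by (rule E1)
    show "v = (\<Sum>i\<in>UNIV. (v \<bullet> dird (E i) ?G u) *\<^sub>R dird (E i) ?G u) + (v \<bullet> N u) *\<^sub>R N u" for v
    proof -
      have "tangential (?t u) v = (\<Sum>i\<in>UNIV. (v \<bullet> dird (E i) ?G u) *\<^sub>R dird (E i) ?G u)"
      proof -
        have "tangential (?t u) v = (\<Sum>k\<in>UNIV. \<Sum>l\<in>UNIV. \<Sum>a\<in>UNIV. (E a $ k * E a $ l * (v \<bullet> ?t u l)) *\<^sub>R ?t u k)"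
          by (simp add: tangential_def E2 sum_distrib_right scaleR_sum_left)
        also have "\<dots> = (\<Sum>a\<in>UNIV. \<Sum>k\<in>UNIV. \<Sum>l\<in>UNIV. (E a $ k * E a $ l * (v \<bullet> ?t u l)) *\<^sub>R ?t u k)"
          by (subst sum.swap[of _ "UNIV :: 'n set"]) (subst (2) sum.swap, rule refl)
        also have "\<dots> = (\<Sum>i\<in>UNIV. (v \<bullet> dird (E i) ?G u) *\<^sub>R dird (E i) ?G u)"
          unfolding GE[OF W(2)]
          by (simp add: inner_sum_right scaleR_sum_right scaleR_sum_left sum_distrib_left mult_ac)
        finally show ?thesis .
      qed
      then show ?thesis
        using hypersurface_expansion[OF indep[OF W(2)] card N(3)[OF W(2)] N(4)[OF W(2)], of v] by simp
    qed
  qed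
  have "minimal_frame.b u ?G N E a b =
      (\<Sum>i\<in>UNIV. \<Sum>j\<in>UNIV. E a $ i * E b $ j * (N u \<bullet> dird (axis i 1) (dird (axis j 1) ?G) u))" for a b
    unfolding minimal_frame.b_def[OF frame] minimal_frame.G2_def[OF frame] minimal_frame.G1_def[OF frame]
    using arg_cong[OF dird2_local_map[OF c u, of "E a" "E b"], of "\<lambda>z. N u \<bullet> z"]
    by (simp only: inner_sum_right inner_scaleR_right)
  then have "(\<Sum>i\<in>UNIV. \<Sum>j\<in>UNIV. (minimal_frame.b u ?G N E i j)\<^sup>2) = sff_norm_sq c F (chart_inv c u)"
    using sff_norm_sq_inner[OF c u N(3)[OF W(2)] N(4)[OF W(2)] E2] by simp
  then show ?thesis using that[OF frame W(3) N(2) N(3) N(4)] by blast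
qed

lemma boundary_or_inner:
  assumes "c \<in> \<A>" "p \<in> fst c" "p \<notin> manifold_boundary \<A>"
  shows "snd c p \<in> inner_coords c"
proof -
  have "snd c p \<in> half_space" using chart(2)[OF assms(1)] assms(2) openin_imp_subset by fastforce
  moreover have "snd c p $ bdry_coord \<noteq> 0" using assms by (auto simp: manifold_boundary_def)
  ultimately show ?thesis using assms(2) by (auto simp: inner_coords_def half_space_def)
qed

end

section \<open>Vanishing of the support function\<close>

text \<open>\<open>\<phi> (F p \<bullet> F p)\<close> is a strict supersolution of the Jacobi equation away from the zeros of \<open>F\<close>;
  \<open>K\<close> is \<open>1 / \<phi>\<^sup>2\<close>, but continuous at \<open>0\<close> as well.\<close>
lemma (in minimal_hypersurface) support_function_vanishes:
  fixes \<phi> \<phi>' \<phi>'' K :: "real \<Rightarrow> real"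
  assumes compact: "compact_space M"
    and free_boundary: "free_boundary_in_ball \<A> F"
    and \<phi>: "\<And>t. t > 0 \<Longrightarrow> (\<phi> has_real_derivative \<phi>' t) (at t)"
    and \<phi>': "\<And>t. t > 0 \<Longrightarrow> (\<phi>' has_real_derivative \<phi>'' t) (at t)"
    and \<phi>_pos: "\<And>t. t > 0 \<Longrightarrow> \<phi> t > 0" and \<phi>_nonneg: "\<And>t. t \<ge> 0 \<Longrightarrow> \<phi> t \<ge> 0"
    and K: "continuous_on {0..} K" "\<And>t. t > 0 \<Longrightarrow> K t * (\<phi> t)\<^sup>2 = 1"
    and super: "\<And>c p v. c \<in> \<A> \<Longrightarrow> p \<in> fst c \<Longrightarrow> 0 < v \<Longrightarrow> v \<le> F p \<bullet> F p \<Longrightarrow>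
      4 * \<phi>'' (F p \<bullet> F p) * (F p \<bullet> F p - v) + 2 * CARD('n) * \<phi>' (F p \<bullet> F p) + sff_norm_sq c F p * \<phi> (F p \<bullet> F p) < 0"
    and q: "q \<in> topspace M"
  shows "F q \<bullet> normal q = 0"
proof (rule ccontr)
  assume nz: "F q \<bullet> normal q \<noteq> 0"
  \<comment> \<open>The squared ratio of support function and barrier. It does not depend on the
    sign of the normal, and \<open>K\<close> makes it continuous also at zeros of
    \<open>F\<close>.\<close>
  define H where "H p = (F p \<bullet> normal p)\<^sup>2 * K (F p \<bullet> F p)" for p
  have Kpos: "K t > 0" if "t > 0" for t
  proof -
    have "(\<phi> t)\<^sup>2 > 0" using \<phi>_pos[OF that] by simp
    then show ?thesis using K(2)[OF that] by (metis zero_less_mult_pos2 zero_less_one)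
  qed
  have "continuous_map M euclidean H"
  proof (rule continuous_map_charts)
    fix c assume c: "c \<in> \<A>"
    have cont: "continuous_on (coords c) (f \<circ> chart_inv c)" if "continuous_map M euclidean f" for f :: "'a \<Rightarrow> 'z::topological_space"
      using that by (rule continuous_on_chart[OF c])
    have 1: "continuous_on (coords c) (\<lambda>u. F (chart_inv c u))" using cont[OF continuous_map_F] by (simp add: o_def)
    have 2: "continuous_on (coords c) (\<lambda>u. (F (chart_inv c u) \<bullet> normal (chart_inv c u))\<^sup>2)"
      using cont[OF continuous_normal_component[OF continuous_map_F]] by (simp add: o_def)
    have "continuous_on (coords c) (\<lambda>u. K (F (chart_inv c u) \<bullet> F (chart_inv c u)))"
      by (rule continuous_on_compose2[OF K(1) continuous_on_inner[OF 1 1]]) auto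
    from continuous_on_mult[OF 2 this] show "continuous_on (coords c) (H \<circ> chart_inv c)" by (simp add: H_def o_def)
  qed
  then have "compact (H ` topspace M)"
    using image_compactin[of M "topspace M" euclidean H] compact by (simp add: compact_space_def)
  then obtain p where p: "p \<in> topspace M" and max: "\<And>r. r \<in> topspace M \<Longrightarrow> H r \<le> H p"
    using compact_attains_sup[of "H ` topspace M"] q by (metis (no_types, lifting) empty_iff imageE imageI)
  have "F q \<noteq> 0" using nz by auto
  then have "0 < H q" using nz Kpos[of "F q \<bullet> F q"] by (simp add: H_def)
  then have Hp: "H p > 0" using max[OF q] by simp
  then have up: "F p \<bullet> normal p \<noteq> 0" by (auto simp: H_def)
  obtain c where c: "c \<in> \<A>" "p \<in> fst c" using chart_cover p by blast
  \<comment> \<open>At a boundary point the free boundary condition would give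
    \<open>F p \<bullet> normal p = 0\<close>.\<close>
  have "p \<notin> manifold_boundary \<A>"
    using free_boundary c normal(2)[OF p] up unfolding free_boundary_in_ball_def by (metis IntI inner_commute)
  then have u: "snd c p \<in> inner_coords c" by (rule boundary_or_inner[OF c])
  define u where "u = snd c p"
  have cu: "chart_inv c u = p" using chart_inv_left[OF c] by (simp add: u_def)
  \<comment> \<open>The sign is chosen so that the support function is positive at
    \<open>p\<close>.\<close>
  define N0 where "N0 = sgn (F p \<bullet> normal p) *\<^sub>R normal p"
  have N0: "norm N0 = 1" "N0 \<bullet> tangent_vec c F (chart_inv c u) i = 0" for i
    using normal[OF p] c up by (auto simp: N0_def cu sgn_if)
  have FN0: "F p \<bullet> N0 = \<bar>F p \<bullet> normal p\<bar>" by (simp add: N0_def sgn_if abs_if)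
  obtain W N and e :: "'n \<Rightarrow> real^'n" and h where
    frame: "minimal_frame W u (local_map c) N e h" and W: "W \<subseteq> inner_coords c" and Nu: "N u = N0" and
    N: "\<And>y. y \<in> W \<Longrightarrow> norm (N y) = 1" "\<And>y i. y \<in> W \<Longrightarrow> N y \<bullet> tangent_vec c F (chart_inv c y) i = 0"
    and sff: "(\<Sum>i\<in>UNIV. \<Sum>j\<in>UNIV. (minimal_frame.b u (local_map c) N e i j)\<^sup>2) = sff_norm_sq c F (chart_inv c u)"
    by (rule minimal_frame_at[OF c(1) u[folded u_def] N0]) (rule that)
  \<comment> \<open>The maximal ratio: its square is \<open>H p\<close>, so \<open>\<Lambda>\<close>
    times the barrier touches the local support function from above at \<open>p\<close>.\<close>
  define \<Lambda> where "\<Lambda> = \<bar>F p \<bullet> normal p\<bar> / \<phi> (F p \<bullet> F p)"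
  have tp: "F p \<bullet> F p > 0" using up by auto
  note \<phi>p = \<phi>_pos[OF tp]
  have \<Lambda>: "\<Lambda> > 0" using up \<phi>p by (simp add: \<Lambda>_def)
  have \<Lambda>sq: "\<Lambda>\<^sup>2 = H p"
  proof -
    have "K (F p \<bullet> F p) = 1 / (\<phi> (F p \<bullet> F p))\<^sup>2" using K(2)[OF tp] \<phi>p by (simp add: field_simps)
    then show ?thesis by (simp add: \<Lambda>_def H_def power_divide)
  qed
  have le: "local_map c y \<bullet> N y \<le> \<Lambda> * \<phi> (local_map c y \<bullet> local_map c y)" if y: "y \<in> W" for y
  proof -
    define r where "r = chart_inv c y"
    have r: "r \<in> fst c" unfolding r_def by (rule inner_chart_inv[OF subsetD[OF W y]])
    then have rM: "r \<in> topspace M" using chart_subset[OF c(1)] by blast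
    have sq: "(F r \<bullet> N y)\<^sup>2 = (F r \<bullet> normal r)\<^sup>2"
      using normal_unique[OF c(1) r N(1)[OF y] N(2)[OF y, folded r_def]] by auto
    show ?thesis
    \<comment> \<open>The barrier is controlled by \<open>K\<close> at positive arguments only. At a
      zero of \<open>F\<close> the support function is 0, and \<open>\<phi> 0 \<ge> 0\<close>
      suffices.\<close>
    proof (cases "F r = 0")
      case True
      then show ?thesis using \<Lambda> \<phi>_nonneg[of 0] by (simp add: r_def)
    next
      case False
      then have t: "F r \<bullet> F r > 0" by simp
      have "(F r \<bullet> N y)\<^sup>2 = H r * (\<phi> (F r \<bullet> F r))\<^sup>2"
        using K(2)[OF t] by (simp add: H_def sq)
      also have "\<dots> \<le> (\<Lambda> * \<phi> (F r \<bullet> F r))\<^sup>2"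
        using max[OF rM] by (simp add: power_mult_distrib \<Lambda>sq mult_right_mono)
      finally have "F r \<bullet> N y \<le> \<Lambda> * \<phi> (F r \<bullet> F r)"
        using \<Lambda> \<phi>_pos[OF t] by (meson power2_le_imp_le mult_nonneg_nonneg less_imp_le)
      then show ?thesis by (simp add: r_def)
    qed
  qed
  have "0 \<le> 4 * \<phi>'' (F p \<bullet> F p) * (F p \<bullet> F p - (F p \<bullet> N0)\<^sup>2) + 2 * CARD('n) * \<phi>' (F p \<bullet> F p)
    + sff_norm_sq c F p * \<phi> (F p \<bullet> F p)"
    using minimal_frame.support_function_max[OF frame \<phi> \<phi>' _ \<Lambda> le, unfolded sff] up \<phi>p
    by (simp add: cu Nu FN0 \<Lambda>_def)
  moreover have "0 < (F p \<bullet> N0)\<^sup>2" "(F p \<bullet> N0)\<^sup>2 \<le> F p \<bullet> F p"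
    using up Cauchy_Schwarz_ineq[of "F p" N0] N0(1) by (simp_all add: FN0 dot_square_norm)
  ultimately show False using super[OF c, of "(F p \<bullet> N0)\<^sup>2"] by linarith
qed

section \<open>Extension across the boundary and local injectivity\<close>

lemma inner_coords_approach:
  fixes u :: "real^'n::finite"
  assumes "0 \<le> u $ bdry_coord" "r > 0"
  obtains x where "x \<in> ball u r" "0 < x $ bdry_coord"
proof
  show "u + (r / 2) *\<^sub>R axis bdry_coord 1 \<in> ball u r" using assms(2) by (simp add: dist_norm norm_axis_1)
  show "0 < (u + (r / 2) *\<^sub>R axis bdry_coord 1) $ bdry_coord" using assms by simp
qed

context immersed_hypersurface
begin

lemma chart_ball:
  assumes c: "c \<in> \<A>" and p: "p \<in> fst c" and U: "openin M U" "p \<in> U"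
  obtains r where "r > 0" "\<And>y. y \<in> ball (snd c p) r \<Longrightarrow> y \<in> half_space \<Longrightarrow> y \<in> coords c \<and> chart_inv c y \<in> U"
proof -
  have "openin (top_of_set half_space) (snd c ` (U \<inter> fst c))"
    using chart(1)[OF c] U by (intro chart_image_open[OF c]) auto
  moreover have "snd c p \<in> snd c ` (U \<inter> fst c)" using p U by blast
  ultimately obtain r where r: "r > 0" "ball (snd c p) r \<inter> half_space \<subseteq> snd c ` (U \<inter> fst c)"
    unfolding openin_contains_ball by blast
  have "y \<in> coords c \<and> chart_inv c y \<in> U" if "y \<in> ball (snd c p) r" "y \<in> half_space" for y
  proof -
    have "y \<in> snd c ` (U \<inter> fst c)" using r that by (meson IntI subsetD)
    then show ?thesis using chart_inv_left[OF c] by auto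
  qed
  then show ?thesis using r(1) that by blast
qed

lemma coords_half_space: "c \<in> \<A> \<Longrightarrow> u \<in> coords c \<Longrightarrow> 0 \<le> u $ bdry_coord"
  using subsetD[OF openin_imp_subset[OF chart(2)]] unfolding half_space_def by blast

text \<open>The linear map \<open>P\<close> allows one to keep an extension across the boundary inside a subspace
  that contains the image of \<open>F\<close>.\<close>
lemma injective_extension:
  fixes P :: "real^'m \<Rightarrow> real^'m"
  assumes c: "c \<in> \<A>" and u: "u \<in> coords c"
    and P: "linear P" "\<And>p. p \<in> topspace M \<Longrightarrow> P (F p) = F p"
  obtains r g where "r > 0" "Cinf_on g (ball u r)" "inj_on g (ball u r)" "g ` ball u r \<subseteq> range P"
    "\<And>y. y \<in> ball u r \<Longrightarrow> y \<in> coords c \<Longrightarrow> g y = F (chart_inv c y)"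
proof -
  obtain W g0 where W: "open W" "u \<in> W" "Cinf_on g0 W" "\<And>y. y \<in> W \<inter> coords c \<Longrightarrow> g0 y = local_map c y"
    using smooth_on_extension[OF local_map_smooth[OF c] chart(2)[OF c] u] by metis
  define g where "g y = P (g0 y)" for y
  have g: "Cinf_on g W"
    unfolding g_def[abs_def] by (rule Cinf_on_bounded_linear[OF W(1) linear_conv_bounded_linear[THEN iffD1, OF P(1)] W(3)])
  have geq: "g y = F (chart_inv c y)" if "y \<in> W" "y \<in> coords c" for y
    using W(4)[of y] that P(2)[of "chart_inv c y"] chart_inv_in[OF that(2)] chart_subset[OF c] by (auto simp: g_def)
  have gder: "(g has_derivative (\<lambda>v. dird v g y)) (at y)" if "y \<in> W" for y
    by (rule Cinf_on_has_derivative[OF g that])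
  obtain r0 where r0: "r0 > 0" "ball u r0 \<subseteq> W" using W openE by blast
  \<comment> \<open>The derivative of the extension at \<open>u\<close> is the one-sided derivative
    of the immersion, hence injective also when \<open>u\<close> is a boundary point.\<close>
  have "(local_map c has_derivative (\<lambda>v. dird v g u)) (at u within coords c)"
    by (rule has_derivative_transform_within[OF has_derivative_at_withinI[OF gder[OF W(2)]] r0(1) u])
      (use r0 geq in \<open>auto simp: dist_commute subset_eq\<close>)
  then have "(\<lambda>v. dird v g u) = frechet_derivative (local_map c) (at u within coords c)"
    by (rule half_space_derivative_unique[OF chart(2)[OF c] u _ local_map_derivative[OF c u]])
  then have "inj (\<lambda>v. dird v g u)"
    using immersion c u unfolding smooth_immersion_def by auto
  moreover have lin: "linear (\<lambda>v. dird v g u)" using gder[OF W(2)] by (rule has_derivative_linear)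
  ultimately obtain g' where g': "linear g'" "g' \<circ> (\<lambda>v. dird v g u) = id"
    using linear_injective_left_inverse by blast
  \<comment> \<open>Continuity of the derivative in operator norm, as the local injectivity theorem
    demands; it suffices to control the finitely many basis directions.\<close>
  have onorm: "\<exists>d>0. \<forall>x. dist u x < d \<longrightarrow> onorm (\<lambda>v. dird v g x - dird v g u) < e" if e: "e > 0" for e
  proof -
    let ?s = "\<lambda>x. \<Sum>b\<in>Basis. norm (dird b g x - dird b g u)"
    have "isCont (dird b g) u" for b
      using Cinf_on_continuous[OF Cinf_on_dird[OF g]] W by (simp add: continuous_on_eq_continuous_at)
    then have "isCont ?s u" by (intro continuous_intros)
    then obtain d where d: "d > 0" "\<And>x. dist x u < d \<Longrightarrow> dist (?s x) (?s u) < e"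
      using e unfolding continuous_at_eps_delta by blast
    have "onorm (\<lambda>v. dird v g x - dird v g u) < e" if x: "dist u x < min d r0" for x
    proof -
      have "x \<in> W" using r0 x by auto
      then have "bounded_linear (\<lambda>v. dird v g x - dird v g u)"
        using gder W(2) has_derivative_bounded_linear bounded_linear_sub by blast
      then have "onorm (\<lambda>v. dird v g x - dird v g u) \<le> ?s x" by (rule onorm_componentwise)
      also have "?s x < e"
      proof -
        have "?s x \<le> \<bar>?s x\<bar>" by simp
        also have "\<dots> < e" using d(2)[of x] x by (simp add: dist_real_def dist_commute)
        finally show ?thesis .
      qed
      finally show ?thesis .
    qed
    then show ?thesis using d r0 by (intro exI[of _ "min d r0"]) auto
  qed
  obtain r where r: "r > 0" "ball u r \<subseteq> W" "inj_on g (ball u r)"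
    by (rule has_derivative_locally_injective[OF W(2,1) linear_conv_bounded_linear[THEN iffD1, OF g'(1)] g'(2) gder onorm])
  show ?thesis
    by (rule that[OF r(1) Cinf_on_subset[OF g r(2)] r(3)]) (use geq r(2) in \<open>auto simp: g_def\<close>)
qed

lemma locally_inj_F: "locally_inj M F"
  unfolding locally_inj_def
proof
  fix p assume "p \<in> topspace M"
  then obtain c where c: "c \<in> \<A>" "p \<in> fst c" using chart_cover by blast
  have "linear (id :: real^'m \<Rightarrow> real^'m)" "snd c p \<in> coords c" using c by (auto simp: linear_id)
  then obtain r g where g: "r > 0" "inj_on g (ball (snd c p) r)"
    "\<And>y. y \<in> ball (snd c p) r \<Longrightarrow> y \<in> coords c \<Longrightarrow> g y = F (chart_inv c y)"
    using injective_extension[OF c(1), of "snd c p" id] by (metis id_apply)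
  let ?V = "{q \<in> fst c. snd c q \<in> ball (snd c p) r}"
  have "inj_on F ?V"
  proof (rule inj_onI)
    fix q q' assume q: "q \<in> ?V" "q' \<in> ?V" "F q = F q'"
    then have "g (snd c q) = g (snd c q')" using g(3) chart_inv_left[OF c(1)] by auto
    then have "snd c q = snd c q'" using g(2) q by (auto simp: inj_on_def)
    then show "q = q'" using chart_inj[OF c(1)] q by (auto simp: inj_on_def)
  qed
  moreover have "openin M ?V" by (rule chart_preimage_open[OF c(1) open_ball])
  moreover have "p \<in> ?V" using c g(1) by simp
  ultimately show "\<exists>V. openin M V \<and> p \<in> V \<and> inj_on F V" by blast
qed

text \<open>Compactness gives a finite cover by open sets on which \<open>F\<close> is injective,
  and each of them contains at most one point of the fibre.\<close>

lemma finite_fibre: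
  assumes "compact_space M"
  shows "finite {p \<in> topspace M. F p = y}"
proof -
  let ?U = "{V. openin M V \<and> inj_on F V}"
  have "(\<forall>U\<in>?U. openin M U) \<and> topspace M \<subseteq> \<Union>?U" using locally_inj_F unfolding locally_inj_def by blast
  then obtain \<F> where \<F>: "finite \<F>" "\<F> \<subseteq> ?U" "topspace M \<subseteq> \<Union>\<F>"
    using assms unfolding compact_space_alt by meson
  have "finite {p \<in> V. F p = y}" if "V \<in> \<F>" for V
  proof -
    have "inj_on F V" using \<F>(2) that by blast
    then have "inj_on F {p \<in> V. F p = y}" by (rule inj_on_subset) auto
    moreover have "finite (F ` {p \<in> V. F p = y})" by (rule finite_subset[of _ "{y}"]) auto
    ultimately show ?thesis by (rule finite_imageD[rotated])
  qed
  then have "finite (\<Union>V\<in>\<F>. {p \<in> V. F p = y})" using \<F>(1) by blast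
  then show ?thesis by (rule rev_finite_subset) (use \<F>(3) in auto)
qed

end

section \<open>Hypersurfaces with tangent position vector\<close>

locale radial_hypersurface = immersed_hypersurface M \<A> F
  for M :: "'a topology" and \<A> :: "('a, 'n::finite) chart set" and F :: "'a \<Rightarrow> real^'m::finite" +
  assumes compact: "compact_space M"
    and connected: "connected_space M" "topspace M \<noteq> {}"
    and in_ball: "F ` topspace M \<subseteq> cball 0 1"
    and sphere: "F ` manifold_boundary \<A> \<subseteq> sphere 0 1"
    and radial: "\<And>p. p \<in> topspace M \<Longrightarrow> F p \<bullet> normal p = 0"
begin

lemma norm_le_1: "p \<in> topspace M \<Longrightarrow> norm (F p) \<le> 1"
  using in_ball by auto

lemma radial_tangent:
  assumes c: "c \<in> \<A>" and u: "u \<in> inner_coords c"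
  obtains X where "dird X (local_map c) u = F (chart_inv c u)"
proof -
  let ?p = "chart_inv c u"
  have p: "?p \<in> fst c" by (rule inner_chart_inv[OF u])
  define X :: "real^'n" where "X = (\<chi> k. \<Sum>l\<in>UNIV. matrix_inv (gram (tangent_vec c F ?p)) $ k $ l * (F ?p \<bullet> tangent_vec c F ?p l))"
  have "F ?p = tangential (tangent_vec c F ?p) (F ?p)"
    using expansion[OF c p, of "F ?p"] radial[of ?p] p chart_subset[OF c] by auto
  also have "\<dots> = (\<Sum>k\<in>UNIV. X $ k *\<^sub>R tangent_vec c F ?p k)"
    by (simp add: tangential_def X_def scaleR_sum_left)
  also have "\<dots> = dird X (local_map c) u"
    unfolding tangent_vec_inner[OF c u] by (rule dird_local_map[OF c u, symmetric])
  finally show ?thesis using that by metis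
qed

text \<open>At an interior point with \<open>|F| = 1\<close> the function \<open>|F|\<^sup>2\<close>
  would be maximal, but its derivative in the direction that is mapped to the position vector is
  2.\<close>

lemma norm_less_1:
  assumes c: "c \<in> \<A>" and u: "u \<in> inner_coords c"
  shows "norm (F (chart_inv c u)) < 1"
proof (rule ccontr)
  let ?p = "chart_inv c u"
  let ?I = "inner_coords c"
  have pM: "chart_inv c y \<in> topspace M" if "y \<in> ?I" for y
    using chart_subset[OF c] inner_chart_inv[OF that] by blast
  assume "\<not> norm (F ?p) < 1"
  then have F1: "norm (F ?p) = 1" using norm_le_1[OF pM[OF u]] by simp
  define s where "s y = local_map c y \<bullet> local_map c y" for y
  have "(s has_derivative (\<lambda>v. dird v s u)) (at u)"
    unfolding s_def[abs_def]
    by (rule Cinf_on_has_derivative[OF Cinf_on_inner[OF open_inner_coords[OF c] local_map_Cinf[OF c] local_map_Cinf[OF c]] u])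
  moreover have "\<forall>y\<in>?I. s y \<le> s u"
  proof
    fix y assume "y \<in> ?I"
    then have "norm (local_map c y) \<le> 1" using norm_le_1[OF pM] by simp
    then show "s y \<le> s u" using F1 by (simp add: s_def dot_square_norm power_le_one)
  qed
  ultimately have 0: "(\<lambda>v. dird v s u) = (\<lambda>v. 0)"
    using differential_zero_maxmin[OF u open_inner_coords[OF c]] by blast
  obtain X where X: "dird X (local_map c) u = F ?p" using radial_tangent[OF c u] .
  have "dird X s u = 2 * (F ?p \<bullet> F ?p)"
    unfolding s_def[abs_def]
    using dird_inner[OF local_map_Cinf[OF c] local_map_Cinf[OF c] u, where v = X] X by (simp add: o_def)
  then show False using fun_cong[OF 0, of X] F1 by (simp add: dot_square_norm)
qed

lemma norm_less_1_iff:
  assumes c: "c \<in> \<A>" "p \<in> fst c"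
  shows "norm (F p) < 1 \<longleftrightarrow> snd c p \<in> inner_coords c"
proof
  assume "norm (F p) < 1"
  then have "p \<notin> manifold_boundary \<A>" using sphere by auto
  then have "snd c p $ bdry_coord \<noteq> 0" using c by (auto simp: manifold_boundary_def)
  then show "snd c p \<in> inner_coords c"
    using coords_half_space[OF c(1), of "snd c p"] c(2) by (auto simp: inner_coords_def)
next
  assume "snd c p \<in> inner_coords c"
  from norm_less_1[OF c(1) this] show "norm (F p) < 1" by (simp add: chart_inv_left[OF c])
qed

text \<open>Differentiating \<open>N \<bullet> F = 0\<close> shows that every derivative of
  \<open>N\<close> is orthogonal to \<open>F\<close>, so the second fundamental form vanishes when
  one entry is \<open>X\<close>. By its symmetry the derivative of \<open>N\<close> along
  \<open>X\<close> has no tangential part; it has no normal part because \<open>N\<close> has unit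
  length.\<close>

lemma radial_normal_derivative:
  assumes c: "c \<in> \<A>" and W: "open W" "u \<in> W" "W \<subseteq> inner_coords c"
    and N: "Cinf_on N W" "\<And>y. y \<in> W \<Longrightarrow> norm (N y) = 1"
      "\<And>y i. y \<in> W \<Longrightarrow> N y \<bullet> tangent_vec c F (chart_inv c y) i = 0"
    and X: "dird X (local_map c) u = F (chart_inv c u)"
  shows "dird X N u = 0"
proof -
  let ?G = "local_map c"
  let ?t = "tangent_vec c F (chart_inv c u)"
  have G: "Cinf_on ?G W" by (rule Cinf_on_subset[OF local_map_Cinf[OF c] W(3)])
  have WI: "y \<in> inner_coords c" if "y \<in> W" for y using W that by blast
  have p: "chart_inv c u \<in> fst c" by (rule inner_chart_inv[OF WI[OF W(2)]])
  have Nt: "N y \<bullet> dird v ?G y = 0" if y: "y \<in> W" for v y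
    unfolding dird_local_map[OF c WI[OF y], of v] tangent_vec_inner[OF c WI[OF y], symmetric]
    by (simp add: inner_sum_right N(3)[OF y])
  have NG: "N y \<bullet> ?G y = 0" if y: "y \<in> W" for y
  proof -
    obtain X where "dird X ?G y = F (chart_inv c y)" using radial_tangent[OF c WI[OF y]] .
    then show ?thesis using Nt[OF y, of X] by simp
  qed
  have 1: "dird k N u \<bullet> ?G u = 0" for k
    using dird_eq_const[OF W(1,2) NG, where v = k] dird_inner[OF N(1) G W(2), where v = k] Nt[OF W(2), of k] by (simp add: o_def)
  have 2: "dird k N u \<bullet> dird v ?G u + N u \<bullet> dird k (dird v ?G) u = 0" for k v
    using dird_eq_const[OF W(1,2) Nt[where v = v], where v = k] dird_inner[OF N(1) Cinf_on_dird[OF G, where v = v] W(2), where v = k] by (simp add: add.commute)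
  have tan: "dird X N u \<bullet> dird k ?G u = 0" for k
  proof -
    have "dird X N u \<bullet> dird k ?G u = - (N u \<bullet> dird k (dird X ?G) u)"
      using 2[of X k] dird_commute[OF W(1,2) G, of k X] by simp
    also have "\<dots> = dird k N u \<bullet> dird X ?G u" using 2[of k X] by simp
    also have "\<dots> = 0" using 1[of k] X by simp
    finally show ?thesis .
  qed
  have nor: "dird X N u \<bullet> N u = 0"
  proof -
    have "N y \<bullet> N y = 1" if "y \<in> W" for y using N(2)[OF that] by (simp add: dot_square_norm)
    then show ?thesis
      using dird_eq_const[OF W(1,2), where f = "\<lambda>y. N y \<bullet> N y" and c = 1 and v = X] dird_inner[OF N(1) N(1) W(2), where v = X]
      by (simp add: inner_commute)
  qed
  have "tangential ?t (dird X N u) = 0"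
    unfolding tangential_def tangent_vec_inner[OF c WI[OF W(2)]] by (simp add: tan)
  then show ?thesis
    using hypersurface_expansion[OF tangent_indep[OF c p] card N(2)[OF W(2)] N(3)[OF W(2)], of "dird X N u"] nor
    by simp
qed

definition zeros :: "'a set" where "zeros = {p \<in> topspace M. F p = 0}"

lemma finite_zeros: "finite zeros"
  unfolding zeros_def by (rule finite_fibre[OF compact])

text \<open>For points of \<open>M\<close> this vanishes exactly where the normal agrees up to sign
  with the normal at some zero of \<open>F\<close>. If there were no zeros, the empty product would
  be 1, which is how their existence is proved later.\<close>

definition normal_defect :: "'a \<Rightarrow> real" where
  "normal_defect p = (\<Prod>z\<in>zeros. 1 - (normal z \<bullet> normal p)\<^sup>2)"

lemma normal_defect_nonneg: "p \<in> topspace M \<Longrightarrow> 0 \<le> normal_defect p"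
  unfolding normal_defect_def
proof (intro prod_nonneg)
  fix z assume "p \<in> topspace M" "z \<in> zeros"
  then show "0 \<le> 1 - (normal z \<bullet> normal p)\<^sup>2"
    using Cauchy_Schwarz_ineq[of "normal z" "normal p"] normal(1) by (simp add: zeros_def dot_square_norm)
qed

lemma normal_defect_zero:
  assumes q: "q \<in> topspace M" "norm (F q) < 1"
  shows "normal_defect q = 0"
proof (rule ccontr)
  assume "normal_defect q \<noteq> 0"
  then have "normal_defect q > 0" using normal_defect_nonneg[OF q(1)] by simp
  define H where "H p = normal_defect p * (1 - F p \<bullet> F p)" for p
  have Hq: "H q > 0"
    using q(2) \<open>normal_defect q > 0\<close> by (simp add: H_def dot_square_norm power_less_one_iff)
  have "continuous_map M euclidean H"
  proof (rule continuous_map_charts)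
    fix c assume c: "c \<in> \<A>"
    have 1: "continuous_on (coords c) (\<lambda>u. F (chart_inv c u))"
      using continuous_on_chart[OF c continuous_map_F] by (simp add: o_def)
    have 2: "continuous_on (coords c) (\<lambda>u. (normal z \<bullet> normal (chart_inv c u))\<^sup>2)" for z
      using continuous_on_chart[OF c continuous_normal_component[of "\<lambda>_. normal z"]] by (simp add: o_def)
    show "continuous_on (coords c) (H \<circ> chart_inv c)"
      unfolding H_def normal_defect_def o_def
      by (intro continuous_on_mult continuous_on_prod continuous_on_diff continuous_on_const continuous_on_inner 1 2)
  qed
  then have "compact (H ` topspace M)"
    using image_compactin[of M "topspace M" euclidean H] compact by (simp add: compact_space_def)
  then obtain p where p: "p \<in> topspace M" and max: "\<And>r. r \<in> topspace M \<Longrightarrow> H r \<le> H p"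
    using compact_attains_sup[of "H ` topspace M"] q by (metis (no_types, lifting) empty_iff imageE imageI)
  have Hp: "H p > 0" using Hq max[OF q(1)] by simp
  have "norm (F p) \<noteq> 1" using Hp by (auto simp: H_def dot_square_norm)
  then have "norm (F p) < 1" using norm_le_1[OF p] by simp
  obtain c where c: "c \<in> \<A>" "p \<in> fst c" using chart_cover p by blast
  define u where "u = snd c p"
  have u: "u \<in> inner_coords c" using norm_less_1_iff[OF c] \<open>norm (F p) < 1\<close> by (simp add: u_def)
  have cu: "chart_inv c u = p" using chart_inv_left[OF c] by (simp add: u_def)
  obtain W N where W: "open W" "u \<in> W" "W \<subseteq> inner_coords c" and N: "Cinf_on N W" "N u = normal p"
    "\<And>y. y \<in> W \<Longrightarrow> norm (N y) = 1" "\<And>y i. y \<in> W \<Longrightarrow> N y \<bullet> tangent_vec c F (chart_inv c y) i = 0"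
    using smooth_normal[OF c(1) u, of "normal p"] normal[OF p] c cu by metis
  obtain X where X: "dird X (local_map c) u = F (chart_inv c u)" using radial_tangent[OF c(1) u] .
  have NX: "dird X N u = 0" by (rule radial_normal_derivative[OF c(1) W N(1,3,4) X])
  \<comment> \<open>The defect as a polynomial in the normal vector; being even, it may be evaluated
    on the smooth local field \<open>N\<close>.\<close>
  define R where "R w = (\<Prod>z\<in>zeros. 1 - (normal z \<bullet> w) * (normal z \<bullet> w))" for w
  have "Cinf_on R UNIV"
    unfolding R_def[abs_def]
    by (intro Cinf_on_prod Cinf_on_diff Cinf_on_mult Cinf_on_inner Cinf_on_const Cinf_on_ident open_UNIV)
  then have Rder: "(R has_derivative (\<lambda>v. dird v R (N u))) (at (N u))" by (rule Cinf_on_has_derivative) simp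
  have RN: "((\<lambda>y. R (N y)) has_derivative (\<lambda>v. dird (dird v N u) R (N u))) (at u)"
    by (rule has_derivative_compose[OF Cinf_on_has_derivative[OF N(1) W(2)] Rder])
  have G: "(local_map c has_derivative (\<lambda>v. dird v (local_map c) u)) (at u)"
    by (rule Cinf_on_has_derivative[OF local_map_Cinf[OF c(1)] u])
  define f where "f y = R (N y) * (1 - local_map c y \<bullet> local_map c y)" for y
  define f' where "f' v = R (N u) * (0 - (local_map c u \<bullet> dird v (local_map c) u + dird v (local_map c) u \<bullet> local_map c u))
      + dird (dird v N u) R (N u) * (1 - local_map c u \<bullet> local_map c u)" for v
  have fder: "(f has_derivative f') (at u)"
    unfolding f_def[abs_def] f'_def[abs_def]
    by (intro has_derivative_mult has_derivative_diff has_derivative_const has_derivative_inner RN G)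
  have RH: "R (N y) = normal_defect (chart_inv c y)" if y: "y \<in> W" for y
  proof -
    have "N y = normal (chart_inv c y) \<or> N y = - normal (chart_inv c y)"
      using W y by (intro normal_unique[OF c(1) inner_chart_inv[of y c] N(3)[OF y] N(4)[OF y]]) blast
    then show ?thesis by (auto simp: R_def normal_defect_def power2_eq_square)
  qed
  have "\<forall>y\<in>W. f y \<le> f u"
  proof
    fix y assume y: "y \<in> W"
    have "chart_inv c y \<in> topspace M"
      using inner_chart_inv[OF subsetD[OF W(3) y]] chart_subset[OF c(1)] by blast
    then show "f y \<le> f u" using max RH[OF y] RH[OF W(2)] by (simp add: f_def H_def cu)
  qed
  then have "f' = (\<lambda>v. 0)" using differential_zero_maxmin[OF W(2,1) fder] by blast
  then have "f' X = 0" by (rule fun_cong)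
  moreover have "dird 0 R (N u) = 0" using has_derivative_linear[OF Rder] linear_0 by blast
  ultimately have "normal_defect p * (F p \<bullet> F p) = 0"
    using X by (simp add: f'_def NX RH[OF W(2)] cu)
  moreover have "normal_defect p \<noteq> 0" using Hp by (auto simp: H_def)
  ultimately have "p \<in> zeros" using p by (simp add: zeros_def)
  \<comment> \<open>The factor of the product that belongs to \<open>z = p\<close> is 0.\<close>
  then have "normal_defect p = 0"
    unfolding normal_defect_def using finite_zeros normal(1)[OF p] by (auto simp: dot_square_norm intro!: bexI[of _ p])
  then show False using \<open>normal_defect p \<noteq> 0\<close> by blast
qed

text \<open>Boundary points are limits of points with positive boundary coordinate, where
  \<open>norm_less_1\<close> applies.\<close>

lemma ex_inner_point:
  assumes "openin M U" "p \<in> U"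
  obtains q where "q \<in> U" "norm (F q) < 1"
proof -
  have "p \<in> topspace M" using assms openin_subset by blast
  then obtain c where c: "c \<in> \<A>" "p \<in> fst c" using chart_cover by blast
  obtain r where r: "r > 0" "\<And>y. y \<in> ball (snd c p) r \<Longrightarrow> y \<in> half_space \<Longrightarrow> y \<in> coords c \<and> chart_inv c y \<in> U"
    using chart_ball[OF c assms] by blast
  obtain x where x: "x \<in> ball (snd c p) r" "0 < x $ bdry_coord"
    using inner_coords_approach[OF coords_half_space[OF c(1)] r(1)] c(2) by blast
  have "x \<in> coords c" "chart_inv c x \<in> U" using r(2)[of x] x by (auto simp: half_space_def)
  moreover from this have "x \<in> inner_coords c" using x(2) by (auto simp: inner_coords_def)
  ultimately show ?thesis using norm_less_1[OF c(1)] that by blast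
qed

lemma normal_constant:
  obtains \<nu> where "norm \<nu> = 1" "\<And>p. p \<in> topspace M \<Longrightarrow> normal p = \<nu> \<or> normal p = - \<nu>"
proof -
  obtain q where q: "q \<in> topspace M" "norm (F q) < 1"
    using ex_inner_point[of "topspace M"] connected(2) by blast
  \<comment> \<open>Otherwise the empty product would be 1, against
    \<open>normal_defect_zero\<close>.\<close>
  have "zeros \<noteq> {}"
    using normal_defect_zero[OF q] by (auto simp: normal_defect_def)
  then obtain z0 where z0: "z0 \<in> topspace M" "z0 \<in> zeros" by (auto simp: zeros_def)
  define f where "f p = (normal z0 \<bullet> normal p)\<^sup>2" for p
  have f: "continuous_map M euclidean f"
    unfolding f_def[abs_def] by (rule continuous_normal_component) simp
  have same: "normal p = normal z \<or> normal p = - normal z"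
    if "p \<in> topspace M" "z \<in> topspace M" "(normal z \<bullet> normal p)\<^sup>2 = 1" for p z
  proof -
    have "normal z \<bullet> normal p = 1 \<or> normal z \<bullet> normal p = - 1" using that(3) by (simp add: power2_eq_1_iff)
    moreover have "normal z \<bullet> normal z = 1" "normal p \<bullet> normal p = 1" using normal(1) that by (auto simp: dot_square_norm)
    ultimately have "(normal p - normal z) \<bullet> (normal p - normal z) = 0 \<or> (normal p + normal z) \<bullet> (normal p + normal z) = 0"
      by (auto simp: inner_simps inner_commute)
    then show ?thesis by (auto simp: eq_neg_iff_add_eq_0)
  qed
  define T where "T = (\<lambda>z. (normal z0 \<bullet> normal z)\<^sup>2) ` zeros"
  have "finite T" using finite_zeros by (simp add: T_def)
  have inner: "f p \<in> T" if p: "p \<in> topspace M" "norm (F p) < 1" for p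
  proof -
    obtain z where z: "z \<in> zeros" "1 - (normal z \<bullet> normal p)\<^sup>2 = 0"
      using normal_defect_zero[OF p] finite_zeros by (auto simp: normal_defect_def)
    then have "normal p = normal z \<or> normal p = - normal z"
      by (intro same) (auto simp: p zeros_def)
    then show ?thesis using z(1) by (auto simp: f_def T_def)
  qed
  have "f ` topspace M \<subseteq> T"
  \<comment> \<open>Points with \<open>|F| < 1\<close> are dense and the finite set \<open>T\<close>
    is closed, so boundary points contribute no further values.\<close>
  proof (rule ccontr)
    assume "\<not> f ` topspace M \<subseteq> T"
    then obtain p where "p \<in> topspace M" "f p \<notin> T" by blast
    then have "p \<in> {p \<in> topspace M. f p \<in> - T}" by simp
    moreover have "openin M {p \<in> topspace M. f p \<in> - T}"
      using openin_continuous_map_preimage[OF f, of "- T"] finite_imp_closed[OF \<open>finite T\<close>] by (simp add: open_Compl)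
    ultimately show False using ex_inner_point inner by (metis (mono_tags, lifting) ComplD mem_Collect_eq)
  qed
  then have "finite (f ` topspace M)" using \<open>finite T\<close> finite_subset by blast
  moreover have "connected (f ` topspace M)"
    using connectedin_continuous_map_image[OF f, of "topspace M"] connected(1) by (simp add: connectedin_topspace)
  moreover have "f z0 = 1" using normal(1)[OF z0(1)] by (simp add: f_def dot_square_norm)
  ultimately have "f p = 1" if "p \<in> topspace M" for p
    using that z0(1) connected_finite_iff_sing[of "f ` topspace M"] by (metis imageI empty_iff singletonD)
  then show ?thesis using that[OF normal(1)[OF z0(1)]] same[OF _ z0(1)] by (simp add: f_def)
qed

text \<open>The coordinate tangent fields are orthogonal to the fixed vector \<open>\<nu>\<close>
  throughout the chart, boundary included. Differentiating, so are the second derivatives, which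
  then have no normal component.\<close>

lemma totally_geodesic_if_normal_constant:
  assumes \<nu>: "\<And>p. p \<in> topspace M \<Longrightarrow> normal p = \<nu> \<or> normal p = - \<nu>"
  shows "totally_geodesic \<A> F"
  unfolding totally_geodesic_def
proof (intro ballI allI)
  fix c p i j assume c: "c \<in> \<A>" "p \<in> fst c"
  let ?X = "partial_in c j (local_map c)"
  have t: "?X u \<bullet> \<nu> = 0" if u: "u \<in> coords c" for u
  proof -
    have q: "chart_inv c u \<in> fst c" by (rule chart_inv_in[OF u])
    then have qM: "chart_inv c u \<in> topspace M" using chart_subset[OF c(1)] by blast
    have "tangent_vec c F (chart_inv c u) j \<bullet> \<nu> = 0"
      using normal(2)[OF qM c(1) q, of j] \<nu>[OF qM] by (auto simp: inner_commute)
    then show ?thesis by (simp add: tangent_vec_def chart_inv_right[OF u])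
  qed
  define u where "u = snd c p"
  have u: "u \<in> coords c" using c by (simp add: u_def)
  obtain W g where W: "open W" "u \<in> W" "Cinf_on g W"
    "\<And>y v. y \<in> W \<inter> coords c \<Longrightarrow> frechet_derivative (local_map c) (at y within coords c) v = dird v g y"
    using smooth_on_extension[OF local_map_smooth[OF c(1)] chart(2)[OF c(1)] u] by metis
  obtain r where r: "r > 0" "ball u r \<subseteq> W" using W openE by blast
  have "(?X has_derivative (\<lambda>v. dird v (dird (axis j 1) g) u)) (at u within coords c)"
    by (rule has_derivative_transform_within[OF has_derivative_at_withinI[OF Cinf_on_has_derivative[OF Cinf_on_dird[OF W(3)] W(2)]] r(1) u])
      (use r W(4) in \<open>auto simp: partial_in_def dist_commute subset_eq\<close>)
  then have X: "(?X has_derivative frechet_derivative ?X (at u within coords c)) (at u within coords c)"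
    by (metis differentiableI frechet_derivative_works)
  have "((\<lambda>y. ?X y \<bullet> \<nu>) has_derivative (\<lambda>v. frechet_derivative ?X (at u within coords c) v \<bullet> \<nu>)) (at u within coords c)"
    by (rule has_derivative_inner_left[OF X])
  moreover have "((\<lambda>y. ?X y \<bullet> \<nu>) has_derivative (\<lambda>v. 0)) (at u within coords c)"
    by (rule has_derivative_transform[OF u t has_derivative_const])
  ultimately have "(\<lambda>v. frechet_derivative ?X (at u within coords c) v \<bullet> \<nu>) = (\<lambda>v. 0)"
    by (rule half_space_derivative_unique[OF chart(2)[OF c(1)] u])
  then have "second_partial c F p i j \<bullet> \<nu> = 0"
    unfolding second_partial_def partial_in_def[of c i] u_def[symmetric] by (rule fun_cong)
  then have "second_partial c F p i j \<bullet> normal p = 0"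
    using \<nu>[OF subsetD[OF chart_subset[OF c(1)] c(2)]] by auto
  then show "second_fundamental_form c F p i j = 0" by (simp add: second_fundamental_form_eq[OF c])
qed

text \<open>Away from the boundary this is invariance of domain in the hyperplane. Near a boundary
  point \<open>F\<close> is extended to \<open>g\<close>; the boundary is mapped to the unit sphere,
  and this separates the images of the two sides: whatever \<open>g\<close> covers of the disk near
  \<open>F p\<close> already comes from the half-space, that is, from \<open>F\<close>.\<close>

lemma open_map_disk:
  assumes \<nu>: "norm \<nu> = 1" and plane: "\<And>p. p \<in> topspace M \<Longrightarrow> \<nu> \<bullet> F p = 0"
  shows "open_map M (top_of_set {x \<in> cball 0 1. \<nu> \<bullet> x = 0}) F"
  unfolding open_map_def
proof (intro allI impI)
  fix U assume U: "openin M U"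
  define V where "V = {x. \<nu> \<bullet> x = 0}"
  define D where "D = {x \<in> cball 0 1. \<nu> \<bullet> x = 0}"
  \<comment> \<open>Orthogonal projection to the hyperplane. It fixes the image of \<open>F\<close>,
    and it brings the target dimension of the extension down to \<open>CARD('n)\<close>, as
    invariance of domain requires.\<close>
  define P where "P x = x - (x \<bullet> \<nu>) *\<^sub>R \<nu>" for x
  have "linear P" unfolding P_def by (intro linearI) (simp_all add: algebra_simps inner_simps)
  have V: "subspace V" unfolding V_def by (rule subspace_hyperplane)
  have "\<nu> \<noteq> 0" using \<nu> by auto
  then have dimV: "dim V \<le> dim (UNIV :: (real^'n) set)"
    using card by (simp add: V_def dim_hyperplane)
  have PV: "range P \<subseteq> V" using \<nu> by (auto simp: P_def V_def inner_simps dot_square_norm inner_commute)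
  have PF: "P (F p) = F p" if "p \<in> topspace M" for p using plane[OF that] by (simp add: P_def inner_commute)
  have UM: "U \<subseteq> topspace M" using U openin_subset by blast
  have FD: "F p \<in> D" if "p \<in> topspace M" for p using plane[OF that] norm_le_1[OF that] by (simp add: D_def)
  have "\<exists>\<rho>>0. ball (F p) \<rho> \<inter> D \<subseteq> F ` U" if p: "p \<in> U" for p
  proof -
    have pM: "p \<in> topspace M" using p UM by blast
    obtain c where c: "c \<in> \<A>" "p \<in> fst c" using chart_cover pM by blast
    define u where "u = snd c p"
    have u: "u \<in> coords c" using c by (simp add: u_def)
    have cu: "chart_inv c u = p" using chart_inv_left[OF c] by (simp add: u_def)
    obtain r1 where r1: "r1 > 0" "\<And>y. y \<in> ball u r1 \<Longrightarrow> y \<in> half_space \<Longrightarrow> y \<in> coords c \<and> chart_inv c y \<in> U"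
      using chart_ball[OF c U p] unfolding u_def by blast
    obtain r2 g where r2: "r2 > 0" and g: "Cinf_on g (ball u r2)" "inj_on g (ball u r2)" "g ` ball u r2 \<subseteq> range P"
      "\<And>y. y \<in> ball u r2 \<Longrightarrow> y \<in> coords c \<Longrightarrow> g y = F (chart_inv c y)"
      by (rule injective_extension[OF c(1) u \<open>linear P\<close> PF]) (assumption, rule that)
    \<comment> \<open>Off the boundary the ball is taken small enough to stay in the
      half-space.\<close>
    define r where "r = (if u $ bdry_coord > 0 then min (u $ bdry_coord) (min r1 r2) else min r1 r2)"
    define B where "B = ball u r"
    have r: "r > 0" "r \<le> r1" "r \<le> r2" using r1 r2 by (auto simp: r_def)
    have B: "B \<subseteq> ball u r1" "B \<subseteq> ball u r2" "open B" "u \<in> B" using r by (auto simp: B_def)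
    have gF: "g y \<in> F ` U" "y \<in> coords c" "g y = F (chart_inv c y)" if "y \<in> B" "y \<in> half_space" for y
    proof -
      have "y \<in> coords c \<and> chart_inv c y \<in> U" using r1(2)[of y] that B(1) by blast
      then show "y \<in> coords c" "g y = F (chart_inv c y)" "g y \<in> F ` U" using g(4)[of y] that B(2) by auto
    qed
    have gu: "g u = F p" using gF(3)[OF B(4)] coords_half_space[OF c(1) u] cu by (simp add: half_space_def)
    have contg: "continuous_on B g" using Cinf_on_continuous[OF g(1)] B(2) continuous_on_subset by blast
    have injg: "inj_on g B" using g(2) B(2) inj_on_subset by blast
    have gV: "g y \<in> V" if "y \<in> B" for y using g(3) B(2) PV that by blast
    have ope: "openin (top_of_set V) (g ` B')" if "open B'" "B' \<subseteq> B" for B'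
    proof (rule invariance_of_domain_subspaces[OF _ subspace_UNIV V dimV])
      show "openin (top_of_set UNIV) B'" using that(1) by simp
      show "continuous_on B' g" using contg that(2) continuous_on_subset by blast
      show "inj_on g B'" using injg that(2) inj_on_subset by blast
    qed (use gV that(2) in auto)
    obtain \<rho> where \<rho>: "\<rho> > 0" "ball (F p) \<rho> \<inter> V \<subseteq> g ` B"
      using ope[OF B(3) subset_refl] B(4) gu unfolding openin_contains_ball by (metis imageI)
    have DV: "D \<subseteq> V" by (auto simp: D_def V_def)
    show ?thesis
    proof (cases "u $ bdry_coord > 0")
      case True
      have "y \<in> half_space" if "y \<in> B" for y
      proof -
        have "\<bar>(u - y) $ bdry_coord\<bar> \<le> norm (u - y)" by (rule component_le_norm_cart)
        also have "\<dots> < u $ bdry_coord" using that True by (simp add: B_def r_def dist_norm)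
        finally show ?thesis by (simp add: half_space_def)
      qed
      then have "g ` B \<subseteq> F ` U" using gF(1) by blast
      then have "ball (F p) \<rho> \<inter> D \<subseteq> F ` U"
        using \<rho>(2) DV by (meson Int_mono order_refl order_trans)
      then show ?thesis using \<rho>(1) by auto
    next
      case False
      define pos where "pos = B \<inter> {x. 0 < x $ bdry_coord}"
      define neg where "neg = B \<inter> {x. x $ bdry_coord < 0}"
      \<comment> \<open>A convex piece of the hyperplane inside the open unit ball. It misses the
        image of the points with boundary coordinate 0, so the disjoint open images of
        \<open>pos\<close> and \<open>neg\<close> cover it; being connected and meeting the first,
        it lies in the first.\<close>
      define C where "C = ball (F p) \<rho> \<inter> V \<inter> ball 0 1"
      have pn: "open pos" "open neg" "pos \<subseteq> B" "neg \<subseteq> B"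
        unfolding pos_def neg_def using B(3) by (auto intro!: open_Int open_Collect_less continuous_intros)
      have CB: "C \<subseteq> g ` B" using \<rho>(2) by (auto simp: C_def)
      have CV: "C \<subseteq> V" by (auto simp: C_def)
      have zero: "norm (g x) = 1" if "x \<in> B" "x $ bdry_coord = 0" for x
      proof -
        have h: "x \<in> half_space" using that(2) by (simp add: half_space_def)
        have "chart_inv c x \<in> manifold_boundary \<A>"
          unfolding manifold_boundary_def
          using c(1) chart_inv_in[OF gF(2)[OF that(1) h]] chart_inv_right[OF gF(2)[OF that(1) h]] that(2) by auto
        then show ?thesis using sphere gF(3)[OF that(1) h] by auto
      qed
      have "connected C"
        unfolding C_def by (intro convex_connected convex_Int convex_ball subspace_imp_convex V)
      have cover: "C \<subseteq> g ` pos \<union> g ` neg"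
      proof
        fix y assume y: "y \<in> C"
        then obtain x where x: "x \<in> B" "y = g x" using CB by blast
        have "norm (g x) \<noteq> 1" using y x(2) by (simp add: C_def)
        then have "x $ bdry_coord \<noteq> 0" using zero[OF x(1)] by blast
        then have "x \<in> pos \<union> neg" using x(1) by (auto simp: pos_def neg_def)
        then show "y \<in> g ` pos \<union> g ` neg" using x(2) by blast
      qed
      have disj: "g ` pos \<inter> g ` neg = {}"
      proof -
        have "pos \<inter> neg = {}" by (auto simp: pos_def neg_def)
        then show ?thesis using inj_on_image_Int[OF injg pn(3,4)] by simp
      qed
      have meets: "C \<inter> g ` pos \<noteq> {}"
      proof -
        have "isCont g u" using contg B(3,4) continuous_on_eq_continuous_at by blast
        then obtain d where d: "d > 0" "\<And>x. dist x u < d \<Longrightarrow> dist (g x) (g u) < \<rho>"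
          using \<rho>(1) unfolding continuous_at_eps_delta by blast
        obtain x where x: "x \<in> ball u (min d r)" "0 < x $ bdry_coord"
          using inner_coords_approach[OF coords_half_space[OF c(1) u], of "min d r"] d(1) r(1) by auto
        have xB: "x \<in> B" using x(1) by (simp add: B_def)
        have xh: "x \<in> half_space" using x(2) by (simp add: half_space_def)
        have "x \<in> inner_coords c" using gF(2)[OF xB xh] x(2) by (simp add: inner_coords_def)
        then have "norm (g x) < 1" using norm_less_1[OF c(1)] gF(3)[OF xB xh] by simp
        moreover have "dist (g x) (F p) < \<rho>" using d(2)[of x] x(1) gu by (simp add: dist_commute)
        ultimately have "g x \<in> C" using gV[OF xB] by (simp add: C_def dist_commute)
        moreover have "x \<in> pos" using xB x(2) by (simp add: pos_def)
        ultimately show ?thesis by blast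
      qed
      have Cpos: "C \<subseteq> g ` pos"
      proof (rule ccontr)
        assume "\<not> C \<subseteq> g ` pos"
        then have "C \<inter> g ` neg \<noteq> {}" using cover by blast
        have "openin (top_of_set C) (C \<inter> S)" if S: "openin (top_of_set V) S" for S
        proof -
          obtain T where T: "open T" "S = V \<inter> T" using S by (auto simp: openin_open)
          then have "C \<inter> S = C \<inter> T" using CV by blast
          then show ?thesis using T(1) by (simp add: openin_open_Int)
        qed
        from this[OF ope[OF pn(1,3)]] this[OF ope[OF pn(2,4)]]
        have o: "openin (top_of_set C) (C \<inter> g ` pos)" "openin (top_of_set C) (C \<inter> g ` neg)" .
        show False
          using \<open>connected C\<close> o meets \<open>C \<inter> g ` neg \<noteq> {}\<close> cover disj
          unfolding connected_openin by blast
      qed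
      have "ball (F p) \<rho> \<inter> D \<subseteq> F ` U"
      proof
        fix y assume y: "y \<in> ball (F p) \<rho> \<inter> D"
        then obtain x where x: "x \<in> B" "y = g x" using \<rho>(2) DV by blast
        \<comment> \<open>The point \<open>y\<close> may lie on the unit sphere, outside
          \<open>C\<close>. If it came from \<open>neg\<close>, scaling it slightly towards 0 would
          give a point of \<open>C\<close> that is still in the image of \<open>neg\<close>, which
          is open in the hyperplane.\<close>
        have "x \<notin> neg"
        proof
          assume "x \<in> neg"
          then obtain e where e: "e > 0" "ball y e \<inter> V \<subseteq> g ` neg"
            using ope[OF pn(2,4)] x(2) unfolding openin_contains_ball by blast
          define m where "m = min e (\<rho> - dist (F p) y)"
          have m: "m > 0" "m \<le> e" "m \<le> \<rho> - dist (F p) y" using e(1) y by (auto simp: m_def)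
          define s where "s = min 1 (m / 2)"
          have s: "0 < s" "s \<le> 1" "s < m" using m by (auto simp: s_def)
          let ?y = "(1 - s) *\<^sub>R y"
          have ny: "norm y \<le> 1" using y by (simp add: D_def)
          have "dist y ?y = s * norm y" using s by (simp add: dist_norm algebra_simps)
          also have "\<dots> \<le> s * 1" using ny s by (intro mult_left_mono) auto
          finally have dy: "dist y ?y < m" using s(3) by simp
          have "dist (F p) ?y < \<rho>" using dist_triangle[of "F p" ?y y] dy m(3) by linarith
          moreover have "norm ?y < 1"
          proof -
            have "norm ?y = (1 - s) * norm y" using s by simp
            also have "\<dots> \<le> (1 - s) * 1" using ny s by (intro mult_left_mono) auto
            finally show ?thesis using s by simp
          qed
          moreover have "?y \<in> V" using y DV V by (meson IntD2 subsetD subspace_scale)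
          ultimately have "?y \<in> C" by (simp add: C_def)
          moreover have "?y \<in> g ` neg" using e(2) dy m(2) \<open>?y \<in> V\<close> by auto
          ultimately show False using Cpos disj by blast
        qed
        then have "x \<in> half_space" using x(1) by (auto simp: neg_def half_space_def)
        then show "y \<in> F ` U" using gF(1)[OF x(1)] x(2) by simp
      qed
      then show ?thesis using \<rho>(1) by blast
    qed
  qed
  moreover have "F ` U \<subseteq> D" using FD UM by blast
  ultimately show "openin (top_of_set {x \<in> cball 0 1. \<nu> \<bullet> x = 0}) (F ` U)"
    unfolding D_def[symmetric] openin_contains_ball by blast
qed

lemma totally_geodesic_disk:
  "totally_geodesic \<A> F \<and>
    (\<exists>\<nu>. norm \<nu> = 1 \<and> homeomorphic_map M (top_of_set {x \<in> cball 0 1. \<nu> \<bullet> x = 0}) F)"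
proof -
  obtain \<nu> where \<nu>: "norm \<nu> = 1" "\<And>p. p \<in> topspace M \<Longrightarrow> normal p = \<nu> \<or> normal p = - \<nu>"
    using normal_constant by blast
  have plane: "\<nu> \<bullet> F p = 0" if "p \<in> topspace M" for p
    using radial[OF that] \<nu>(2)[OF that] by (auto simp: inner_commute)
  let ?D = "{x \<in> cball 0 1. \<nu> \<bullet> x = 0}"
  have D: "?D = cball 0 1 \<inter> {x. \<nu> \<bullet> x = 0}" by blast
  have "continuous_map M (top_of_set ?D) F"
    using continuous_map_F in_ball plane by (auto simp: continuous_map_in_subtopology)
  moreover have "convex ?D" unfolding D by (intro convex_Int convex_cball convex_hyperplane)
  moreover have "compact ?D" unfolding D by (intro compact_Int_closed compact_cball closed_hyperplane)
  ultimately have "homeomorphic_map M (top_of_set ?D) F"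
    by (intro open_immersion_onto_convex_body compact Hausdorff connected open_map_disk[OF \<nu>(1) plane] locally_inj_F) auto
  then show ?thesis using totally_geodesic_if_normal_constant[OF \<nu>(2)] \<nu>(1) by blast
qed

end

section \<open>The two pinching conditions and their barriers\<close>

theorem theorem1p1:
  fixes M :: "'a topology"
    and \<A> :: "('a, 'n::finite) chart set"
    and F :: "'a \<Rightarrow> real^'m::finite"
  assumes dim: "CARD('n) \<ge> 3" "CARD('m) = CARD('n) + 1"
    and manifold: "smooth_manifold_with_boundary M \<A>"
    and compact: "compact_space M"
    and connected: "connected_space M" "topspace M \<noteq> {}"
    and in_ball: "F ` topspace M \<subseteq> cball 0 1"
    and minimal: "minimal_immersion \<A> F"
    and free_boundary: "free_boundary_in_ball \<A> F"
    and pinching: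
      "(\<forall>c\<in>\<A>. \<forall>p\<in>fst c. sff_norm_sq c F p \<le> (real CARD('n))\<^sup>2 / 4) \<or>
       (\<forall>c\<in>\<A>. \<forall>p\<in>fst c. (norm (F p))\<^sup>2 * sff_norm_sq c F p \<le> (real CARD('n) - 2)\<^sup>2 / 4)"
  shows "totally_geodesic \<A> F \<and>
    (\<exists>\<nu>. norm \<nu> = 1 \<and> homeomorphic_map M (top_of_set {x \<in> cball 0 1. \<nu> \<bullet> x = 0}) F)"
proof -
  interpret minimal_hypersurface M \<A> F
    using dim(2) manifold minimal by unfold_locales (auto simp: minimal_immersion_def)
  define n where "n = real CARD('n)"
  have n: "n \<ge> 3" using dim(1) by (simp add: n_def)
  have norm1: "F p \<bullet> F p \<le> 1" if "c \<in> \<A>" "p \<in> fst c" for c p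
    using in_ball chart_subset[OF that(1)] that(2) by (auto simp: dot_square_norm power_le_one_iff subset_eq)
  have "F p \<bullet> normal p = 0" if p: "p \<in> topspace M" for p
    using pinching
  proof
    assume A: "\<forall>c\<in>\<A>. \<forall>p\<in>fst c. sff_norm_sq c F p \<le> (real CARD('n))\<^sup>2 / 4"
    show ?thesis
    proof (rule support_function_vanishes[where \<phi> = "\<lambda>t. exp (- n / 4 * t)" and \<phi>' = "\<lambda>t. - n / 4 * exp (- n / 4 * t)"
          and \<phi>'' = "\<lambda>t. n\<^sup>2 / 16 * exp (- n / 4 * t)" and K = "\<lambda>t. exp (n / 2 * t)",
          OF compact free_boundary _ _ _ _ _ _ _ p])
      fix t :: real
      show "((\<lambda>t. exp (- n / 4 * t)) has_real_derivative - n / 4 * exp (- n / 4 * t)) (at t)"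
        by (auto intro!: derivative_eq_intros)
      show "((\<lambda>t. - n / 4 * exp (- n / 4 * t)) has_real_derivative n\<^sup>2 / 16 * exp (- n / 4 * t)) (at t)"
        by (auto intro!: derivative_eq_intros simp: power2_eq_square)
      show "exp (n / 2 * t) * (exp (- n / 4 * t))\<^sup>2 = 1"
        by (simp add: exp_double[symmetric] exp_add[symmetric])
    next
      fix c p v assume cp: "c \<in> \<A>" "p \<in> fst c" and v: "0 < v" "v \<le> F p \<bullet> F p"
      define t where "t = F p \<bullet> F p"
      define E where "E = exp (- n / 4 * t)"
      have "4 * (n\<^sup>2 / 16 * E) * (t - v) + 2 * n * (- n / 4 * E) + sff_norm_sq c F p * E
        = E * (n\<^sup>2 / 4 * (t - v) - n\<^sup>2 / 2 + sff_norm_sq c F p)"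
        by (simp add: algebra_simps power2_eq_square)
      also have "\<dots> < 0"
      proof (rule mult_pos_neg)
        \<comment> \<open>Strictness comes from \<open>v > 0\<close>: as \<open>t \<le> 1\<close>,
          the difference \<open>t - v\<close> is below 1, and the remaining terms balance
          exactly.\<close>
        have "n\<^sup>2 / 4 * (t - v) < n\<^sup>2 / 4 * 1"
          using norm1[OF cp] v n by (intro mult_strict_left_mono) (auto simp: t_def)
        moreover have "sff_norm_sq c F p \<le> n\<^sup>2 / 4" using A cp by (auto simp: n_def)
        ultimately show "n\<^sup>2 / 4 * (t - v) - n\<^sup>2 / 2 + sff_norm_sq c F p < 0" by linarith
      qed (simp add: E_def)
      finally show "4 * (n\<^sup>2 / 16 * exp (- n / 4 * (F p \<bullet> F p))) * (F p \<bullet> F p - v) + real (2 * CARD('n)) * (- n / 4 * exp (- n / 4 * (F p \<bullet> F p)))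
        + sff_norm_sq c F p * exp (- n / 4 * (F p \<bullet> F p)) < 0"
        by (simp add: t_def E_def n_def)
    qed (auto intro!: continuous_intros)
  next
    assume A: "\<forall>c\<in>\<A>. \<forall>p\<in>fst c. (norm (F p))\<^sup>2 * sff_norm_sq c F p \<le> (real CARD('n) - 2)\<^sup>2 / 4"
    \<comment> \<open>The barrier is a power of \<open>|F|\<close>, but \<open>t\<close> stands for
      \<open>|F|\<^sup>2\<close>, so the exponent is halved.\<close>
    define a where "a = - (n - 2) / 4"
    have a: "a < 0" using n by (simp add: a_def)
    show ?thesis
    \<comment> \<open>As \<open>a < 0\<close>, the function \<open>K\<close> is a positive power of
      \<open>t\<close> and continuous at 0, although the barrier is unbounded there. The convention
      \<open>0 powr a = 0\<close> satisfies the sign condition at 0.\<close>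
    proof (rule support_function_vanishes[where \<phi> = "\<lambda>t. t powr a" and \<phi>' = "\<lambda>t. a * t powr (a - 1)"
          and \<phi>'' = "\<lambda>t. a * ((a - 1) * t powr (a - 1 - 1))" and K = "\<lambda>t. t powr (- 2 * a)",
          OF compact free_boundary _ _ _ _ _ _ _ p])
      fix t :: real assume t: "t > 0"
      show "((\<lambda>t. t powr a) has_real_derivative a * t powr (a - 1)) (at t)"
        using t by (rule has_real_derivative_powr)
      show "((\<lambda>t. a * t powr (a - 1)) has_real_derivative a * ((a - 1) * t powr (a - 1 - 1))) (at t)"
        using t by (intro DERIV_cmult has_real_derivative_powr)
      show "t powr (- 2 * a) * (t powr a)\<^sup>2 = 1"
        using t by (simp add: power2_eq_square powr_add[symmetric])
    next
      fix c p v assume cp: "c \<in> \<A>" "p \<in> fst c" and v: "0 < v" "v \<le> F p \<bullet> F p"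
      define t where "t = F p \<bullet> F p"
      have t: "t > 0" using v unfolding t_def by linarith
      define E where "E = t powr (a - 1 - 1)"
      have E1: "t powr (a - 1) = t * E" and E0: "t powr a = t * (t * E)"
        using t by (simp_all add: E_def powr_diff power2_eq_square)
      have E: "E > 0" using t by (simp add: E_def)
      have "4 * (a * ((a - 1) * E)) * (t - v) + 2 * n * (a * (t * E)) + sff_norm_sq c F p * (t * (t * E))
        = E * (t * (4 * a * (a - 1) + 2 * n * a + t * sff_norm_sq c F p) - 4 * (a * (a - 1)) * v)"
        by (simp add: algebra_simps)
      also have "\<dots> < 0"
      proof (rule mult_pos_neg[OF E])
        \<comment> \<open>The value \<open>a\<close> is the double root of
          \<open>4 a^2 + 2 (n - 2) a + (n - 2)^2 / 4\<close>, so the pinching bound is used up and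
          the strict sign comes from the term with \<open>v\<close>, where
          \<open>a * (a - 1) > 0\<close>.\<close>
        have "4 * a * (a - 1) + 2 * n * a = - ((n - 2)\<^sup>2 / 4)"
          by (simp add: a_def power2_eq_square field_simps)
        moreover have "t * sff_norm_sq c F p \<le> (n - 2)\<^sup>2 / 4"
          using A cp by (auto simp: n_def t_def dot_square_norm)
        ultimately have "t * (4 * a * (a - 1) + 2 * n * a + t * sff_norm_sq c F p) \<le> 0"
          using t by (intro mult_nonneg_nonpos) auto
        moreover have "0 < 4 * (a * (a - 1)) * v" using a v by (simp add: mult_neg_neg)
        ultimately show "t * (4 * a * (a - 1) + 2 * n * a + t * sff_norm_sq c F p) - 4 * (a * (a - 1)) * v < 0" by linarith
      qed
      finally show "4 * (a * ((a - 1) * (F p \<bullet> F p) powr (a - 1 - 1))) * (F p \<bullet> F p - v)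
        + real (2 * CARD('n)) * (a * (F p \<bullet> F p) powr (a - 1)) + sff_norm_sq c F p * (F p \<bullet> F p) powr a < 0"
        using E0 E1 by (simp add: t_def E_def n_def)
    next
      show "continuous_on {0..} (\<lambda>t. t powr (- 2 * a))"
        using a by (intro continuous_on_powr' continuous_on_id continuous_on_const) auto
    qed auto
  qed
  then interpret radial_hypersurface M \<A> F
    using compact connected in_ball free_boundary by unfold_locales (auto simp: free_boundary_in_ball_def)
  show ?thesis by (rule totally_geodesic_disk)
qed

end
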